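(* Let $P_1$ be a probability measure on $\mathbb{R}^d$ with pdf $p_1$ such that $\mathbb{E}_{p_1}|h|<\infty$ for every $h\in\mathrm{Lip}(\Omega_{p_1},1)$. Suppose that $P_1$ has finite variance and satisfies a Poincaré inequality with Poincaré constant $C_{P_1}$. Let $h\in\mathrm{Lip}(\Omega_{p_1},1)$. Then there exists a function $g\in W^{1,2}_0(p_1)$ which satisfies $$\mathbb{E}_{p_1}\bigl[\langle\nabla v,\nabla g\rangle\bigr]=\mathbb{E}_{p_1}\bigl[(h-\mathbb{E}_{p_1}h)\,v\bigr]\qquad\text{for all } v\in W^{1,2}_0(p_1)$$ and is such that $$\sqrt{\mathbb{E}_{p_1}\|\nabla g\|^2}\le C_{P_1}.$$
   Context: The pdf $p_1$ (density with respect to Lebesgue measure) is assumed to have open support $\Omega_{p_1}=\{x:p_1(x)>0\}$ and to be continuous on $\Omega_{p_1}$. $\mathbb{E}_p f=\int_{\Omega_p}fp$. $\mathrm{Lip}(\Omega,1)$ is the set of Lipschitz functions $\Omega\to\mathbb{R}$ with Lipschitz constant $1$. A probability distribution $P$ satisfies a Poincaré inequality if there is a constant $C<\infty$ such that for every locally Lipschitz function $\varphi\in L^2(P)$ with $\mathbb{E}_P\varphi=0$ one has $\mathbb{E}_P\varphi^2\le C\,\mathbb{E}_P\|\nabla\varphi\|^2$; the smallest such constant is the Poincaré constant $C_P$. $W^{1,2}(p)$ is the weighted Sobolev space of weakly differentiable functions $u:\Omega_p\to\mathbb{R}$ with $\|u\|_{W^{1,2}(p)}^2=\|u\|_{L^2(p)}^2+\|\nabla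 u\|_{L^2(p)}^2<\infty$. $W^{1,2}_0(p)$ is the subspace of those $u\in W^{1,2}(p)$ with $\mathbb{E}_p u=0$. *)

theory Defs
  imports "HOL-Probability.Probability"
begin

(* Functions on an open set Omega are total functions whose values off Omega are never inspected:
   integrals, measurability and regularity conditions are all relative to Omega. *)

definition pdf_dom :: "('a::euclidean_space \<Rightarrow> real) \<Rightarrow> 'a set" where
  "pdf_dom p = {x. p x > 0}"

definition pexp :: "('a::euclidean_space \<Rightarrow> real) \<Rightarrow> ('a \<Rightarrow> real) \<Rightarrow> real" where
  "pexp p f = (LINT x:pdf_dom p|lebesgue. f x * p x)"

definition pintegrable :: "('a::euclidean_space \<Rightarrow> real) \<Rightarrow> ('a \<Rightarrow> real) \<Rightarrow> bool" where
  "pintegrable p f \<longleftrightarrow> set_integrable lebesgue (pdf_dom p) (\<lambda>x. f x * p x)"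

definition in_L2 :: "('a::euclidean_space \<Rightarrow> real) \<Rightarrow> ('a \<Rightarrow> 'b::real_normed_vector) \<Rightarrow> bool" where
  "in_L2 p f \<longleftrightarrow> set_borel_measurable lebesgue (pdf_dom p) f \<and> pintegrable p (\<lambda>x. (norm (f x))\<^sup>2)"

definition finite_variance :: "'a::euclidean_space measure \<Rightarrow> bool" where
  "finite_variance P \<longleftrightarrow> integrable P (\<lambda>x. x) \<and>
     integrable P (\<lambda>x. (norm (x - (LINT y|P. y)))\<^sup>2)"

definition Lip1 :: "'a::euclidean_space set \<Rightarrow> ('a \<Rightarrow> real) set" where
  "Lip1 \<Omega> = {h. 1-lipschitz_on \<Omega> h}"

definition locally_lipschitz_on :: "'a::euclidean_space set \<Rightarrow> ('a \<Rightarrow> real) \<Rightarrow> bool" where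
  "locally_lipschitz_on \<Omega> f \<longleftrightarrow> (\<forall>x\<in>\<Omega>. \<exists>e>0. \<exists>L. L-lipschitz_on (ball x e \<inter> \<Omega>) f)"

(* Classical gradient. A locally Lipschitz function on an open set is differentiable almost
   everywhere (Rademacher), so the value 0 at the remaining points does not affect integrals. *)
definition grad :: "('a::euclidean_space \<Rightarrow> real) \<Rightarrow> 'a \<Rightarrow> 'a" where
  "grad f x = (if f differentiable (at x)
     then (\<Sum>i\<in>Basis. frechet_derivative f (at x) i *\<^sub>R i) else 0)"

(* The test functions are locally Lipschitz on the open support of p only, not on the whole space.
   The right-hand side is an extended nonnegative integral, as it may be infinite. *)
definition poincare_with :: "('a::euclidean_space \<Rightarrow> real) \<Rightarrow> real \<Rightarrow> bool" where
  "poincare_with p C \<longleftrightarrow> C \<ge> 0 \<and>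
     (\<forall>\<phi>. locally_lipschitz_on (pdf_dom p) \<phi> \<and> in_L2 p \<phi> \<and> pexp p \<phi> = 0 \<longrightarrow>
        ennreal (pexp p (\<lambda>x. (\<phi> x)\<^sup>2))
          \<le> ennreal C * (\<integral>\<^sup>+x\<in>pdf_dom p. ennreal ((norm (grad \<phi> x))\<^sup>2 * p x) \<partial>lebesgue))"

definition poincare_inequality :: "('a::euclidean_space \<Rightarrow> real) \<Rightarrow> bool" where
  "poincare_inequality p \<longleftrightarrow> (\<exists>C. poincare_with p C)"

(* The set of admissible constants is closed, so the infimum is the smallest one. *)
definition poincare_constant :: "('a::euclidean_space \<Rightarrow> real) \<Rightarrow> real" where
  "poincare_constant p = Inf {C. poincare_with p C}"

primrec Ck :: "nat \<Rightarrow> ('a::euclidean_space \<Rightarrow> real) \<Rightarrow> bool" where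
  "Ck 0 f \<longleftrightarrow> continuous_on UNIV f"
| "Ck (Suc n) f \<longleftrightarrow> (\<forall>x. f differentiable (at x)) \<and>
     (\<forall>i\<in>Basis. Ck n (\<lambda>x. frechet_derivative f (at x) i))"

definition test_function :: "'a::euclidean_space set \<Rightarrow> ('a \<Rightarrow> real) \<Rightarrow> bool" where
  "test_function \<Omega> \<phi> \<longleftrightarrow> (\<forall>n. Ck n \<phi>) \<and>
     compact (closure {x. \<phi> x \<noteq> 0}) \<and> closure {x. \<phi> x \<noteq> 0} \<subseteq> \<Omega>"

definition locally_integrable_on ::
    "'a::euclidean_space set \<Rightarrow> ('a \<Rightarrow> 'b::{banach, second_countable_topology}) \<Rightarrow> bool" where
  "locally_integrable_on \<Omega> f \<longleftrightarrow> (\<forall>K. compact K \<and> K \<subseteq> \<Omega> \<longrightarrow> set_integrable lebesgue K f)"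

definition has_weak_gradient ::
    "'a::euclidean_space set \<Rightarrow> ('a \<Rightarrow> real) \<Rightarrow> ('a \<Rightarrow> 'a) \<Rightarrow> bool" where
  "has_weak_gradient \<Omega> u G \<longleftrightarrow> locally_integrable_on \<Omega> u \<and> locally_integrable_on \<Omega> G \<and>
     (\<forall>\<phi>. test_function \<Omega> \<phi> \<longrightarrow> (\<forall>i\<in>Basis.
        (LINT x:\<Omega>|lebesgue. u x * frechet_derivative \<phi> (at x) i)
          = - (LINT x:\<Omega>|lebesgue. (G x \<bullet> i) * \<phi> x)))"

definition weakly_differentiable :: "'a::euclidean_space set \<Rightarrow> ('a \<Rightarrow> real) \<Rightarrow> bool" where
  "weakly_differentiable \<Omega> u \<longleftrightarrow> (\<exists>G. has_weak_gradient \<Omega> u G)"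

(* A representative; weak gradients are unique up to null sets. *)
definition weak_grad :: "'a::euclidean_space set \<Rightarrow> ('a \<Rightarrow> real) \<Rightarrow> 'a \<Rightarrow> 'a" where
  "weak_grad \<Omega> u = (SOME G. has_weak_gradient \<Omega> u G)"

definition W12 :: "('a::euclidean_space \<Rightarrow> real) \<Rightarrow> ('a \<Rightarrow> real) set" where
  "W12 p = {u. weakly_differentiable (pdf_dom p) u \<and> in_L2 p u \<and> in_L2 p (weak_grad (pdf_dom p) u)}"

definition W12_0 :: "('a::euclidean_space \<Rightarrow> real) \<Rightarrow> ('a \<Rightarrow> real) set" where
  "W12_0 p = {u \<in> W12 p. pexp p u = 0}"

end

(* The weak equation is the Euler-Lagrange equation of v -> E|grad v|^2 - 2 E[(h - E h) v] on
   W^{1,2}_0(p). The functional is bounded below and its minimising sequences are Cauchy once the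
   Poincare inequality, assumed for locally Lipschitz functions only, holds on all of W^{1,2}_0(p).
   That extension is a Meyers-Serrin argument: p is bounded above and below on compact subsets of its
   open support, so v is approximated, together with its weak gradient, by sum_j zeta_j (eta_j * v)
   for a locally finite partition of unity (zeta_j) and mollifiers eta_j. As grad (sum_j zeta_j) = 0,
   the error in the gradient is sum_j zeta_j (eta_j * G - G) + sum_j (eta_j * v - v) grad zeta_j.
   Testing the equation with g gives E|grad g|^2 <= sd(h) sd(g) <= sqrt C * sqrt C * sqrt (E|grad g|^2)
   for each admissible constant C, because |grad h| <= 1. *)

theory Submission imports Defs
begin

section \<open>Smooth functions\<close>

text \<open>The support is an arbitrary open set and \<open>p\<close> may degenerate at its
  boundary, so nothing can be mollified across it: approximants live on the support only, each piece
  on a ball with room around it and with its own tolerance. Integrals are moved to a measure \<mu>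
  with density \<open>p\<close>. The weak gradient identity then pairs with multipliers
  \<open>\<phi> x / p x\<close> and \<open>frechet_derivative \<phi> (at x) i / p x\<close>, which
  are bounded because test functions have compact support. Hence weak gradients survive L^1(\<mu>)
  limits, the closedness that the variational argument requires. \<open>weak_grad\<close> is a
  choice, determined only almost everywhere. The variational problem is therefore posed for pairs of
  a function and a weak gradient, and uniqueness of weak gradients translates the result back.
  \<open>poincare_constant\<close> is an infimum. The solution is built from one admissible
  constant, but its equation does not mention that constant, so the bound holds for every admissible
  constant and passes to the infimum.\<close>

lemma Ck_SucI:
  assumes "\<And>x. (f has_derivative f' x) (at x)" "\<And>i. i \<in> Basis \<Longrightarrow> Ck n (\<lambda>x. f' x i)"
  shows "Ck (Suc n) f"
proof -
  have "frechet_derivative f (at x) = f' x" for x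
    using frechet_derivative_at[OF assms(1)] by simp
  then show ?thesis using assms(2) assms(1) by (auto simp: differentiable_def)
qed

lemma Ck_Suc_imp_Ck: "Ck (Suc n) f \<Longrightarrow> Ck n f"
proof (induction n arbitrary: f)
  case 0
  then show ?case
    by (auto simp: continuous_on_eq_continuous_at intro: differentiable_imp_continuous_within)
next
  case (Suc n)
  then show ?case by (metis Ck.simps(2))
qed

lemma Ck_Suc_has_derivative:
  "Ck (Suc n) f \<Longrightarrow> (f has_derivative frechet_derivative f (at x)) (at x)"
  by (simp add: frechet_derivative_works)

lemma Ck_const: "Ck n (\<lambda>x. c)"
proof (induction n arbitrary: c)
  case (Suc n)
  show ?case by (rule Ck_SucI[where f' = "\<lambda>x k. 0"]) (auto simp: Suc.IH)
qed simp

lemma Ck_add: "Ck n f \<Longrightarrow> Ck n g \<Longrightarrow> Ck n (\<lambda>x. f x + g x)"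
proof (induction n arbitrary: f g)
  case 0
  then show ?case by (auto intro: continuous_intros)
next
  case (Suc n)
  show ?case
    by (rule Ck_SucI[OF has_derivative_add[OF Ck_Suc_has_derivative Ck_Suc_has_derivative]])
      (use Suc in auto)
qed

lemma Ck_mult: "Ck n f \<Longrightarrow> Ck n g \<Longrightarrow> Ck n (\<lambda>x. f x * g x)"
proof (induction n arbitrary: f g)
  case 0
  then show ?case by (auto intro: continuous_intros)
next
  case (Suc n)
  show ?case
    by (rule Ck_SucI[OF has_derivative_mult[OF Ck_Suc_has_derivative Ck_Suc_has_derivative]])
      (use Suc.prems Ck_Suc_imp_Ck in \<open>auto intro!: Ck_add Suc.IH\<close>)
qed

lemma Ck_diff: "Ck n f \<Longrightarrow> Ck n g \<Longrightarrow> Ck n (\<lambda>x. f x - g x)"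
  using Ck_add[OF _ Ck_mult[OF Ck_const[of n "-1"]], of f g] by simp

lemma Ck_prod: "finite A \<Longrightarrow> (\<And>i. i \<in> A \<Longrightarrow> Ck n (f i)) \<Longrightarrow> Ck n (\<lambda>x. \<Prod>i\<in>A. f i x)"
  by (induction A rule: finite_induct) (auto simp: Ck_const intro!: Ck_mult)

lemma Ck_inverse:
  assumes "Ck n f" "\<And>x. f x \<noteq> 0"
  shows "Ck n (\<lambda>x. inverse (f x))"
  using assms
proof (induction n arbitrary: f)
  case 0
  then show ?case by (auto intro!: continuous_intros)
next
  case (Suc n)
  show ?case
  proof (rule Ck_SucI)
    fix x
    show "((\<lambda>x. inverse (f x)) has_derivative
        (\<lambda>k. - (inverse (f x) * frechet_derivative f (at x) k * inverse (f x)))) (at x)"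
      using Suc.prems Ck_Suc_has_derivative[OF Suc.prems(1)] by (intro Deriv.has_derivative_inverse)
  next
    fix i :: 'a assume "i \<in> Basis"
    then have "Ck n (\<lambda>x. frechet_derivative f (at x) i)" using Suc.prems(1) by simp
    moreover have "Ck n (\<lambda>x. inverse (f x))"
      using Suc.IH[OF Ck_Suc_imp_Ck[OF Suc.prems(1)] Suc.prems(2)] .
    ultimately have "Ck n (\<lambda>x. (- 1) * ((inverse (f x) * frechet_derivative f (at x) i) * inverse (f x)))"
      by (intro Ck_mult Ck_const)
    then show "Ck n (\<lambda>x. - (inverse (f x) * frechet_derivative f (at x) i * inverse (f x)))"
      by simp
  qed
qed

lemma Ck_sum: "(\<And>i. i \<in> A \<Longrightarrow> Ck n (f i)) \<Longrightarrow> Ck n (\<lambda>x. \<Sum>i\<in>A. f i x)"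
  by (induction A rule: infinite_finite_induct) (auto simp: Ck_const intro!: Ck_add)

lemma Ck_inner_const: "Ck n (\<lambda>x. x \<bullet> a)"
proof (cases n)
  case (Suc m)
  show ?thesis unfolding Suc
    by (rule Ck_SucI[where f' = "\<lambda>x k. k \<bullet> a"])
      (auto simp: Ck_const intro!: derivative_eq_intros)
qed (auto intro: continuous_intros)

lemma Ck_inner_self: "Ck n (\<lambda>x. x \<bullet> x)"
proof (cases n)
  case (Suc m)
  show ?thesis unfolding Suc
  proof (rule Ck_SucI)
    fix x :: 'a
    show "((\<lambda>x. x \<bullet> x) has_derivative (\<lambda>k. 2 * (x \<bullet> k))) (at x)"
      by (auto simp: inner_commute intro!: derivative_eq_intros)
  next
    fix i :: 'a
    show "Ck m (\<lambda>x. 2 * (x \<bullet> i))"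
      by (intro Ck_mult Ck_const Ck_inner_const)
  qed
qed (auto intro: continuous_intros)

text \<open>The family is closed under differentiation, which gives smoothness of \<open>exp (- 1 / t)\<close>
  extended by \<open>0\<close> without computing derivatives.\<close>

definition flat_exp :: "real poly \<Rightarrow> real \<Rightarrow> real" where
  "flat_exp P t = (if t > 0 then poly P (1/t) * exp (- 1/t) else 0)"

text \<open>With x = 1/t this is the decay of a polynomial divided by exp x at infinity, taken
  coefficient by coefficient.\<close>

lemma flat_exp_tendsto_0: "(flat_exp P \<longlongrightarrow> 0) (at_right 0)"
proof -
  have "((\<lambda>x. \<Sum>i\<le>degree P. coeff P i * (x ^ i / exp x)) \<longlongrightarrow> (\<Sum>i\<le>degree P. coeff P i * 0)) at_top"
    by (intro tendsto_intros tendsto_power_div_exp_0)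
  then have "((\<lambda>x. poly P x / exp x) \<longlongrightarrow> 0) at_top"
    by (simp add: poly_altdef sum_divide_distrib)
  then have "((\<lambda>t. poly P (inverse t) / exp (inverse t)) \<longlongrightarrow> 0) (at_right 0)"
    by (rule filterlim_compose[OF _ filterlim_inverse_at_top_right])
  then show ?thesis
    by (rule Lim_transform_eventually)
      (auto simp: flat_exp_def eventually_at_right_field exp_minus divide_inverse intro: exI[of _ 1])
qed

text \<open>For t > 0 the chain rule gives (1/t^2) (P - P')(1/t) exp (-1/t), and
  \<open>[:0,0,1:]\<close> is the polynomial X^2. At 0 the difference quotient from the right is the
  member of the family with polynomial X * P, which tends to 0; from the left the quotient is
  0.\<close>

lemma has_derivative_flat_exp:
  "(flat_exp P has_real_derivative flat_exp ([:0,0,1:] * (P - pderiv P)) t) (at t)"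
proof -
  consider "t > 0" | "t < 0" | "t = 0" by linarith
  then show ?thesis
  proof cases
    case 1
    have "((\<lambda>t. poly P (1/t) * exp (- 1/t)) has_real_derivative flat_exp ([:0,0,1:] * (P - pderiv P)) t) (at t)"
    proof -
      have "((\<lambda>t. poly P (1/t) * exp (- 1/t)) has_real_derivative
        (poly (pderiv P) (1/t) * (- (1 / t\<^sup>2))) * exp (- 1/t) + (exp (- 1/t) * (1 / t\<^sup>2)) * poly P (1/t)) (at t)"
        using 1 by (intro DERIV_mult DERIV_chain'[OF _ poly_DERIV] DERIV_chain'[OF _ DERIV_exp])
          (auto intro!: derivative_eq_intros simp: power2_eq_square)
      then show ?thesis
        by (rule DERIV_cong) (use 1 in \<open>simp add: flat_exp_def power2_eq_square algebra_simps\<close>)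
    qed
    then show ?thesis
      by (rule DERIV_cong_ev[THEN iffD1, rotated -1, OF _ refl _ refl])
        (use 1 in \<open>auto simp: flat_exp_def eventually_nhds intro!: exI[of _ "{0<..}"]\<close>)
  next
    case 2
    have "((\<lambda>t. 0) has_real_derivative 0) (at t)" by simp
    then have "(flat_exp P has_real_derivative 0) (at t)"
      by (rule DERIV_cong_ev[THEN iffD1, rotated -1, OF _ refl _ refl])
        (use 2 in \<open>auto simp: flat_exp_def eventually_nhds intro!: exI[of _ "{..<0}"]\<close>)
    then show ?thesis using 2 by (simp add: flat_exp_def)
  next
    case 3
    have "((\<lambda>y. (flat_exp P y - flat_exp P 0) / (y - 0)) \<longlongrightarrow> 0) (at_right 0)"
      by (rule Lim_transform_eventually[OF flat_exp_tendsto_0[of "[:0,1:] * P"]])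
        (auto simp: flat_exp_def eventually_at_right_field intro: exI[of _ 1])
    moreover have "((\<lambda>y. (flat_exp P y - flat_exp P 0) / (y - 0)) \<longlongrightarrow> 0) (at_left 0)"
      by (rule Lim_transform_eventually[OF tendsto_const])
        (auto simp: flat_exp_def eventually_at_left_field intro: exI[of _ "-1"])
    ultimately show ?thesis
      using 3 by (simp add: has_field_derivative_iff filterlim_split_at flat_exp_def)
  qed
qed

lemma Ck_flat_exp:
  assumes "\<And>m. Ck m g"
  shows "Ck n (\<lambda>x. flat_exp P (g x))"
\<comment> \<open>Each derivative changes the polynomial, so the induction has to range over all of
  them.\<close>
proof (induction n arbitrary: P)
  case 0
  have "continuous_on UNIV (flat_exp P)"
    using has_derivative_flat_exp DERIV_isCont by (blast intro: continuous_at_imp_continuous_on)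
  moreover have "continuous_on UNIV g" using assms[of 0] by simp
  ultimately show ?case by (auto intro: continuous_on_compose2)
next
  case (Suc n)
  show ?case
  proof (rule Ck_SucI)
    fix x
    show "((\<lambda>x. flat_exp P (g x)) has_derivative
       (\<lambda>k. flat_exp ([:0,0,1:] * (P - pderiv P)) (g x) * frechet_derivative g (at x) k)) (at x)"
      using has_derivative_compose[OF Ck_Suc_has_derivative[OF assms, of x]
        has_derivative_flat_exp[unfolded has_field_derivative_def]]
      by (simp add: mult.commute)
  next
    fix i :: 'a assume "i \<in> Basis"
    then have "Ck n (\<lambda>x. frechet_derivative g (at x) i)"
      using assms[of "Suc n"] by simp
    then show "Ck n (\<lambda>x. flat_exp ([:0,0,1:] * (P - pderiv P)) (g x) * frechet_derivative g (at x) i)"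
      by (intro Ck_mult Suc.IH)
  qed
qed

text \<open>For s > 0 this is exp (-1 / (s (r^2 - |x|^2))) inside the ball of radius r and 0
  outside. Large s drives it to the indicator of the open ball; s = 1, after normalisation, gives
  the mollifiers.\<close>

definition bump :: "real \<Rightarrow> real \<Rightarrow> 'a::euclidean_space \<Rightarrow> real" where
  "bump s r x = flat_exp 1 (s * (r\<^sup>2 - x \<bullet> x))"

lemma Ck_diff_const: "Ck n f \<Longrightarrow> Ck n (\<lambda>x. f (x - c))"
proof (induction n arbitrary: f)
  case 0
  then show ?case
    using continuous_on_compose2[of UNIV f UNIV "\<lambda>x. x - c"]
      by (simp add: continuous_on_diff continuous_on_id continuous_on_const)
next
  case (Suc n)
  show ?case
  proof (rule Ck_SucI)
    fix x
    show "((\<lambda>x. f (x - c)) has_derivative frechet_derivative f (at (x - c))) (at x)"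
      using has_derivative_compose[OF has_derivative_diff[OF has_derivative_ident has_derivative_const[of c]]
        Ck_Suc_has_derivative[OF Suc.prems]] by simp
  qed (use Suc in auto)
qed

lemma Ck_bump: "Ck n (bump s r)"
proof -
  have "Ck m (\<lambda>x::'a. s * (r\<^sup>2 - x \<bullet> x))" for m
    by (intro Ck_mult Ck_diff Ck_const Ck_inner_self)
  from Ck_flat_exp[OF this] show ?thesis by (simp add: bump_def[abs_def])
qed

lemma bump_nonneg: "bump s r x \<ge> 0" and bump_le_1: "bump s r x \<le> 1"
  by (auto simp: bump_def flat_exp_def)

lemma bump_pos_iff: "s > 0 \<Longrightarrow> r \<ge> 0 \<Longrightarrow> bump s r x > 0 \<longleftrightarrow> norm x < r"
proof -
  assume "s > 0" "r \<ge> 0"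
  then have "bump s r x > 0 \<longleftrightarrow> norm x ^ 2 < r\<^sup>2"
    by (simp add: bump_def flat_exp_def zero_less_mult_iff dot_square_norm)
  then show ?thesis
    using \<open>r \<ge> 0\<close> by (meson norm_ge_zero power2_less_imp_less power_strict_mono zero_less_numeral)
qed

lemma bump_tendsto_1:
  assumes "norm x < r"
  shows "(\<lambda>n. bump (real n) r x) \<longlonglongrightarrow> 1"
proof -
  define d where "d = r\<^sup>2 - x \<bullet> x"
  have d: "d > 0"
    using assms by (simp add: d_def dot_square_norm power_strict_mono)
  have "(\<lambda>n. exp (- (1 / d) * inverse (real n))) \<longlonglongrightarrow> exp (- (1 / d) * 0)"
    by (intro tendsto_intros lim_inverse_n)
  then have "(\<lambda>n. exp (- (1 / d) * inverse (real n))) \<longlonglongrightarrow> 1" by simp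
  then show ?thesis
    by (rule Lim_transform_eventually)
      \<comment> \<open>At n = 0 the bump vanishes identically, so the exponential formula starts at
        n = 1.\<close>
      (use d in \<open>auto simp: bump_def flat_exp_def d_def[symmetric] divide_inverse mult.commute
        intro!: eventually_sequentiallyI[of 1]\<close>)
qed

section \<open>Uniqueness of weak gradients\<close>

text \<open>Lindelof's theorem for balls of admissible radius. \<open>P\<close> records the room
  that a caller wants around each centre. The enumeration by all natural numbers may repeat balls,
  which is where nonemptiness enters.\<close>

lemma open_countable_ball_cover:
  fixes U :: "'a::euclidean_space set"
  assumes "U \<noteq> {}" "\<And>x. x \<in> U \<Longrightarrow> \<exists>r>0. P x r"
  obtains c r where "\<And>n::nat. c n \<in> U" "\<And>n. r n > 0" "\<And>n. P (c n) (r n)"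
    "U \<subseteq> (\<Union>n. ball (c n) (r n))"
proof -
  obtain \<rho> where \<rho>: "\<And>x. x \<in> U \<Longrightarrow> \<rho> x > 0 \<and> P x (\<rho> x)"
    using assms(2) by metis
  obtain \<F>' where F: "\<F>' \<subseteq> (\<lambda>x. ball x (\<rho> x)) ` U" "countable \<F>'"
      "\<Union>\<F>' = \<Union>((\<lambda>x. ball x (\<rho> x)) ` U)"
    by (rule Lindelof[of "(\<lambda>x. ball x (\<rho> x)) ` U"]) blast+
  obtain S where S: "S \<subseteq> U" "countable S" "\<F>' = (\<lambda>x. ball x (\<rho> x)) ` S"
    using F(1,2) countable_subset_image[of \<F>' "\<lambda>x. ball x (\<rho> x)" U] by blast
  have U: "U \<subseteq> (\<Union>x\<in>S. ball x (\<rho> x))"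
  proof
    fix x assume "x \<in> U"
    moreover from this have "x \<in> ball x (\<rho> x)" using \<rho> by simp
    ultimately have "x \<in> \<Union>((\<lambda>x. ball x (\<rho> x)) ` U)" by blast
    then show "x \<in> (\<Union>x\<in>S. ball x (\<rho> x))" using F(3) S(3) by simp
  qed
  with assms(1) have "S \<noteq> {}" by auto
  define c where "c = from_nat_into S"
  have c: "range c = S"
    using S(2) \<open>S \<noteq> {}\<close> by (simp add: c_def range_from_nat_into)
  then have cU: "c n \<in> U" for n
    using S(1) by auto
  have "U \<subseteq> (\<Union>n. ball (c n) (\<rho> (c n)))"
    using U c by auto
  with cU \<rho> show ?thesis
    by (intro that[of c "\<lambda>n. \<rho> (c n)"]) auto
qed

text \<open>Write \<open>U\<close> as a countable union of balls; the test functions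
  \<open>1 - \<Prod>j<n. (1 - bump n (r j) (x - c j))\<close> converge boundedly to the indicator of \<open>U\<close>.\<close>

lemma set_integral_open_eq_0_of_test_integrals:
  fixes f :: "'a::euclidean_space \<Rightarrow> real"
  assumes loc: "locally_integrable_on \<Omega> f"
    and zero: "\<And>\<phi>. test_function \<Omega> \<phi> \<Longrightarrow> (LINT x:\<Omega>|lebesgue. f x * \<phi> x) = 0"
    and U: "open U" "compact (closure U)" "closure U \<subseteq> \<Omega>"
  shows "(LINT x:U|lebesgue. f x) = 0"
proof (cases "U = {}")
  case False
  obtain c r where cr: "\<And>n::nat. c n \<in> U" "\<And>n. r n > 0" "\<And>n. ball (c n) (r n) \<subseteq> U"
    "U \<subseteq> (\<Union>n. ball (c n) (r n))"
  proof (rule open_countable_ball_cover[OF False])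
    show "\<exists>r>0. ball x r \<subseteq> U" if "x \<in> U" for x
      using open_contains_ball[THEN iffD1, OF U(1)] that by blast
  qed blast
  define \<phi> where "\<phi> n x = 1 - (\<Prod>j<n. 1 - bump (real n) (r j) (x - c j))" for n x
  have off: "\<phi> n x = 0" if "x \<notin> U" for n x
  proof -
    have "bump (real n) (r j) (x - c j) = 0" if "j < n" for j
      using bump_pos_iff[of "real n" "r j" "x - c j"] cr(2)[of j] cr(3)[of j] that \<open>x \<notin> U\<close>
        bump_nonneg[of "real n" "r j" "x - c j"]
      by (auto simp: dist_norm norm_minus_commute)
    then show ?thesis by (simp add: \<phi>_def)
  qed
  have prod01: "(\<Prod>j<n. 1 - bump (real n) (r j) (x - c j)) \<in> {0..1}" for n x
    by (auto intro!: prod_nonneg prod_le_1 simp: bump_nonneg bump_le_1)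
  have bound: "\<bar>\<phi> n x\<bar> \<le> 1" for n x
    using prod01[where n=n and x=x] by (auto simp: \<phi>_def)
  have Ck_\<phi>: "Ck m (\<phi> n)" for m n
    unfolding \<phi>_def[abs_def] by (intro Ck_diff Ck_prod Ck_const Ck_diff_const[OF Ck_bump]) auto
  have supp: "closure {x. \<phi> n x \<noteq> 0} \<subseteq> closure U" for n
    using off by (intro closure_mono) auto
  have test: "test_function \<Omega> (\<phi> n)" for n
    unfolding test_function_def
  proof (intro conjI allI)
    show "compact (closure {x. \<phi> n x \<noteq> 0})"
      using compact_Int_closed[OF U(2) closed_closure] supp[of n] by (metis Int_absorb1)
  qed (use Ck_\<phi> supp[of n] U(3) in auto)
  have lim: "(\<lambda>n. \<phi> n x) \<longlonglongrightarrow> indicator U x" for x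
  proof (cases "x \<in> U")
    case True
    then obtain j where j: "x \<in> ball (c j) (r j)" using cr(4) by auto
    have "(\<lambda>n. 1 - bump (real n) (r j) (x - c j)) \<longlonglongrightarrow> 1 - 1"
      using j by (intro tendsto_intros bump_tendsto_1) (auto simp: dist_norm norm_minus_commute)
    then have b: "(\<lambda>n. 1 - bump (real n) (r j) (x - c j)) \<longlonglongrightarrow> 0" by simp
    \<comment> \<open>Every factor lies in [0,1], so once n > j the product is at most its j-th
      factor, which tends to 0.\<close>
    have "(\<lambda>n. \<Prod>j<n. 1 - bump (real n) (r j) (x - c j)) \<longlonglongrightarrow> 0"
    proof (rule tendsto_sandwich[OF _ _ tendsto_const b])
      show "\<forall>\<^sub>F n in sequentially. 0 \<le> (\<Prod>j<n. 1 - bump (real n) (r j) (x - c j))"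
        using prod01 by (auto intro!: always_eventually)
      show "\<forall>\<^sub>F n in sequentially. (\<Prod>j<n. 1 - bump (real n) (r j) (x - c j))
          \<le> 1 - bump (real n) (r j) (x - c j)"
      proof (rule eventually_sequentiallyI[of "Suc j"])
        fix n assume "Suc j \<le> n"
        then have "(\<Prod>j<n. 1 - bump (real n) (r j) (x - c j)) =
          (1 - bump (real n) (r j) (x - c j)) * (\<Prod>j\<in>{..<n} - {j}. 1 - bump (real n) (r j) (x - c j))"
          by (intro prod.remove) auto
        also have "\<dots> \<le> (1 - bump (real n) (r j) (x - c j)) * 1"
          by (intro mult_left_mono prod_le_1) (auto simp: bump_nonneg bump_le_1)
        finally show "(\<Prod>j<n. 1 - bump (real n) (r j) (x - c j)) \<le> 1 - bump (real n) (r j) (x - c j)"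
          by simp
      qed
    qed
    from tendsto_diff[OF tendsto_const[of 1] this] show ?thesis
      using True by (simp add: \<phi>_def)
  qed (simp add: off)
  have intf: "integrable lebesgue (\<lambda>x. indicator (closure U) x *\<^sub>R f x)"
    using loc U by (auto simp: locally_integrable_on_def set_integrable_def)
  have meas_\<phi>: "\<phi> n \<in> borel_measurable lebesgue" for n
    using Ck_\<phi>[of 0 n] by (intro measurable_completion) (simp add: borel_measurable_continuous_onI)
  \<comment> \<open>The test functions vanish off U, so the integrals over \<Omega> only see f on
    the compact closure of U, where f is integrable; this supplies the dominating function.\<close>
  have eq: "indicator \<Omega> x *\<^sub>R (f x * \<phi> n x) = (indicator (closure U) x *\<^sub>R f x) * \<phi> n x" for x n
    using off[of x n] U(3) closure_subset[of U] by (auto simp: indicator_def)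
  have "(\<lambda>n. LINT x|lebesgue. (indicator (closure U) x *\<^sub>R f x) * \<phi> n x)
      \<longlonglongrightarrow> (LINT x|lebesgue. (indicator (closure U) x *\<^sub>R f x) * indicator U x)"
  proof (rule integral_dominated_convergence[where w = "\<lambda>x. norm (indicator (closure U) x *\<^sub>R f x)"])
    show "AE x in lebesgue. norm (indicator (closure U) x *\<^sub>R f x * \<phi> n x)
        \<le> norm (indicator (closure U) x *\<^sub>R f x)" for n
      using mult_left_mono[OF bound] by (auto simp: abs_mult intro!: AE_I2)
    have U_sets: "U \<in> sets lebesgue" using U(1) by auto
    show "(\<lambda>x. indicator (closure U) x *\<^sub>R f x * indicator U x) \<in> borel_measurable lebesgue"
      by (intro borel_measurable_times[OF borel_measurable_integrable[OF intf]]
          borel_measurable_indicator U_sets)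
    show "(\<lambda>x. indicator (closure U) x *\<^sub>R f x * \<phi> n x) \<in> borel_measurable lebesgue" for n
      by (rule borel_measurable_times[OF borel_measurable_integrable[OF intf] meas_\<phi>])
    show "AE x in lebesgue. (\<lambda>n. indicator (closure U) x *\<^sub>R f x * \<phi> n x)
        \<longlonglongrightarrow> indicator (closure U) x *\<^sub>R f x * indicator U x"
      by (intro AE_I2 tendsto_intros lim)
  qed (intro integrable_norm intf)
  moreover have "(LINT x|lebesgue. (indicator (closure U) x *\<^sub>R f x) * \<phi> n x) = 0" for n
    using zero[OF test[of n]] by (simp only: set_lebesgue_integral_def eq)
  ultimately have "(LINT x|lebesgue. (indicator (closure U) x *\<^sub>R f x) * indicator U x) = 0"
    by (simp add: LIMSEQ_const_iff)
  moreover have "(indicator (closure U) x *\<^sub>R f x) * indicator U x = indicator U x *\<^sub>R f x" for x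
    using closure_subset[of U] by (auto simp: indicator_def)
  ultimately show ?thesis by (simp only: set_lebesgue_integral_def)
qed (simp add: set_lebesgue_integral_def)

text \<open>A small open neighbourhood V of K has compact closure in \<Omega>, and both V and V - K
  are open. The open case makes both of their integrals vanish, and additivity leaves 0 for
  K.\<close>

lemma set_integral_compact_eq_0_of_test_integrals:
  fixes f :: "'a::euclidean_space \<Rightarrow> real"
  assumes loc: "locally_integrable_on \<Omega> f" and "open \<Omega>"
    and zero: "\<And>\<phi>. test_function \<Omega> \<phi> \<Longrightarrow> (LINT x:\<Omega>|lebesgue. f x * \<phi> x) = 0"
    and K: "compact K" "K \<subseteq> \<Omega>"
  shows "(LINT x:K|lebesgue. f x) = 0"
proof (cases "K = {}")
  case False
  obtain e where e: "e > 0" "{x. infdist x K \<le> e} \<subseteq> \<Omega>"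
    using compact_in_open_separated[OF False K(1) \<open>open \<Omega>\<close> K(2)] by blast
  have cpt: "compact {x. infdist x K \<le> e}"
    using compact_infdist_le[OF False K(1) e(1)] .
  define V where "V = {x. infdist x K < e}"
  have "open V" unfolding V_def
    by (intro open_Collect_less continuous_intros)
  have cl: "closure W \<subseteq> {x. infdist x K \<le> e}" if "W \<subseteq> V" for W
    using that by (intro closure_minimal compact_imp_closed[OF cpt]) (auto simp: V_def)
  have *: "(LINT x:W|lebesgue. f x) = 0" if "open W" "W \<subseteq> V" for W
    using set_integral_open_eq_0_of_test_integrals[OF loc zero, of W] that cl[OF that(2)] e(2)
      compact_Int_closed[OF cpt, of "closure W"] by (auto simp: Int_absorb1)
  have KV: "K \<subseteq> V" using e(1) by (auto simp: V_def)
  have int: "set_integrable lebesgue {x. infdist x K \<le> e} f"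
    using loc cpt e(2) by (auto simp: locally_integrable_on_def)
  have "set_integrable lebesgue K f" "set_integrable lebesgue (V - K) f"
    using K(1) \<open>open V\<close> KV
    by (auto intro!: set_integrable_subset[OF int] simp: V_def borel_closed compact_imp_closed)
  then have "(LINT x:K \<union> (V - K)|lebesgue. f x) = (LINT x:K|lebesgue. f x) + (LINT x:V - K|lebesgue. f x)"
    by (intro set_integral_Un) auto
  then show ?thesis
    using *[of V] *[of "V - K"] \<open>open V\<close> K(1) KV by (auto simp: Un_absorb1 open_Diff compact_imp_closed)
qed (simp add: set_lebesgue_integral_def)

text \<open>Inner regularity: up to measure less than e, the part of C where f > 0 is filled by a
  closed T, compact as a subset of C. A zero integral of a positive function makes T null, so the
  rest would carry the whole measure, which is at least e.\<close>

lemma AE_le_0_if_compact_integrals_zero: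
  fixes f :: "'a::euclidean_space \<Rightarrow> real"
  assumes C: "compact C" "set_integrable lebesgue C f"
    and zero: "\<And>K. compact K \<Longrightarrow> K \<subseteq> C \<Longrightarrow> (LINT x:K|lebesgue. f x) = 0"
  shows "AE x in lebesgue. x \<in> C \<longrightarrow> f x \<le> 0"
proof -
  define A where "A = {x. indicator C x *\<^sub>R f x > 0}"
  have [measurable]: "(\<lambda>x. indicator C x *\<^sub>R f x) \<in> borel_measurable lebesgue"
    using C(2) by (auto simp: set_integrable_def)
  then have A: "A \<in> sets lebesgue"
    using measurable_sets[of "\<lambda>x. indicator C x *\<^sub>R f x" lebesgue borel "{0<..}"]
    by (auto simp: A_def vimage_def)
  have AC: "A \<subseteq> C" by (auto simp: A_def indicator_def)
  have "emeasure lebesgue A = 0"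
  proof (rule ccontr)
    assume "emeasure lebesgue A \<noteq> 0"
    \<comment> \<open>A finite positive lower bound for the measure, available whether that measure
      is finite or not.\<close>
    then obtain e :: real where e: "e > 0" "ennreal e \<le> emeasure lebesgue A"
    proof (cases "emeasure lebesgue A")
      case (real r)
      with \<open>emeasure lebesgue A \<noteq> 0\<close> show ?thesis
        by (intro that[of r]) (auto simp: order_less_le)
    next
      case top
      then show ?thesis by (intro that[of 1]) auto
    qed
    obtain T where T: "closed T" "T \<subseteq> A" "A - T \<in> lmeasurable" "emeasure lebesgue (A - T) < ennreal e"
      using sets_lebesgue_inner_closed[OF A e(1)] by blast
    have "compact T"
      using compact_Int_closed[OF C(1) T(1)] T(2) AC by (simp add: Int_absorb1 subset_trans)
    have T_sets: "T \<in> sets lebesgue" using T(1) by auto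
    have int: "integrable lebesgue (\<lambda>x. indicator T x *\<^sub>R f x)"
      using set_integrable_subset[OF C(2) T_sets] T(2) AC by (auto simp: set_integrable_def)
    have "(LINT x|lebesgue. indicator T x *\<^sub>R f x) = 0"
      using zero[OF \<open>compact T\<close>] T(2) AC by (auto simp: set_lebesgue_integral_def)
    moreover have "AE x in lebesgue. 0 \<le> indicator T x *\<^sub>R f x"
    proof (rule AE_I2)
      fix x
      show "0 \<le> indicator T x *\<^sub>R f x"
      proof (cases "x \<in> T")
        case True
        then have "x \<in> A" using T(2) by blast
        then show ?thesis using AC True by (auto simp: A_def indicator_def)
      qed simp
    qed
    ultimately have "AE x in lebesgue. indicator T x *\<^sub>R f x = 0"
      using integral_nonneg_eq_0_iff_AE[OF int] by blast
    then have "AE x in lebesgue. x \<notin> T"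
      by eventually_elim (use T(2) in \<open>auto simp: A_def indicator_def split: if_splits\<close>)
    then have "emeasure lebesgue T = 0"
      using T_sets by (auto simp: AE_iff_measurable[OF _ refl] vimage_def)
    then have "emeasure lebesgue (A - T) = emeasure lebesgue A"
      using A T_sets by (intro emeasure_Diff_null_set) auto
    with T(4) e(2) show False by simp
  qed
  then have "AE x in lebesgue. x \<notin> A"
    using A by (intro AE_not_in) auto
  then show ?thesis
    by eventually_elim (auto simp: A_def indicator_def split: if_splits)
qed

text \<open>The fundamental lemma of the calculus of variations: the one-sided result is applied to
  f and to - f on each of countably many closed balls covering \<Omega>.\<close>

lemma AE_eq_0_of_test_integrals:
  fixes f :: "'a::euclidean_space \<Rightarrow> real"
  assumes loc: "locally_integrable_on \<Omega> f" and "open \<Omega>"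
    and zero: "\<And>\<phi>. test_function \<Omega> \<phi> \<Longrightarrow> (LINT x:\<Omega>|lebesgue. f x * \<phi> x) = 0"
  shows "AE x in lebesgue. x \<in> \<Omega> \<longrightarrow> f x = 0"
proof (cases "\<Omega> = {}")
  case False
  obtain c r where cr: "\<And>n::nat. c n \<in> \<Omega>" "\<And>n. r n > 0" "\<And>n. cball (c n) (r n) \<subseteq> \<Omega>"
    "\<Omega> \<subseteq> (\<Union>n. ball (c n) (r n))"
  proof (rule open_countable_ball_cover[OF False])
    show "\<exists>r>0. cball x r \<subseteq> \<Omega>" if "x \<in> \<Omega>" for x
      using open_contains_cball[THEN iffD1, OF \<open>open \<Omega>\<close>] that by blast
  qed blast
  have "AE x in lebesgue. x \<in> cball (c n) (r n) \<longrightarrow> f x = 0" for n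
  proof -
    have i: "set_integrable lebesgue (cball (c n) (r n)) f"
      using loc cr(3) by (auto simp: locally_integrable_on_def)
    have z: "(LINT x:K|lebesgue. f x) = 0" if "compact K" "K \<subseteq> cball (c n) (r n)" for K
      using set_integral_compact_eq_0_of_test_integrals[OF loc \<open>open \<Omega>\<close> zero] that cr(3)[of n] by blast
    have "AE x in lebesgue. x \<in> cball (c n) (r n) \<longrightarrow> f x \<le> 0"
      by (rule AE_le_0_if_compact_integrals_zero) (use i z in auto)
    moreover have "AE x in lebesgue. x \<in> cball (c n) (r n) \<longrightarrow> - f x \<le> 0"
      by (rule AE_le_0_if_compact_integrals_zero)
        (use i z in \<open>auto simp: set_lebesgue_integral_def set_integrable_def\<close>)
    ultimately show ?thesis by eventually_elim auto
  qed
  then have "AE x in lebesgue. \<forall>n. x \<in> cball (c n) (r n) \<longrightarrow> f x = 0"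
    by (subst AE_all_countable) blast
  then show ?thesis
    by eventually_elim (use cr(4) ball_subset_cball in blast)
qed simp

text \<open>\<open>weak_grad\<close> picks an arbitrary representative; this result identifies it
  with a gradient constructed by other means. Each coordinate of G - H integrates to 0 against every
  test function.\<close>

lemma has_weak_gradient_AE_unique:
  assumes "open \<Omega>" and G: "has_weak_gradient \<Omega> u G" and H: "has_weak_gradient \<Omega> u H"
  shows "AE x in lebesgue. x \<in> \<Omega> \<longrightarrow> G x = H x"
proof -
  have "AE x in lebesgue. x \<in> \<Omega> \<longrightarrow> (G x - H x) \<bullet> i = 0" if i: "i \<in> Basis" for i
  proof (rule AE_eq_0_of_test_integrals[OF _ \<open>open \<Omega>\<close>])
    have int: "set_integrable lebesgue K (\<lambda>x. G x \<bullet> i)" "set_integrable lebesgue K (\<lambda>x. H x \<bullet> i)"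
      if "compact K" "K \<subseteq> \<Omega>" for K
    proof -
      have "set_integrable lebesgue K G" "set_integrable lebesgue K H"
        using G H that by (auto simp: has_weak_gradient_def locally_integrable_on_def)
      then have "integrable lebesgue (\<lambda>x. (indicator K x *\<^sub>R G x) \<bullet> i)"
        "integrable lebesgue (\<lambda>x. (indicator K x *\<^sub>R H x) \<bullet> i)"
        unfolding set_integrable_def by (auto intro!: integrable_inner_left simp del: inner_scaleR_left)
      then show "set_integrable lebesgue K (\<lambda>x. G x \<bullet> i)" "set_integrable lebesgue K (\<lambda>x. H x \<bullet> i)"
        by (simp_all add: set_integrable_def)
    qed
    then show "locally_integrable_on \<Omega> (\<lambda>x. (G x - H x) \<bullet> i)"
      by (auto simp: locally_integrable_on_def inner_diff_left intro!: set_integral_diff(1))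
    fix \<phi> assume \<phi>: "test_function \<Omega> \<phi>"
    define S where "S = closure {x. \<phi> x \<noteq> 0}"
    have zero: "\<phi> x = 0" if "x \<notin> S" for x
      using closure_subset[of "{x. \<phi> x \<noteq> 0}"] that by (auto simp: S_def)
    have S: "compact S" "S \<subseteq> \<Omega>"
      using \<phi> by (auto simp: test_function_def S_def)
    have "Ck 0 \<phi>" using \<phi> by (simp add: test_function_def)
    then have cont: "continuous_on UNIV \<phi>" by simp
    then have meas: "\<phi> \<in> borel_measurable lebesgue"
      by (intro measurable_completion) (simp add: borel_measurable_continuous_onI)
    obtain B where B: "\<And>x. x \<in> S \<Longrightarrow> norm (\<phi> x) \<le> B"
      using compact_imp_bounded[OF compact_continuous_image[OF continuous_on_subset[OF cont] S(1)]]
      by (auto simp: bounded_iff)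
    \<comment> \<open>A test function is bounded on its compact support S, so its product with a
      function integrable on S is integrable. This allows the integral of the difference to be
      split.\<close>
    have int\<phi>: "set_integrable lebesgue \<Omega> (\<lambda>x. f x * \<phi> x)"
      if f: "set_integrable lebesgue S f" for f :: "'a \<Rightarrow> real"
      unfolding set_integrable_def
    proof (rule Bochner_Integration.integrable_bound[where f = "\<lambda>x. B * (indicator S x *\<^sub>R f x)"])
      have eq: "indicator \<Omega> x *\<^sub>R (f x * \<phi> x) = (indicator S x *\<^sub>R f x) * \<phi> x" for x
        using zero[of x] S(2) by (auto simp: indicator_def)
      show "(\<lambda>x. indicator \<Omega> x *\<^sub>R (f x * \<phi> x)) \<in> borel_measurable lebesgue"
        unfolding eq using f meas by (auto simp: set_integrable_def intro!: borel_measurable_times)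
      show "AE x in lebesgue. norm (indicator \<Omega> x *\<^sub>R (f x * \<phi> x)) \<le> norm (B * (indicator S x *\<^sub>R f x))"
        unfolding eq
      proof (rule AE_I2)
        fix x
        show "norm (indicator S x *\<^sub>R f x * \<phi> x) \<le> norm (B * (indicator S x *\<^sub>R f x))"
        proof (cases "x \<in> S")
          case True
          then have "\<bar>\<phi> x\<bar> \<le> \<bar>B\<bar>" using B[of x] by simp
          from mult_left_mono[OF this, of "\<bar>f x\<bar>"] show ?thesis
            using True by (simp add: abs_mult mult.commute)
        qed simp
      qed
    qed (use f in \<open>auto simp: set_integrable_def\<close>)
    have "(LINT x:\<Omega>|lebesgue. (G x - H x) \<bullet> i * \<phi> x)
        = (LINT x:\<Omega>|lebesgue. (G x \<bullet> i) * \<phi> x - (H x \<bullet> i) * \<phi> x)"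
      by (simp add: inner_diff_left left_diff_distrib)
    also have "\<dots> = (LINT x:\<Omega>|lebesgue. (G x \<bullet> i) * \<phi> x) - (LINT x:\<Omega>|lebesgue. (H x \<bullet> i) * \<phi> x)"
      by (intro set_integral_diff(2) int\<phi> int S)
    also have "\<dots> = 0"
    proof -
      have "(LINT x:\<Omega>|lebesgue. u x * frechet_derivative \<phi> (at x) i) = - (LINT x:\<Omega>|lebesgue. (F x \<bullet> i) * \<phi> x)"
        if "has_weak_gradient \<Omega> u F" for F
        using that \<phi> i unfolding has_weak_gradient_def by blast
      from this[OF G] this[OF H] show ?thesis by simp
    qed
    finally show "(LINT x:\<Omega>|lebesgue. (G x - H x) \<bullet> i * \<phi> x) = 0" .
  qed
  then have "AE x in lebesgue. \<forall>i\<in>Basis. x \<in> \<Omega> \<longrightarrow> (G x - H x) \<bullet> i = 0"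
    by (subst AE_finite_all) auto
  then show ?thesis
    by eventually_elim (auto intro: euclidean_eqI simp: inner_diff_left)
qed

section \<open>The probability measure with density p\<close>

locale continuous_pdf =
  fixes p :: "'a::euclidean_space \<Rightarrow> real"
  assumes measurable_p [measurable]: "p \<in> borel_measurable borel"
    and p_nonneg: "\<And>x. p x \<ge> 0"
    and open_dom: "open (pdf_dom p)"
    and cont_p: "continuous_on (pdf_dom p) p"
    and nn_integral_p: "(\<integral>\<^sup>+x. ennreal (p x) \<partial>lborel) = 1"
begin

text \<open>The distribution as a measure on the Lebesgue measurable subsets of the support. Taking
  the density over \<open>lebesgue_on\<close> rather than \<open>lborel\<close> makes
  \<mu>-measurability coincide with the relative measurability demanded by \<open>in_L2\<close>, so
  that \<open>pexp\<close>, \<open>pintegrable\<close> and \<open>in_L2\<close> become the ordinary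
  notions for \<mu>.\<close>

definition \<mu> :: "'a measure" where
  "\<mu> = density (lebesgue_on (pdf_dom p)) (\<lambda>x. ennreal (p x))"

lemma dom_sets [measurable]: "pdf_dom p \<in> sets lebesgue"
  using open_dom by auto

lemma p_pos: "x \<in> pdf_dom p \<Longrightarrow> p x > 0" and p_zero: "x \<notin> pdf_dom p \<Longrightarrow> p x = 0"
  using p_nonneg[of x] by (auto simp: pdf_dom_def)

lemma p_lebesgue: "p \<in> borel_measurable lebesgue"
  by (intro measurable_completion) simp

lemma p_on [measurable]: "p \<in> borel_measurable (lebesgue_on (pdf_dom p))"
  using p_lebesgue by (rule measurable_restrict_space1)

lemma sets_\<mu>: "sets \<mu> = sets (lebesgue_on (pdf_dom p))"
  and space_\<mu>: "space \<mu> = pdf_dom p"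
  by (simp_all add: \<mu>_def space_restrict_space)

lemma borel_measurable_\<mu>: "borel_measurable \<mu> = borel_measurable (lebesgue_on (pdf_dom p))"
  by (rule measurable_cong_sets) (simp_all add: sets_\<mu>)

lemma nn_integral_\<mu>:
  assumes "f \<in> borel_measurable \<mu>"
  shows "(\<integral>\<^sup>+x. f x \<partial>\<mu>) = (\<integral>\<^sup>+x\<in>pdf_dom p. f x * ennreal (p x) \<partial>lebesgue)"
  using assms unfolding borel_measurable_\<mu>
  by (simp add: \<mu>_def nn_integral_density nn_integral_restrict_space mult_ac)

sublocale prob_space \<mu>
proof
  have "emeasure \<mu> (space \<mu>) = (\<integral>\<^sup>+x. 1 \<partial>\<mu>)" by simp
  also have "\<dots> = (\<integral>\<^sup>+x\<in>pdf_dom p. ennreal (p x) \<partial>lebesgue)"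
    by (subst nn_integral_\<mu>) simp_all
  also have "\<dots> = (\<integral>\<^sup>+x. ennreal (p x) \<partial>lebesgue)"
    using p_zero by (intro nn_integral_cong) (auto simp: indicator_def)
  also have "\<dots> = 1"
    using nn_integral_p by (simp add: nn_integral_completion)
  finally show "emeasure \<mu> (space \<mu>) = 1" .
qed

lemma borel_measurable_\<mu>_iff:
  fixes f :: "'a \<Rightarrow> 'b::real_normed_vector"
  shows "f \<in> borel_measurable \<mu> \<longleftrightarrow> set_borel_measurable lebesgue (pdf_dom p) f"
  unfolding borel_measurable_\<mu> set_borel_measurable_def
  by (rule borel_measurable_restrict_space_iff) auto

lemma borel_measurable_times_p_iff:
  fixes f :: "'a \<Rightarrow> real"
  shows "(\<lambda>x. f x * p x) \<in> borel_measurable (lebesgue_on (pdf_dom p)) \<longleftrightarrow> f \<in> borel_measurable (lebesgue_on (pdf_dom p))"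
proof
  assume "(\<lambda>x. f x * p x) \<in> borel_measurable (lebesgue_on (pdf_dom p))"
  then have "(\<lambda>x. (f x * p x) / p x) \<in> borel_measurable (lebesgue_on (pdf_dom p))"
    by measurable
  moreover have "(f x * p x) / p x = f x" if "x \<in> space (lebesgue_on (pdf_dom p))" for x
    using that p_pos[of x] by (simp add: space_restrict_space)
  ultimately show "f \<in> borel_measurable (lebesgue_on (pdf_dom p))"
    using measurable_cong[of "lebesgue_on (pdf_dom p)" "\<lambda>x. (f x * p x) / p x" f borel] by blast
qed (auto intro!: borel_measurable_times p_on)

text \<open>No measurability of f is assumed: as p > 0 on the support, multiplying by p preserves
  non-measurability, and then both sides are false.\<close>

lemma pintegrable_iff: "pintegrable p f \<longleftrightarrow> integrable \<mu> f"
proof (cases "f \<in> borel_measurable (lebesgue_on (pdf_dom p))")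
  case True
  then show ?thesis
    by (simp add: pintegrable_def set_integrable_def \<mu>_def integrable_density p_nonneg
        integrable_restrict_space mult.commute)
next
  case False
  then have "\<not> integrable (lebesgue_on (pdf_dom p)) (\<lambda>x. f x * p x)"
    using borel_measurable_times_p_iff[of f] by (auto dest: borel_measurable_integrable)
  moreover have "\<not> integrable \<mu> f"
    using False borel_measurable_\<mu> by (auto dest: borel_measurable_integrable)
  ultimately show ?thesis
    by (simp add: pintegrable_def set_integrable_def integrable_restrict_space)
qed

text \<open>For measurable f this is the density formula; otherwise neither side has an integrable
  integrand and both integrals take the default value 0.\<close>

lemma pexp_eq: "pexp p f = (LINT x|\<mu>. f x)"
proof (cases "f \<in> borel_measurable (lebesgue_on (pdf_dom p))")
  case True
  then have "(LINT x|\<mu>. f x) = (LINT x|lebesgue_on (pdf_dom p). p x *\<^sub>R f x)"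
    unfolding \<mu>_def by (intro integral_density) (auto simp: p_nonneg)
  then show ?thesis
    by (simp add: pexp_def set_lebesgue_integral_def integral_restrict_space mult.commute)
next
  case False
  then have "\<not> pintegrable p f"
    using borel_measurable_\<mu> by (auto simp: pintegrable_iff dest: borel_measurable_integrable)
  then show ?thesis
    using pintegrable_iff[of f]
    by (simp add: pexp_def pintegrable_def set_integrable_def set_lebesgue_integral_def
        not_integrable_integral_eq)
qed

lemma in_L2_iff: "in_L2 p f \<longleftrightarrow> f \<in> borel_measurable \<mu> \<and> integrable \<mu> (\<lambda>x. (norm (f x))\<^sup>2)"
  by (simp add: in_L2_def borel_measurable_\<mu>_iff pintegrable_iff)

lemma AE_\<mu>_iff: "(AE x in \<mu>. P x) \<longleftrightarrow> (AE x in lebesgue. x \<in> pdf_dom p \<longrightarrow> P x)"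
proof -
  have "(AE x in \<mu>. P x) \<longleftrightarrow> (AE x in lebesgue_on (pdf_dom p). p x > 0 \<longrightarrow> P x)"
    unfolding \<mu>_def by (subst AE_density) simp_all
  also have "\<dots> \<longleftrightarrow> (AE x in lebesgue. x \<in> pdf_dom p \<longrightarrow> P x)"
    by (subst AE_restrict_space_iff) (auto simp: pdf_dom_def)
  finally show ?thesis .
qed

section \<open>Comparison of \<mu> with Lebesgue measure on compact subsets of the support\<close>

lemma p_bounds_compact:
  assumes "compact K" "K \<subseteq> pdf_dom p"
  obtains c M where "c > 0" "M > 0" "\<And>x. x \<in> K \<Longrightarrow> c \<le> p x" "\<And>x. x \<in> K \<Longrightarrow> p x \<le> M"
proof (cases "K = {}")
  case False
  have cont: "continuous_on K p" using cont_p assms(2) by (rule continuous_on_subset)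
  obtain x where x: "x \<in> K" "\<And>y. y \<in> K \<Longrightarrow> p x \<le> p y"
    using continuous_attains_inf[OF assms(1) False cont] by blast
  obtain y where y: "y \<in> K" "\<And>z. z \<in> K \<Longrightarrow> p z \<le> p y"
    using continuous_attains_sup[OF assms(1) False cont] by blast
  show ?thesis
    using that[of "p x" "p y"] x y p_pos assms(2) by blast
qed (use that[of 1 1] in auto)

text \<open>Continuity of p provides a lower bound c > 0 on K, and then |f| <= (1/c) p |f|
  there.\<close>

lemma set_integrable_compact:
  fixes f :: "'a \<Rightarrow> 'b::{banach, second_countable_topology}"
  assumes f: "integrable \<mu> f" and K: "compact K" "K \<subseteq> pdf_dom p"
  shows "set_integrable lebesgue K f"
proof -
  obtain c M where c: "c > 0" "M > 0" "\<And>x. x \<in> K \<Longrightarrow> c \<le> p x" "\<And>x. x \<in> K \<Longrightarrow> p x \<le> M"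
    by (rule p_bounds_compact[OF K]) blast
  have "integrable (lebesgue_on (pdf_dom p)) (\<lambda>x. p x *\<^sub>R f x)"
    using f borel_measurable_integrable[OF f] unfolding borel_measurable_\<mu>
    by (subst (asm) \<mu>_def, subst (asm) integrable_density) (auto simp: p_nonneg)
  then have int: "integrable lebesgue (\<lambda>x. indicator (pdf_dom p) x *\<^sub>R (p x *\<^sub>R f x))"
    by (simp add: integrable_restrict_space)
  have Kset: "K \<in> sets lebesgue" using K(1) by (simp add: borel_closed compact_imp_closed)
  have "set_borel_measurable lebesgue (pdf_dom p) f"
    using borel_measurable_integrable[OF f] by (simp add: borel_measurable_\<mu>_iff)
  then have meas: "set_borel_measurable lebesgue K f"
    by (rule set_borel_measurable_subset) (use K Kset in auto)
  show ?thesis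
    unfolding set_integrable_def
  proof (rule Bochner_Integration.integrable_bound[OF
      integrable_scaleR_right[OF int, of "1/c"]])
    show "AE x in lebesgue. norm (indicator K x *\<^sub>R f x)
        \<le> norm ((1 / c) *\<^sub>R (indicator (pdf_dom p) x *\<^sub>R p x *\<^sub>R f x))"
    proof (rule AE_I2)
      fix x
      show "norm (indicator K x *\<^sub>R f x) \<le> norm ((1 / c) *\<^sub>R (indicator (pdf_dom p) x *\<^sub>R p x *\<^sub>R f x))"
      proof (cases "x \<in> K")
        case True
        have "1 * norm (f x) \<le> (p x / c) * norm (f x)"
          using c(1) c(3)[OF True] by (intro mult_right_mono) auto
        then show ?thesis using True K(2) c(1) p_nonneg[of x] by auto
      qed simp
    qed
  qed (use meas in \<open>simp add: set_borel_measurable_def\<close>)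
qed

lemma locally_integrable_on_dom:
  fixes f :: "'a \<Rightarrow> 'b::{banach, second_countable_topology}"
  shows "integrable \<mu> f \<Longrightarrow> locally_integrable_on (pdf_dom p) f"
  by (simp add: locally_integrable_on_def set_integrable_compact)

text \<open>Division by p turns a Lebesgue pairing into a \<mu>-integral. If b is continuous with
  compact support inside \<open>pdf_dom p\<close>, the multiplier b / p is bounded, and the pairing
  becomes continuous in L^1(\<mu>).\<close>

lemma set_integral_dom_eq:
  "(LINT x:pdf_dom p|lebesgue. f x * b x) = (LINT x|\<mu>. f x * (b x / p x))"
  unfolding pexp_eq[symmetric] pexp_def
  by (intro set_lebesgue_integral_cong) (use p_pos in \<open>auto simp: less_le\<close>)

lemma bounded_div_p:
  fixes b :: "'a \<Rightarrow> real"
  assumes b: "continuous_on UNIV b" and S: "compact S" "S \<subseteq> pdf_dom p" "\<And>x. x \<notin> S \<Longrightarrow> b x = 0"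
  obtains B where "\<And>x. \<bar>b x / p x\<bar> \<le> B" "(\<lambda>x. b x / p x) \<in> borel_measurable \<mu>"
proof -
  obtain c M where c: "c > 0" "M > 0" "\<And>x. x \<in> S \<Longrightarrow> c \<le> p x" "\<And>x. x \<in> S \<Longrightarrow> p x \<le> M"
    by (rule p_bounds_compact[OF S(1,2)]) blast
  obtain B where B: "\<And>x. x \<in> S \<Longrightarrow> norm (b x) \<le> B"
    using compact_imp_bounded[OF compact_continuous_image[OF continuous_on_subset[OF b] S(1)]]
    by (auto simp: bounded_iff)
  show ?thesis
  proof
    \<comment> \<open>The absolute value of B is taken because B may be negative when S is empty;
      off S the quotient is 0.\<close>
    show "\<bar>b x / p x\<bar> \<le> \<bar>B\<bar> / c" for x
    proof (cases "x \<in> S")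
      case True
      then show ?thesis
        using B[OF True] c(1) c(3)[OF True] unfolding abs_divide by (intro frac_le) auto
    qed (use S(3) c in auto)
    have "(\<lambda>x. b x / p x) \<in> borel_measurable lebesgue"
      using b measurable_p
      by (intro measurable_completion borel_measurable_divide) (simp_all add: borel_measurable_continuous_onI)
    then show "(\<lambda>x. b x / p x) \<in> borel_measurable \<mu>"
      unfolding borel_measurable_\<mu> by (rule measurable_restrict_space1)
  qed
qed

lemma integrable_mult_bounded:
  fixes g :: "'a \<Rightarrow> real"
  assumes g: "integrable \<mu> g" and b: "\<And>x. \<bar>b x\<bar> \<le> B" "b \<in> borel_measurable \<mu>"
  shows "integrable \<mu> (\<lambda>x. g x * b x)"
proof (rule Bochner_Integration.integrable_bound[OF integrable_mult_right[OF g, of B]])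
  show "AE x in \<mu>. norm (g x * b x) \<le> norm (B * g x)"
    using b(1) by (auto simp: abs_mult mult.commute intro!: AE_I2 mult_right_mono order_trans[OF b(1) abs_ge_self])
qed (use b(2) g in measurable)

lemma tendsto_integral_mult_bounded:
  fixes f :: "'a \<Rightarrow> real"
  assumes int: "\<And>n. integrable \<mu> (f' n)" "integrable \<mu> f"
    and lim: "(\<lambda>n. LINT x|\<mu>. \<bar>f' n x - f x\<bar>) \<longlonglongrightarrow> 0"
    and b: "\<And>x. \<bar>b x\<bar> \<le> B" "b \<in> borel_measurable \<mu>"
  shows "(\<lambda>n. LINT x|\<mu>. f' n x * b x) \<longlonglongrightarrow> (LINT x|\<mu>. f x * b x)"
proof (rule LIM_zero_cancel, rule Lim_null_comparison)
  note int_b = integrable_mult_bounded[OF _ b]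
  show "\<forall>\<^sub>F n in sequentially. norm ((LINT x|\<mu>. f' n x * b x) - (LINT x|\<mu>. f x * b x))
      \<le> (LINT x|\<mu>. \<bar>f' n x - f x\<bar>) * B"
  proof (rule always_eventually, rule allI)
    fix n
    have "(LINT x|\<mu>. f' n x * b x) - (LINT x|\<mu>. f x * b x) = (LINT x|\<mu>. (f' n x - f x) * b x)"
      using int_b[OF int(1)[of n]] int_b[OF int(2)] by (simp add: left_diff_distrib)
    also have "norm \<dots> \<le> (LINT x|\<mu>. \<bar>f' n x - f x\<bar> * B)"
      unfolding real_norm_def
    proof (rule integral_abs_bound[THEN order_trans], rule integral_mono)
      show "integrable \<mu> (\<lambda>x. \<bar>(f' n x - f x) * b x\<bar>)"
        using int_b[of "\<lambda>x. f' n x - f x"] int by auto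
    qed (use int b(1) in \<open>auto simp: abs_mult intro!: mult_left_mono\<close>)
    finally show "norm ((LINT x|\<mu>. f' n x * b x) - (LINT x|\<mu>. f x * b x))
      \<le> (LINT x|\<mu>. \<bar>f' n x - f x\<bar>) * B" by simp
  qed
  show "(\<lambda>n. (LINT x|\<mu>. \<bar>f' n x - f x\<bar>) * B) \<longlonglongrightarrow> 0"
    using tendsto_mult_left_zero[OF lim] .
qed

lemma test_function_div_p:
  assumes \<phi>: "test_function (pdf_dom p) \<phi>" and i: "i \<in> Basis"
  obtains B B' where "\<And>x. \<bar>\<phi> x / p x\<bar> \<le> B" "(\<lambda>x. \<phi> x / p x) \<in> borel_measurable \<mu>"
    "\<And>x. \<bar>frechet_derivative \<phi> (at x) i / p x\<bar> \<le> B'"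
    "(\<lambda>x. frechet_derivative \<phi> (at x) i / p x) \<in> borel_measurable \<mu>"
proof -
  define S where "S = closure {x. \<phi> x \<noteq> 0}"
  have S: "compact S" "S \<subseteq> pdf_dom p"
    using \<phi> by (auto simp: test_function_def S_def)
  have zero: "\<phi> x = 0" if "x \<notin> S" for x
    using closure_subset[of "{x. \<phi> x \<noteq> 0}"] that by (auto simp: S_def)
  have Ck: "Ck n \<phi>" for n using \<phi> by (simp add: test_function_def)
  have cont: "continuous_on UNIV \<phi>" using Ck[of 0] by simp
  have cont': "continuous_on UNIV (\<lambda>x. frechet_derivative \<phi> (at x) i)"
    using Ck[of "Suc 0"] i by simp
  have zero': "frechet_derivative \<phi> (at x) i = 0" if "x \<notin> S" for x
  proof -
    have "open (- S)" using S(1) by (simp add: compact_imp_closed open_Compl)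
    then have "(\<phi> has_derivative (\<lambda>x. 0)) (at x)"
      by (rule has_derivative_transform_within_open[OF has_derivative_const[of 0]])
        (use that zero in auto)
    then show ?thesis by (simp add: frechet_derivative_at[symmetric])
  qed
  obtain B where B: "\<And>x. \<bar>\<phi> x / p x\<bar> \<le> B" "(\<lambda>x. \<phi> x / p x) \<in> borel_measurable \<mu>"
  proof (rule bounded_div_p[OF cont S])
    show "\<phi> x = 0" if "x \<notin> S" for x using that by (rule zero)
  qed blast
  obtain B' where B': "\<And>x. \<bar>frechet_derivative \<phi> (at x) i / p x\<bar> \<le> B'"
    "(\<lambda>x. frechet_derivative \<phi> (at x) i / p x) \<in> borel_measurable \<mu>"
  proof (rule bounded_div_p[OF cont' S])
    show "frechet_derivative \<phi> (at x) i = 0" if "x \<notin> S" for x using that by (rule zero')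
  qed blast
  show ?thesis by (rule that[OF B B'])
qed

lemma has_weak_gradient_add_scaleR:
  assumes G: "has_weak_gradient (pdf_dom p) u G" and H: "has_weak_gradient (pdf_dom p) v H"
    and int: "integrable \<mu> u" "integrable \<mu> v" "integrable \<mu> G" "integrable \<mu> H"
  shows "has_weak_gradient (pdf_dom p) (\<lambda>x. u x + c * v x) (\<lambda>x. G x + c *\<^sub>R H x)"
  unfolding has_weak_gradient_def
proof (intro conjI allI ballI impI)
  show "locally_integrable_on (pdf_dom p) (\<lambda>x. u x + c * v x)"
    "locally_integrable_on (pdf_dom p) (\<lambda>x. G x + c *\<^sub>R H x)"
    using int by (auto intro!: locally_integrable_on_dom)
  fix \<phi> and i :: 'a assume \<phi>: "test_function (pdf_dom p) \<phi>" and i: "i \<in> Basis"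
  obtain B B' where B: "\<And>x. \<bar>\<phi> x / p x\<bar> \<le> B" "(\<lambda>x. \<phi> x / p x) \<in> borel_measurable \<mu>"
    and B': "\<And>x. \<bar>frechet_derivative \<phi> (at x) i / p x\<bar> \<le> B'"
      "(\<lambda>x. frechet_derivative \<phi> (at x) i / p x) \<in> borel_measurable \<mu>"
    by (rule test_function_div_p[OF \<phi> i]) blast
  have u: "(LINT x|\<mu>. u x * (frechet_derivative \<phi> (at x) i / p x)) = - (LINT x|\<mu>. (G x \<bullet> i) * (\<phi> x / p x))"
    using G \<phi> i unfolding has_weak_gradient_def set_integral_dom_eq by blast
  have v: "(LINT x|\<mu>. v x * (frechet_derivative \<phi> (at x) i / p x)) = - (LINT x|\<mu>. (H x \<bullet> i) * (\<phi> x / p x))"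
    using H \<phi> i unfolding has_weak_gradient_def set_integral_dom_eq by blast
  have Gi: "integrable \<mu> (\<lambda>x. G x \<bullet> i)" and Hi: "integrable \<mu> (\<lambda>x. H x \<bullet> i)"
    using int by auto
  note ints = integrable_mult_bounded[OF int(1) B'] integrable_mult_bounded[OF int(2) B']
    integrable_mult_bounded[OF Gi B] integrable_mult_bounded[OF Hi B]
  have "(LINT x|\<mu>. (u x + c * v x) * (frechet_derivative \<phi> (at x) i / p x))
      = (LINT x|\<mu>. u x * (frechet_derivative \<phi> (at x) i / p x) + c * (v x * (frechet_derivative \<phi> (at x) i / p x)))"
    by (simp only: distrib_right mult.assoc)
  also have "\<dots> = (LINT x|\<mu>. u x * (frechet_derivative \<phi> (at x) i / p x))
      + c * (LINT x|\<mu>. v x * (frechet_derivative \<phi> (at x) i / p x))"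
    by (simp only: Bochner_Integration.integral_add[OF ints(1) integrable_mult_right[OF ints(2)]]
        integral_mult_right_zero)
  also have "\<dots> = - ((LINT x|\<mu>. (G x \<bullet> i) * (\<phi> x / p x)) + c * (LINT x|\<mu>. (H x \<bullet> i) * (\<phi> x / p x)))"
    by (simp only: u v)
  also have "(LINT x|\<mu>. (G x \<bullet> i) * (\<phi> x / p x)) + c * (LINT x|\<mu>. (H x \<bullet> i) * (\<phi> x / p x))
      = (LINT x|\<mu>. (G x \<bullet> i) * (\<phi> x / p x) + c * ((H x \<bullet> i) * (\<phi> x / p x)))"
    by (simp only: Bochner_Integration.integral_add[OF ints(3) integrable_mult_right[OF ints(4)]]
        integral_mult_right_zero)
  also have "\<dots> = (LINT x|\<mu>. ((G x + c *\<^sub>R H x) \<bullet> i) * (\<phi> x / p x))"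
    by (simp only: inner_add_left inner_scaleR_left distrib_right mult.assoc)
  finally show "(LINT x:pdf_dom p|lebesgue. (u x + c * v x) * frechet_derivative \<phi> (at x) i)
      = - (LINT x:pdf_dom p|lebesgue. ((G x + c *\<^sub>R H x) \<bullet> i) * \<phi> x)"
    unfolding set_integral_dom_eq .
qed

text \<open>Over \<mu>, both sides of the integration by parts are pairings with bounded
  multipliers, so they pass to L^1(\<mu>) limits. Applied to a constant sequence, this also shows
  that null set modifications keep a weak gradient.\<close>

lemma has_weak_gradient_limit:
  assumes G: "\<And>n. has_weak_gradient (pdf_dom p) (u' n) (G' n)"
    and int: "\<And>n. integrable \<mu> (u' n)" "integrable \<mu> u" "\<And>n. integrable \<mu> (G' n)" "integrable \<mu> G"
    and lim: "(\<lambda>n. LINT x|\<mu>. \<bar>u' n x - u x\<bar>) \<longlonglongrightarrow> 0" "(\<lambda>n. LINT x|\<mu>. norm (G' n x - G x)) \<longlonglongrightarrow> 0"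
  shows "has_weak_gradient (pdf_dom p) u G"
  unfolding has_weak_gradient_def
proof (intro conjI allI ballI impI)
  show "locally_integrable_on (pdf_dom p) u" "locally_integrable_on (pdf_dom p) G"
    using int by (auto intro: locally_integrable_on_dom)
  fix \<phi> and i :: 'a assume \<phi>: "test_function (pdf_dom p) \<phi>" and i: "i \<in> Basis"
  obtain B B' where B: "\<And>x. \<bar>\<phi> x / p x\<bar> \<le> B" "(\<lambda>x. \<phi> x / p x) \<in> borel_measurable \<mu>"
    and B': "\<And>x. \<bar>frechet_derivative \<phi> (at x) i / p x\<bar> \<le> B'"
      "(\<lambda>x. frechet_derivative \<phi> (at x) i / p x) \<in> borel_measurable \<mu>"
    by (rule test_function_div_p[OF \<phi> i]) blast
  have 1: "(\<lambda>n. LINT x|\<mu>. u' n x * (frechet_derivative \<phi> (at x) i / p x))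
      \<longlonglongrightarrow> (LINT x|\<mu>. u x * (frechet_derivative \<phi> (at x) i / p x))"
    by (rule tendsto_integral_mult_bounded[OF int(1,2) lim(1) B'])
  have "(\<lambda>n. LINT x|\<mu>. \<bar>G' n x \<bullet> i - G x \<bullet> i\<bar>) \<longlonglongrightarrow> 0"
  proof (rule Lim_null_comparison[OF always_eventually lim(2)], rule allI)
    fix n
    have "(LINT x|\<mu>. \<bar>G' n x \<bullet> i - G x \<bullet> i\<bar>) \<le> (LINT x|\<mu>. norm (G' n x - G x))"
    proof (rule integral_mono)
      show "\<bar>G' n x \<bullet> i - G x \<bullet> i\<bar> \<le> norm (G' n x - G x)" for x
        using Basis_le_norm[OF i, of "G' n x - G x"] by (simp add: inner_diff_left)
    qed (use int in auto)
    then show "norm (LINT x|\<mu>. \<bar>G' n x \<bullet> i - G x \<bullet> i\<bar>) \<le> (LINT x|\<mu>. norm (G' n x - G x))"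
      by simp
  qed
  then have 2: "(\<lambda>n. LINT x|\<mu>. (G' n x \<bullet> i) * (\<phi> x / p x)) \<longlonglongrightarrow> (LINT x|\<mu>. (G x \<bullet> i) * (\<phi> x / p x))"
    by (intro tendsto_integral_mult_bounded[OF _ _ _ B]) (use int in auto)
  have "(LINT x|\<mu>. u' n x * (frechet_derivative \<phi> (at x) i / p x)) = - (LINT x|\<mu>. (G' n x \<bullet> i) * (\<phi> x / p x))" for n
    using G[of n] \<phi> i unfolding has_weak_gradient_def set_integral_dom_eq by blast
  with 1 have "(\<lambda>n. - (LINT x|\<mu>. (G' n x \<bullet> i) * (\<phi> x / p x)))
      \<longlonglongrightarrow> (LINT x|\<mu>. u x * (frechet_derivative \<phi> (at x) i / p x))" by simp
  from LIMSEQ_unique[OF this tendsto_minus[OF 2]]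
  show "(LINT x:pdf_dom p|lebesgue. u x * frechet_derivative \<phi> (at x) i)
      = - (LINT x:pdf_dom p|lebesgue. (G x \<bullet> i) * \<phi> x)"
    unfolding set_integral_dom_eq .
qed

end

section \<open>Square-integrable functions and the variational problem\<close>

text \<open>The notion \<open>in_L2\<close> for an arbitrary measure and Euclidean values: it serves
  \<mu> and \<open>lborel\<close> alike, and functions, gradients and pairs of the two.\<close>

definition square_integrable :: "'a measure \<Rightarrow> ('a \<Rightarrow> 'b::euclidean_space) \<Rightarrow> bool" where
  "square_integrable M f \<longleftrightarrow> f \<in> borel_measurable M \<and> integrable M (\<lambda>x. (norm (f x))\<^sup>2)"

lemma square_integrable_measurable: "square_integrable M f \<Longrightarrow> f \<in> borel_measurable M"
  and square_integrable_integrable: "square_integrable M f \<Longrightarrow> integrable M (\<lambda>x. (norm (f x))\<^sup>2)"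
  by (simp_all add: square_integrable_def)

lemma square_integrable_iff_nn_integral:
  "f \<in> borel_measurable M \<Longrightarrow>
    square_integrable M f \<longleftrightarrow> (\<integral>\<^sup>+x. ennreal ((norm (f x))\<^sup>2) \<partial>M) < \<infinity>"
  by (simp add: square_integrable_def integrable_iff_bounded)

lemma nn_integral_eq_square_integral:
  "square_integrable M f \<Longrightarrow> (\<integral>\<^sup>+x. ennreal ((norm (f x))\<^sup>2) \<partial>M) = ennreal (LINT x|M. (norm (f x))\<^sup>2)"
  by (intro nn_integral_eq_integral square_integrable_integrable) auto

lemma norm_add_sq_le: "(norm (a + b))\<^sup>2 \<le> 2 * (norm a)\<^sup>2 + 2 * (norm (b::'a::real_normed_vector))\<^sup>2"
proof -
  have "(norm (a + b))\<^sup>2 \<le> (norm a + norm b)\<^sup>2"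
    by (intro power_mono norm_triangle_ineq) auto
  also have "\<dots> \<le> 2 * (norm a)\<^sup>2 + 2 * (norm b)\<^sup>2"
    using sum_squares_bound[of "norm a" "norm b"] by (simp add: power2_sum)
  finally show ?thesis .
qed

lemma norm_diff_sq_le: "(norm (a - b))\<^sup>2 \<le> 2 * (norm a)\<^sup>2 + 2 * (norm (b::'a::real_normed_vector))\<^sup>2"
  using norm_add_sq_le[of a "- b"] by simp

lemma square_integrable_bound:
  assumes g: "square_integrable M g" and f: "f \<in> borel_measurable M"
    and le: "AE x in M. norm (f x) \<le> norm (g x)"
  shows "square_integrable M f"
  unfolding square_integrable_def
proof
  show "integrable M (\<lambda>x. (norm (f x))\<^sup>2)"
    by (rule Bochner_Integration.integrable_bound[OF square_integrable_integrable[OF g]])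
      (use f le in \<open>auto simp: power_mono elim!: eventually_mono\<close>)
qed (rule f)

lemma square_integrable_add:
  assumes "square_integrable M f" "square_integrable M g"
  shows "square_integrable M (\<lambda>x. f x + g x)"
  unfolding square_integrable_def
proof
  have [measurable]: "f \<in> borel_measurable M" "g \<in> borel_measurable M"
    using assms by (simp_all add: square_integrable_def)
  show "(\<lambda>x. f x + g x) \<in> borel_measurable M" by measurable
  show "integrable M (\<lambda>x. (norm (f x + g x))\<^sup>2)"
  proof (rule Bochner_Integration.integrable_bound)
    show "integrable M (\<lambda>x. 2 * (norm (f x))\<^sup>2 + 2 * (norm (g x))\<^sup>2)"
      using assms by (auto simp: square_integrable_def)
  qed (auto intro!: AE_I2 simp: norm_add_sq_le)
qed

lemma square_integrable_scaleR:
  "square_integrable M f \<Longrightarrow> square_integrable M (\<lambda>x. c *\<^sub>R f x)"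
  by (auto simp: square_integrable_def power_mult_distrib)

lemma square_integrable_diff:
  "square_integrable M f \<Longrightarrow> square_integrable M g \<Longrightarrow> square_integrable M (\<lambda>x. f x - g x)"
  using square_integrable_add[OF _ square_integrable_scaleR[of M g "-1"], of f] by simp

lemma square_integrable_fst: "square_integrable M F \<Longrightarrow> square_integrable M (\<lambda>x. fst (F x))"
  and square_integrable_snd: "square_integrable M F \<Longrightarrow> square_integrable M (\<lambda>x. snd (F x))"
proof -
  assume F: "square_integrable M F"
  then have m: "F \<in> borel_measurable M" by (rule square_integrable_measurable)
  show "square_integrable M (\<lambda>x. fst (F x))"
  proof (rule square_integrable_bound[OF F])
    show "(\<lambda>x. fst (F x)) \<in> borel_measurable M"
      by (intro borel_measurable_continuous_on[OF _ m] continuous_intros)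
  qed (use norm_fst_le[of "fst (F x)" "snd (F x)" for x] in \<open>auto intro!: AE_I2\<close>)
  show "square_integrable M (\<lambda>x. snd (F x))"
  proof (rule square_integrable_bound[OF F])
    show "(\<lambda>x. snd (F x)) \<in> borel_measurable M"
      by (intro borel_measurable_continuous_on[OF _ m] continuous_intros)
  qed (use norm_snd_le[of "snd (F x)" "fst (F x)" for x] in \<open>auto intro!: AE_I2\<close>)
qed

lemma square_integrable_Pair:
  assumes "square_integrable M f" "square_integrable M g"
  shows "square_integrable M (\<lambda>x. (f x, g x))"
  unfolding square_integrable_def
proof
  show "(\<lambda>x. (f x, g x)) \<in> borel_measurable M"
    using assms by (auto simp: square_integrable_def intro: borel_measurable_Pair)
  show "integrable M (\<lambda>x. (norm (f x, g x))\<^sup>2)"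
    using assms by (simp add: square_integrable_def norm_Pair)
qed

lemma integrable_inner_square_integrable:
  assumes "square_integrable M f" "square_integrable M g"
  shows "integrable M (\<lambda>x. f x \<bullet> g x)"
proof (rule Bochner_Integration.integrable_bound)
  have [measurable]: "f \<in> borel_measurable M" "g \<in> borel_measurable M"
    using assms by (simp_all add: square_integrable_def)
  show "(\<lambda>x. f x \<bullet> g x) \<in> borel_measurable M" by measurable
  show "integrable M (\<lambda>x. (norm (f x))\<^sup>2 + (norm (g x))\<^sup>2)"
    using assms by (auto simp: square_integrable_def)
  have "\<bar>f x \<bullet> g x\<bar> \<le> (norm (f x))\<^sup>2 + (norm (g x))\<^sup>2" for x
    using Cauchy_Schwarz_ineq2[of "f x" "g x"] sum_squares_bound[of "norm (f x)" "norm (g x)"]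
      mult_nonneg_nonneg[of "norm (f x)" "norm (g x)"] by simp
  then show "AE x in M. norm (f x \<bullet> g x) \<le> norm ((norm (f x))\<^sup>2 + (norm (g x))\<^sup>2)"
    by auto
qed

text \<open>Evaluation at the vertex t = - b / c. Besides Cauchy-Schwarz it serves the variational
  argument, where a is the distance of an energy from its infimum and b the defect in the
  Euler-Lagrange equation.\<close>

lemma discriminant_le:
  fixes a b c :: real
  assumes nonneg: "\<And>t. 0 \<le> a + 2 * t * b + t\<^sup>2 * c" and c: "c \<ge> 0"
  shows "b\<^sup>2 \<le> a * c"
proof (cases "c = 0")
  case True
  have "b = 0"
  proof (rule ccontr)
    assume "b \<noteq> 0"
    \<comment> \<open>The chosen t makes a + 2 t b equal to -1.\<close>
    then show False
      using nonneg[of "- (a + 1) / (2 * b)"] True by (simp add: field_simps)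
  qed
  then show ?thesis using True by simp
next
  case False
  with c have "c > 0" by simp
  have "0 \<le> (a + 2 * (- b / c) * b + (- b / c)\<^sup>2 * c) * c"
    using nonneg[of "- b / c"] c by (rule mult_nonneg_nonneg)
  also have "\<dots> = a * c - b\<^sup>2"
    using \<open>c > 0\<close> by (simp add: field_simps power2_eq_square)
  finally show ?thesis by simp
qed

lemma square_integral_add_scaleR:
  assumes "square_integrable M f" "square_integrable M g"
  shows "(LINT x|M. (norm (f x + t *\<^sub>R g x))\<^sup>2)
    = (LINT x|M. (norm (f x))\<^sup>2) + 2 * t * (LINT x|M. f x \<bullet> g x) + t\<^sup>2 * (LINT x|M. (norm (g x))\<^sup>2)"
proof -
  have "(norm (f x + t *\<^sub>R g x))\<^sup>2 = (norm (f x))\<^sup>2 + (2 * t) * (f x \<bullet> g x) + t\<^sup>2 * (norm (g x))\<^sup>2" for x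
    unfolding power2_norm_eq_inner
    by (simp add: inner_add_left inner_add_right inner_commute[of "g x" "f x"]
        power2_eq_square algebra_simps)
  then show ?thesis
    using assms by (simp add: square_integrable_def integrable_inner_square_integrable[OF assms])
qed

lemma integral_Cauchy_Schwarz:
  assumes "square_integrable M f" "square_integrable M g"
  shows "(LINT x|M. f x \<bullet> g x)\<^sup>2 \<le> (LINT x|M. (norm (f x))\<^sup>2) * (LINT x|M. (norm (g x))\<^sup>2)"
proof (rule discriminant_le)
  fix t
  have "0 \<le> (LINT x|M. (norm (f x + t *\<^sub>R g x))\<^sup>2)" by simp
  then show "0 \<le> (LINT x|M. (norm (f x))\<^sup>2) + 2 * t * (LINT x|M. f x \<bullet> g x) + t\<^sup>2 * (LINT x|M. (norm (g x))\<^sup>2)"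
    unfolding square_integral_add_scaleR[OF assms] .
qed simp

text \<open>The weight 2^n forces increments of size at most sqrt S * 2^(-n/2); these are summable
  and the sequence telescopes.\<close>

lemma convergent_of_summable_weighted_squares:
  fixes f :: "nat \<Rightarrow> 'b::banach"
  assumes "\<And>n. 2 ^ n * (norm (f (Suc n) - f n))\<^sup>2 \<le> S"
  shows "convergent f"
proof -
  have le: "norm (f (Suc n) - f n) \<le> sqrt S * (1 / sqrt 2) ^ n" for n
  proof -
    have "(norm (f (Suc n) - f n))\<^sup>2 \<le> S / 2 ^ n"
      using assms[of n] by (simp add: field_simps)
    then have "norm (f (Suc n) - f n) \<le> sqrt (S / 2 ^ n)"
      by (rule real_le_rsqrt)
    also have "\<dots> = sqrt S * (1 / sqrt 2) ^ n"
      by (simp only: real_sqrt_divide real_sqrt_power power_one_over) (simp add: divide_inverse)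
    finally show ?thesis .
  qed
  have "summable (\<lambda>n. sqrt S * (1 / sqrt 2) ^ n)"
    by (intro summable_mult summable_geometric) simp
  then have "summable (\<lambda>n. f (Suc n) - f n)"
    by (rule summable_comparison_test'[of _ 0]) (rule le)
  then have "convergent (\<lambda>n. \<Sum>i<n. f (Suc i) - f i)"
    by (simp add: summable_iff_convergent)
  then have "convergent (\<lambda>n. (f n - f 0) + f 0)"
    unfolding sum_lessThan_telescope by (intro convergent_add convergent_const)
  then show ?thesis by simp
qed

lemma member_le_suminf_ennreal: "f n \<le> (\<Sum>n. f n)" for f :: "nat \<Rightarrow> ennreal"
  using sum_le_suminf[OF summableI finite.insertI[OF finite.emptyI], of n f] by simp

text \<open>Riesz-Fischer for a prescribed rate, so that the given sequence itself converges almost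
  everywhere: the rate (1/8)^n leaves (1/4)^n after weighting by 2^n, hence the weighted sum of
  squared increments is finite almost everywhere. Fatou's lemma carries the bound to the
  limit.\<close>

lemma L2_complete_geometric:
  fixes f :: "nat \<Rightarrow> 'a \<Rightarrow> 'b::euclidean_space"
  assumes f: "\<And>n. square_integrable M (f n)"
    and cauchy: "\<And>m n. n \<le> m \<Longrightarrow> (LINT x|M. (norm (f m x - f n x))\<^sup>2) \<le> A * (1/8) ^ n"
  obtains g where "square_integrable M g" "\<And>n. (LINT x|M. (norm (f n x - g x))\<^sup>2) \<le> A * (1/8) ^ n"
proof -
  have [measurable]: "f n \<in> borel_measurable M" for n
    using f by (rule square_integrable_measurable)
  have A: "A \<ge> 0" using cauchy[of 0 0] by simp
  have nn: "(\<integral>\<^sup>+x. ennreal ((norm (f m x - f n x))\<^sup>2) \<partial>M) \<le> ennreal (A * (1/8) ^ n)" if "n \<le> m" for m n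
    using cauchy[OF that] nn_integral_eq_square_integral[OF square_integrable_diff[OF f f]]
    by (simp add: ennreal_leI)
  define T where "T x = (\<Sum>n. ennreal (2 ^ n * (norm (f (Suc n) x - f n x))\<^sup>2))" for x
  have "(\<integral>\<^sup>+x. T x \<partial>M) = (\<Sum>n. \<integral>\<^sup>+x. ennreal (2 ^ n * (norm (f (Suc n) x - f n x))\<^sup>2) \<partial>M)"
    unfolding T_def by (intro nn_integral_suminf) measurable
  also have "\<dots> \<le> (\<Sum>n. ennreal (A * (1/4) ^ n))"
  proof (intro suminf_le summableI)
    fix n
    have "(\<integral>\<^sup>+x. ennreal (2 ^ n * (norm (f (Suc n) x - f n x))\<^sup>2) \<partial>M)
        = ennreal (2 ^ n) * (\<integral>\<^sup>+x. ennreal ((norm (f (Suc n) x - f n x))\<^sup>2) \<partial>M)"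
      by (subst nn_integral_cmult[symmetric]) (auto simp: ennreal_mult)
    also have "\<dots> \<le> ennreal (2 ^ n) * ennreal (A * (1/8) ^ n)"
      by (intro mult_left_mono nn) auto
    also have "\<dots> = ennreal (A * (1/4) ^ n)"
    proof -
      have "2 ^ n * (A * (1/8) ^ n) = A * (2 * (1/8)) ^ n"
        by (simp only: power_mult_distrib mult_ac)
      then show ?thesis using A by (simp add: ennreal_mult[symmetric])
    qed
    finally show "(\<integral>\<^sup>+x. ennreal (2 ^ n * (norm (f (Suc n) x - f n x))\<^sup>2) \<partial>M) \<le> ennreal (A * (1/4) ^ n)" .
  qed
  also have "\<dots> = ennreal (\<Sum>n. A * (1/4) ^ n)"
    using A by (intro suminf_ennreal2 summable_mult summable_geometric) auto
  finally have "(\<integral>\<^sup>+x. T x \<partial>M) \<noteq> \<infinity>"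
    by (auto simp: top_unique)
  then have AE_T: "AE x in M. T x \<noteq> \<infinity>"
    by (intro nn_integral_PInf_AE) (auto simp: T_def)
  have AE_conv: "AE x in M. convergent (\<lambda>n. f n x)"
    using AE_T
  proof eventually_elim
    case (elim x)
    show ?case
    proof (rule convergent_of_summable_weighted_squares)
      fix n
      have "ennreal (2 ^ n * (norm (f (Suc n) x - f n x))\<^sup>2) \<le> T x"
        unfolding T_def by (rule member_le_suminf_ennreal)
      then show "2 ^ n * (norm (f (Suc n) x - f n x))\<^sup>2 \<le> enn2real (T x)"
        using elim enn2real_mono[of "ennreal (2 ^ n * (norm (f (Suc n) x - f n x))\<^sup>2)" "T x"]
        by (simp add: less_top)
    qed
  qed
  define g where "g x = lim (\<lambda>n. f n x)" for x
  have [measurable]: "g \<in> borel_measurable M"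
    unfolding g_def by measurable
  have bound: "(\<integral>\<^sup>+x. ennreal ((norm (f n x - g x))\<^sup>2) \<partial>M) \<le> ennreal (A * (1/8) ^ n)" for n
  proof -
    have "(\<integral>\<^sup>+x. ennreal ((norm (f n x - g x))\<^sup>2) \<partial>M)
        = (\<integral>\<^sup>+x. liminf (\<lambda>m. ennreal ((norm (f m x - f n x))\<^sup>2)) \<partial>M)"
    proof (rule nn_integral_cong_AE, use AE_conv in eventually_elim)
      case (elim x)
      then have "(\<lambda>m. f m x) \<longlonglongrightarrow> g x"
        by (simp add: g_def convergent_LIMSEQ_iff)
      then have "(\<lambda>m. ennreal ((norm (f m x - f n x))\<^sup>2)) \<longlonglongrightarrow> ennreal ((norm (g x - f n x))\<^sup>2)"
        by (intro tendsto_intros)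
      from lim_imp_Liminf[OF sequentially_bot this] show ?case
        by (simp add: norm_minus_commute)
    qed
    also have "\<dots> \<le> liminf (\<lambda>m. \<integral>\<^sup>+x. ennreal ((norm (f m x - f n x))\<^sup>2) \<partial>M)"
      by (intro nn_integral_liminf) measurable
    also have "\<dots> \<le> liminf (\<lambda>m. ennreal (A * (1/8) ^ n))"
      by (intro Liminf_mono eventually_sequentiallyI[of n] nn)
    finally show ?thesis by (simp add: Liminf_const)
  qed
  have diff: "square_integrable M (\<lambda>x. f n x - g x)" for n
    using le_less_trans[OF bound[of n]] by (subst square_integrable_iff_nn_integral) auto
  show ?thesis
  proof
    show "square_integrable M g"
      using square_integrable_diff[OF f[of 0] diff[of 0]] by simp
    show "(LINT x|M. (norm (f n x - g x))\<^sup>2) \<le> A * (1/8) ^ n" for n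
      using bound[of n] A unfolding nn_integral_eq_square_integral[OF diff[of n]]
      by (simp add: ennreal_le_iff)
  qed
qed

section \<open>Existence of weak solutions by minimisation\<close>

lemma tendsto_zero_of_power2_le:
  fixes x y :: "nat \<Rightarrow> real"
  assumes "\<And>n. (x n)\<^sup>2 \<le> y n" "y \<longlonglongrightarrow> 0"
  shows "x \<longlonglongrightarrow> 0"
proof -
  have "(\<lambda>n. sqrt (y n)) \<longlonglongrightarrow> sqrt 0"
    using assms(2) by (rule tendsto_real_sqrt)
  moreover have "norm (x n) \<le> sqrt (y n)" for n
    using assms(1)[of n] by (simp add: real_le_rsqrt)
  ultimately show ?thesis
    by (intro Lim_null_comparison[of x "\<lambda>n. sqrt (y n)"]) simp_all
qed

text \<open>The minimiser of \<open>\<integral>|snd F|\<^sup>2 - 2 \<integral>h fst F\<close> over \<open>S\<close> solves the weak equation; the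
  minimising sequence is Cauchy by the parallelogram identity.\<close>

lemma weak_solution_exists:
  fixes S :: "('a \<Rightarrow> real \<times> 'v::euclidean_space) set" and h :: "'a \<Rightarrow> real"
  assumes S_L2: "\<And>F. F \<in> S \<Longrightarrow> square_integrable M F"
    and S_0: "(\<lambda>x. 0) \<in> S"
    and S_add: "\<And>F G c. F \<in> S \<Longrightarrow> G \<in> S \<Longrightarrow> (\<lambda>x. F x + c *\<^sub>R G x) \<in> S"
    and S_closed: "\<And>Fn F. (\<And>n::nat. Fn n \<in> S) \<Longrightarrow> square_integrable M F \<Longrightarrow>
      (\<lambda>n. LINT x|M. (norm (Fn n x - F x))\<^sup>2) \<longlonglongrightarrow> 0 \<Longrightarrow> F \<in> S"
    and h: "square_integrable M h"
    and poincare: "\<And>F. F \<in> S \<Longrightarrow> (LINT x|M. (fst (F x))\<^sup>2) \<le> C * (LINT x|M. (norm (snd (F x)))\<^sup>2)"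
    and C: "C \<ge> 0"
  obtains F where "F \<in> S" "\<And>\<Phi>. \<Phi> \<in> S \<Longrightarrow> (LINT x|M. snd (F x) \<bullet> snd (\<Phi> x)) = (LINT x|M. h x * fst (\<Phi> x))"
proof -
  define q where "q F = (LINT x|M. (norm (snd (F x)))\<^sup>2)" for F :: "'a \<Rightarrow> real \<times> 'v"
  define b where "b F G = (LINT x|M. snd (F x) \<bullet> snd (G x))" for F G :: "'a \<Rightarrow> real \<times> 'v"
  define l where "l F = (LINT x|M. h x * fst (F x))" for F :: "'a \<Rightarrow> real \<times> 'v"
  define J where "J F = q F - 2 * l F" for F
  have q_nonneg: "q F \<ge> 0" for F by (simp add: q_def)
  have L2f: "square_integrable M (\<lambda>x. fst (F x))" and L2s: "square_integrable M (\<lambda>x. snd (F x))"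
    if "F \<in> S" for F
    using S_L2[OF that] by (rule square_integrable_fst square_integrable_snd)+
  have q_add: "q (\<lambda>x. F x + t *\<^sub>R G x) = q F + 2 * t * b F G + t\<^sup>2 * q G" if "F \<in> S" "G \<in> S" for F G t
    using square_integral_add_scaleR[OF L2s[OF that(1)] L2s[OF that(2)]] by (simp add: q_def b_def)
  have l_add: "l (\<lambda>x. F x + t *\<^sub>R G x) = l F + t * l G" if "F \<in> S" "G \<in> S" for F G t
  proof -
    have "integrable M (\<lambda>x. h x * fst (F x))" "integrable M (\<lambda>x. h x * fst (G x))"
      using integrable_inner_square_integrable[OF h L2f[OF that(1)]]
        integrable_inner_square_integrable[OF h L2f[OF that(2)]] by simp_all
    then show ?thesis
      by (simp add: l_def distrib_left mult.left_commute[of _ t])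
  qed
  \<comment> \<open>Cauchy-Schwarz for h and the Poincare inequality give (l F)^2 <= K q F with this
    K. Hence 2 l F <= q F + K, and J is bounded below by - K.\<close>
  define K where "K = (LINT x|M. (norm (h x))\<^sup>2) * C"
  have K: "K \<ge> 0" using C by (simp add: K_def)
  have l_bound: "(l F)\<^sup>2 \<le> K * q F" if "F \<in> S" for F
  proof -
    have "(l F)\<^sup>2 \<le> (LINT x|M. (norm (h x))\<^sup>2) * (LINT x|M. (norm (fst (F x)))\<^sup>2)"
      using integral_Cauchy_Schwarz[OF h L2f[OF that]] by (simp add: l_def)
    also have "\<dots> \<le> (LINT x|M. (norm (h x))\<^sup>2) * (C * q F)"
      using poincare[OF that] by (intro mult_left_mono) (auto simp: q_def)
    finally show ?thesis by (simp add: K_def mult.assoc)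
  qed
  have J_bound: "J F \<ge> - K" if "F \<in> S" for F
  proof -
    have "(2 * l F)\<^sup>2 \<le> (q F + K)\<^sup>2"
      using l_bound[OF that] sum_squares_bound[of "q F" K]
      by (simp add: power2_sum power_mult_distrib mult.commute)
    then have "2 * l F \<le> q F + K"
      by (rule power2_le_imp_le) (use q_nonneg[of F] K in simp)
    then show ?thesis by (simp add: J_def)
  qed
  define m where "m = Inf (J ` S)"
  have bdd: "bdd_below (J ` S)"
    using J_bound by (auto simp: bdd_below_def)
  have m_le: "m \<le> J F" if "F \<in> S" for F
    unfolding m_def using bdd that by (intro cInf_lower) auto
  have "\<exists>F\<in>S. J F < m + (1/8) ^ n" for n
    using cInf_lessD[of "J ` S" "m + (1/8) ^ n"] S_0 by (auto simp: m_def)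
  then obtain Fn where Fn: "\<And>n. Fn n \<in> S" "\<And>n. J (Fn n) < m + (1/8) ^ n"
    by metis
  \<comment> \<open>The parallelogram identity gives q (Fn n - Fn k) = 2 q (Fn n) + 2 q (Fn k) - q
    (Fn n + Fn k). The half sum is a competitor, so its J is at least m, and only the two excesses
    over m remain.\<close>
  have step: "2 * (1/8) ^ n + 2 * (1/8) ^ k \<ge> q (\<lambda>x. Fn n x - Fn k x)" for n k
  proof -
    define G where "G = (\<lambda>x. Fn n x + 1 *\<^sub>R Fn k x)"
    have G: "G \<in> S" using S_add[OF Fn(1) Fn(1)] by (simp only: G_def)
    \<comment> \<open>Closure under scaling is closure under addition of a multiple to the zero
      function.\<close>
    have half: "(\<lambda>x. 0 + (1/2) *\<^sub>R G x) \<in> S" by (rule S_add[OF S_0 G])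
    have "m \<le> J (\<lambda>x. 0 + (1/2) *\<^sub>R G x)" by (rule m_le[OF half])
    also have "\<dots> = q G / 4 - l G"
      using q_add[OF S_0 G, of "1/2"] l_add[OF S_0 G, of "1/2"]
      by (simp add: J_def q_def b_def l_def power2_eq_square)
    finally have "4 * m \<le> q G - 4 * l G" by simp
    moreover have "q G = q (Fn n) + 2 * b (Fn n) (Fn k) + q (Fn k)" "l G = l (Fn n) + l (Fn k)"
      using q_add[OF Fn(1) Fn(1), of n 1 k] l_add[OF Fn(1) Fn(1), of n 1 k] by (simp_all add: G_def)
    moreover have "q (\<lambda>x. Fn n x - Fn k x) = q (Fn n) - 2 * b (Fn n) (Fn k) + q (Fn k)"
      using q_add[OF Fn(1) Fn(1), of n "-1" k] by simp
    ultimately show ?thesis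
      using Fn(2)[of n] Fn(2)[of k] by (simp add: J_def)
  qed
  have diff_S: "(\<lambda>x. F x - G x) \<in> S" if "F \<in> S" "G \<in> S" for F G
    using S_add[OF that, of "-1"] by simp
  have norm_split: "(LINT x|M. (norm (F x))\<^sup>2) = (LINT x|M. (fst (F x))\<^sup>2) + q F" if "square_integrable M F" for F
  proof -
    have "(norm (F x))\<^sup>2 = (norm (fst (F x)))\<^sup>2 + (norm (snd (F x)))\<^sup>2" for x
      by (cases "F x") (simp add: norm_Pair)
    then show ?thesis
      using square_integrable_integrable[OF square_integrable_fst[OF that]]
        square_integrable_integrable[OF square_integrable_snd[OF that]] by (simp add: q_def)
  qed
  \<comment> \<open>The factor C + 1 bounds the full norm of a pair by its gradient part; 4 = 2 + 2
    comes from the parallelogram estimate, both of whose terms are at most (1/8)^n up to the factor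
    2.\<close>
  have cauchy: "(LINT x|M. (norm (Fn k x - Fn n x))\<^sup>2) \<le> ((C + 1) * 4) * (1/8) ^ n" if "n \<le> k" for n k
  proof -
    have "(LINT x|M. (norm (Fn k x - Fn n x))\<^sup>2)
        = (LINT x|M. (fst (Fn k x - Fn n x))\<^sup>2) + q (\<lambda>x. Fn k x - Fn n x)"
      by (rule norm_split[OF S_L2[OF diff_S[OF Fn(1) Fn(1)]]])
    also have "\<dots> \<le> (C + 1) * q (\<lambda>x. Fn k x - Fn n x)"
      using poincare[OF diff_S[OF Fn(1)[of k] Fn(1)[of n]]] by (simp add: q_def algebra_simps)
    also have "\<dots> \<le> (C + 1) * (4 * (1/8) ^ n)"
    proof (rule mult_left_mono)
      have "(1/8) ^ k \<le> (1/8::real) ^ n" using that by (intro power_decreasing) auto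
      then show "q (\<lambda>x. Fn k x - Fn n x) \<le> 4 * (1/8) ^ n"
        using step[of k n] by linarith
    qed (use C in simp)
    finally show ?thesis by (simp only: mult.assoc)
  qed
  obtain F where F: "square_integrable M F"
    "\<And>n. (LINT x|M. (norm (Fn n x - F x))\<^sup>2) \<le> ((C + 1) * 4) * (1/8) ^ n"
  proof (rule L2_complete_geometric[of M Fn "(C + 1) * 4"])
    show "square_integrable M (Fn n)" for n by (rule S_L2[OF Fn(1)])
    show "(LINT x|M. (norm (Fn k x - Fn n x))\<^sup>2) \<le> (C + 1) * 4 * (1/8) ^ n" if "n \<le> k" for n k
      using that by (rule cauchy)
  qed blast
  have geo: "(\<lambda>n. ((C + 1) * 4) * (1/8) ^ n) \<longlonglongrightarrow> 0"
    by (intro tendsto_mult_right_zero LIMSEQ_power_zero) simp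
  have "(\<lambda>n. LINT x|M. (norm (Fn n x - F x))\<^sup>2) \<longlonglongrightarrow> 0"
  proof (rule tendsto_sandwich[OF _ _ tendsto_const geo])
    show "\<forall>\<^sub>F n in sequentially. (LINT x|M. (norm (Fn n x - F x))\<^sup>2) \<le> (C + 1) * 4 * (1/8) ^ n"
      by (rule always_eventually) (rule allI, rule F(2))
  qed simp
  with Fn(1) F(1) have F_S: "F \<in> S"
    by (intro S_closed[of Fn F]) auto
  have "b F \<Phi> = l \<Phi>" if \<Phi>: "\<Phi> \<in> S" for \<Phi>
  proof -
    \<comment> \<open>Since J (Fn n + t \<Phi>) >= m > J (Fn n) - (1/8)^n for all t, a nonnegative
      quadratic in t arises, and its discriminant bounds the defect of Fn n in the weak equation.
      The equation for F follows because b (Fn n) \<Phi> tends to b F \<Phi>.\<close>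
    have "(b (Fn n) \<Phi> - l \<Phi>)\<^sup>2 \<le> (1/8) ^ n * q \<Phi>" for n
    proof (rule discriminant_le)
      fix t
      have "m \<le> J (\<lambda>x. Fn n x + t *\<^sub>R \<Phi> x)" by (intro m_le S_add Fn(1) \<Phi>)
      then show "0 \<le> (1/8) ^ n + 2 * t * (b (Fn n) \<Phi> - l \<Phi>) + t\<^sup>2 * q \<Phi>"
        using Fn(2)[of n] unfolding J_def q_add[OF Fn(1) \<Phi>] l_add[OF Fn(1) \<Phi>]
        by (simp add: algebra_simps)
    qed (rule q_nonneg)
    moreover have "(\<lambda>n. (1/8) ^ n * q \<Phi>) \<longlonglongrightarrow> 0"
      by (intro tendsto_mult_left_zero LIMSEQ_power_zero) simp
    ultimately have 1: "(\<lambda>n. b (Fn n) \<Phi> - l \<Phi>) \<longlonglongrightarrow> 0"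
      by (rule tendsto_zero_of_power2_le)
    have "(b (Fn n) \<Phi> - b F \<Phi>)\<^sup>2 \<le> ((C + 1) * 4) * (1/8) ^ n * q \<Phi>" for n
    proof -
      have D: "(\<lambda>x. Fn n x - F x) \<in> S" by (rule diff_S[OF Fn(1) F_S])
      have "b (Fn n) \<Phi> - b F \<Phi> = (LINT x|M. snd (Fn n x - F x) \<bullet> snd (\<Phi> x))"
        using integrable_inner_square_integrable[OF L2s[OF Fn(1)] L2s[OF \<Phi>]]
          integrable_inner_square_integrable[OF L2s[OF F_S] L2s[OF \<Phi>]]
        by (simp add: b_def inner_diff_left)
      then have "(b (Fn n) \<Phi> - b F \<Phi>)\<^sup>2 \<le> q (\<lambda>x. Fn n x - F x) * q \<Phi>"
        using integral_Cauchy_Schwarz[OF L2s[OF D] L2s[OF \<Phi>]] by (simp add: q_def)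
      also have "q (\<lambda>x. Fn n x - F x) \<le> (LINT x|M. (norm (Fn n x - F x))\<^sup>2)"
        using norm_split[OF S_L2[OF D]] by simp
      finally show ?thesis
        using F(2)[of n] q_nonneg[of \<Phi>] by (meson mult_right_mono order_trans)
    qed
    then have 2: "(\<lambda>n. b (Fn n) \<Phi> - b F \<Phi>) \<longlonglongrightarrow> 0"
      using tendsto_mult_left_zero[OF geo] by (rule tendsto_zero_of_power2_le)
    show ?thesis
      using LIMSEQ_unique[OF LIM_zero_cancel[OF 1] LIM_zero_cancel[OF 2]] by simp
  qed
  then show ?thesis
    using that[OF F_S] by (simp add: b_def l_def)
qed

section \<open>Mollification\<close>

lemma distr_lborel_reflect:
  fixes c :: "'a::euclidean_space"
  shows "distr lborel borel (\<lambda>x. c - x) = lborel"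
  by (subst (2) lborel_affine[of "-1" c]) (auto simp: density_1)

lemma nn_integral_lborel_reflect:
  fixes c :: "'a::euclidean_space"
  assumes "f \<in> borel_measurable borel"
  shows "(\<integral>\<^sup>+x. f (c - x) \<partial>lborel) = (\<integral>\<^sup>+x. f x \<partial>lborel)"
proof -
  have "(\<integral>\<^sup>+x. f x \<partial>distr lborel borel (\<lambda>x. c - x)) = (\<integral>\<^sup>+x. f (c - x) \<partial>lborel)"
    using assms by (intro nn_integral_distr) simp_all
  then show ?thesis by (simp only: distr_lborel_reflect)
qed

lemma nn_integral_lborel_translate:
  fixes c :: "'a::euclidean_space"
  assumes "f \<in> borel_measurable borel"
  shows "(\<integral>\<^sup>+x. f (x - c) \<partial>lborel) = (\<integral>\<^sup>+x. f x \<partial>lborel)"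
proof -
  have "(\<integral>\<^sup>+x. f x \<partial>distr lborel borel ((+) (- c))) = (\<integral>\<^sup>+x. f (- c + x) \<partial>lborel)"
    using assms by (intro nn_integral_distr) simp_all
  then show ?thesis by (simp add: lborel_distr_plus)
qed

section \<open>Density of continuous functions in L^2 and continuity of translations\<close>

lemma compact_support_uniformly_continuous:
  fixes g :: "'a::euclidean_space \<Rightarrow> 'b::real_normed_vector"
  assumes g: "continuous_on UNIV g" and supp: "\<And>x. norm x > R \<Longrightarrow> g x = 0" and "e > 0"
  obtains d where "d > 0" "\<And>x y. norm (x - y) < d \<Longrightarrow> norm (g x - g y) < e"
proof -
  have "uniformly_continuous_on (cball 0 (R + 1)) g"
    using g by (intro compact_uniformly_continuous) (auto intro: continuous_on_subset)
  then obtain d where d: "d > 0"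
    "\<And>x y. x \<in> cball 0 (R + 1) \<Longrightarrow> y \<in> cball 0 (R + 1) \<Longrightarrow> dist x y < d \<Longrightarrow> dist (g x) (g y) < e"
    using \<open>e > 0\<close> unfolding uniformly_continuous_on_def by metis
  show ?thesis
  \<comment> \<open>Two points at distance less than 1 either both lie in the ball of radius R + 1,
    where uniform continuity applies, or both lie beyond radius R, where g vanishes.\<close>
  proof (rule that[of "min d 1"])
    fix x y :: 'a assume xy: "norm (x - y) < min d 1"
    show "norm (g x - g y) < e"
    proof (cases "norm x \<le> R + 1 \<and> norm y \<le> R + 1")
      case True
      then show ?thesis using d(2)[of x y] xy by (simp add: dist_norm)
    next
      case False
      have "norm x > R" "norm y > R"
        using False xy norm_triangle_ineq3[of x y] by auto
      then show ?thesis using supp \<open>e > 0\<close> by simp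
    qed
  qed (use d in auto)
qed

lemma L2_approx_bounded_support:
  fixes f :: "'a::euclidean_space \<Rightarrow> 'b::euclidean_space"
  assumes f: "square_integrable lborel f" and "e > 0"
  obtains M :: nat where
    "(LINT x|lborel. (norm (f x - (if norm (f x) \<le> M \<and> norm x \<le> M then f x else 0)))\<^sup>2) < e"
proof -
  define fM where "fM M x = (if norm (f x) \<le> real M \<and> norm x \<le> real M then f x else 0)" for M :: nat and x
  have [measurable]: "f \<in> borel_measurable lborel"
    using f by (rule square_integrable_measurable)
  have "(\<lambda>M. LINT x|lborel. (norm (f x - fM M x))\<^sup>2) \<longlonglongrightarrow> (LINT x|(lborel::'a measure). 0)"
  proof (rule integral_dominated_convergence[where w = "\<lambda>x. (norm (f x))\<^sup>2"])
    show "integrable lborel (\<lambda>x. (norm (f x))\<^sup>2)"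
      using f by (rule square_integrable_integrable)
    show "(\<lambda>x. (norm (f x - fM M x))\<^sup>2) \<in> borel_measurable lborel" for M
      unfolding fM_def by measurable
    show "AE x in lborel. (\<lambda>M. (norm (f x - fM M x))\<^sup>2) \<longlonglongrightarrow> 0"
    proof (rule AE_I2)
      fix x
      obtain N :: nat where "max (norm (f x)) (norm x) \<le> real N"
        using real_arch_simple by blast
      then have "fM M x = f x" if "M \<ge> N" for M
        using that by (auto simp: fM_def)
      then have "\<forall>\<^sub>F M in sequentially. 0 = (norm (f x - fM M x))\<^sup>2"
        by (intro eventually_sequentiallyI[of N]) simp
      then show "(\<lambda>M. (norm (f x - fM M x))\<^sup>2) \<longlonglongrightarrow> 0"
        by (rule Lim_transform_eventually[OF tendsto_const])
    qed
    show "AE x in lborel. norm ((norm (f x - fM M x))\<^sup>2) \<le> (norm (f x))\<^sup>2" for M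
      by (rule AE_I2) (simp add: fM_def)
  qed simp
  then have "\<forall>\<^sub>F M in sequentially. (LINT x|lborel. (norm (f x - fM M x))\<^sup>2) < e"
    using \<open>e > 0\<close> by (intro order_tendstoD(2)) simp_all
  then obtain M where "(LINT x|lborel. (norm (f x - fM M x))\<^sup>2) < e"
    unfolding eventually_sequentially by blast
  then show ?thesis by (intro that[of M]) (simp add: fM_def)
qed

text \<open>\<open>measurable_on\<close> provides continuous functions converging to f off a
  negligible set. Projecting their values onto the ball of radius M and multiplying by a cutoff
  gives a common bound and a common bounded support without disturbing the limit, so dominated
  convergence applies.\<close>

lemma L2_approx_continuous_of_bounded:
  fixes f :: "'a::euclidean_space \<Rightarrow> 'b::euclidean_space"
  assumes [measurable]: "f \<in> borel_measurable borel"
    and bnd: "\<And>x. norm (f x) \<le> M" and supp: "\<And>x. norm x > M \<Longrightarrow> f x = 0" and "e > 0"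
  obtains g where "continuous_on UNIV g" "\<And>x. norm x > M + 1 \<Longrightarrow> g x = 0" "square_integrable lborel g"
    "(LINT x|lborel. (norm (f x - g x))\<^sup>2) < e"
proof -
  have M: "M \<ge> 0" using bnd[of 0] norm_ge_zero order_trans by blast
  have "f measurable_on UNIV"
    by (rule lebesgue_measurable_imp_measurable_on) (simp_all add: measurable_completion)
  then obtain N G where N: "negligible N" and G: "\<And>n. continuous_on UNIV (G n)"
      "\<And>x. x \<notin> N \<Longrightarrow> (\<lambda>n. G n x) \<longlonglongrightarrow> f x"
    unfolding measurable_on_def by auto
  define P where "P = closest_point (cball (0::'b) M)"
  have P_norm: "norm (P y) \<le> M" for y
    using closest_point_in_set[of "cball 0 M" y] M by (simp add: P_def)
  have P_self: "P y = y" if "norm y \<le> M" for y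
    unfolding P_def using that by (intro closest_point_self) simp
  have P_cont: "continuous_on S P" for S
    unfolding P_def using M by (intro continuous_on_closest_point) auto
  define cut where "cut x = max 0 (min 1 (M + 1 - norm x))" for x :: 'a
  have cut: "0 \<le> cut x" "cut x \<le> 1" "norm x > M + 1 \<Longrightarrow> cut x = 0" "norm x \<le> M \<Longrightarrow> cut x = 1" for x
    by (auto simp: cut_def)
  define g where "g n x = cut x *\<^sub>R P (G n x)" for n x
  have g_cont: "continuous_on UNIV (g n)" for n
    unfolding g_def cut_def
    by (intro continuous_intros continuous_on_compose2[OF P_cont[of UNIV] G(1)[of n]]) auto
  then have [measurable]: "g n \<in> borel_measurable borel" for n
    by (rule borel_measurable_continuous_onI)
  have g_supp: "g n x = 0" if "norm x > M + 1" for n x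
    using that cut(3) by (simp add: g_def)
  have g_norm: "norm (g n x) \<le> M * indicator (cball 0 (M + 1)) x" for n x
  proof (cases "norm x \<le> M + 1")
    case True
    have "cut x * norm (P (G n x)) \<le> 1 * M"
      using cut P_norm M by (intro mult_mono) auto
    then show ?thesis using True cut(1)[of x] by (simp add: g_def)
  qed (use g_supp[of x n] in simp)
  have f_norm: "norm (f x) \<le> M * indicator (cball 0 (M + 1)) x" for x
    using bnd[of x] supp[of x] by (cases "norm x \<le> M + 1") auto
  have int_w: "integrable lborel (\<lambda>x. c * indicator (cball 0 (M + 1)) x :: real)" for c
    by (intro integrable_mult_right integrable_real_indicator) (auto intro: emeasure_bounded_finite[unfolded infinity_ennreal_def])
  have "(\<lambda>n. LINT x|lborel. (norm (f x - g n x))\<^sup>2) \<longlonglongrightarrow> (LINT x|(lborel::'a measure). 0)"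
  proof (rule integral_dominated_convergence[where w = "\<lambda>x. (2 * M)\<^sup>2 * indicator (cball 0 (M + 1)) x"])
    show "AE x in lborel. (\<lambda>n. (norm (f x - g n x))\<^sup>2) \<longlonglongrightarrow> 0"
    proof -
      have "AE x in lebesgue. x \<notin> N"
        using N by (intro AE_not_in) (simp add: negligible_iff_null_sets)
      then have "AE x in lborel. x \<notin> N"
        by (simp add: AE_completion_iff)
      then show ?thesis
      proof eventually_elim
        case (elim x)
        have "(\<lambda>n. P (G n x)) \<longlonglongrightarrow> P (f x)"
          by (rule continuous_on_tendsto_compose[OF P_cont[of UNIV] G(2)[OF elim]]) auto
        then have "(\<lambda>n. g n x) \<longlonglongrightarrow> cut x *\<^sub>R f x"
          using P_self[OF bnd[of x]] unfolding g_def by (intro tendsto_intros) simp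
        also have "cut x *\<^sub>R f x = f x"
          using cut(4)[of x] supp[of x] by (cases "norm x \<le> M") auto
        finally have "(\<lambda>n. (norm (f x - g n x))\<^sup>2) \<longlonglongrightarrow> (norm (f x - f x))\<^sup>2"
          by (intro tendsto_intros)
        then show ?case by simp
      qed
    qed
    show "AE x in lborel. norm ((norm (f x - g n x))\<^sup>2) \<le> (2 * M)\<^sup>2 * indicator (cball 0 (M + 1)) x" for n
    proof (rule AE_I2)
      fix x
      have "norm (f x - g n x) \<le> 2 * M * indicator (cball 0 (M + 1)) x"
        using norm_triangle_ineq4[of "f x" "g n x"] f_norm[of x] g_norm[of n x] by linarith
      then have "(norm (f x - g n x))\<^sup>2 \<le> (2 * M * indicator (cball 0 (M + 1)) x)\<^sup>2"
        by (intro power_mono) auto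
      then show "norm ((norm (f x - g n x))\<^sup>2) \<le> (2 * M)\<^sup>2 * indicator (cball 0 (M + 1)) x"
        by (auto simp: indicator_def split: if_splits)
    qed
  qed (use int_w in \<open>auto simp: power_mult_distrib\<close>)
  then have "\<forall>\<^sub>F n in sequentially. (LINT x|lborel. (norm (f x - g n x))\<^sup>2) < e"
    using \<open>e > 0\<close> by (intro order_tendstoD(2)) simp_all
  then obtain n where n: "(LINT x|lborel. (norm (f x - g n x))\<^sup>2) < e"
    unfolding eventually_sequentially by blast
  have "square_integrable lborel (g n)"
    unfolding square_integrable_def
  proof
    show "integrable lborel (\<lambda>x. (norm (g n x))\<^sup>2)"
    proof (rule Bochner_Integration.integrable_bound[OF int_w[of "M\<^sup>2"]])
      show "AE x in lborel. norm ((norm (g n x))\<^sup>2) \<le> norm (M\<^sup>2 * indicator (cball 0 (M + 1)) x)"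
      proof (rule AE_I2)
        fix x
        have "(norm (g n x))\<^sup>2 \<le> (M * indicator (cball 0 (M + 1)) x)\<^sup>2"
          using g_norm[of n x] by (intro power_mono) auto
        then show "norm ((norm (g n x))\<^sup>2) \<le> norm (M\<^sup>2 * indicator (cball 0 (M + 1)) x)"
          by (auto simp: indicator_def split: if_splits)
      qed
    qed measurable
  qed measurable
  then show ?thesis
    by (intro that[of "g n"] g_cont g_supp n)
qed

lemma nn_square_integral_less:
  assumes "square_integrable M f" "(LINT x|M. (norm (f x))\<^sup>2) < e"
  shows "(\<integral>\<^sup>+x. ennreal ((norm (f x))\<^sup>2) \<partial>M) < ennreal e"
  unfolding nn_integral_eq_square_integral[OF assms(1)]
  using assms(2) by (intro ennreal_lessI) (auto intro: le_less_trans[OF _ assms(2)])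

lemma L2_approx_continuous:
  fixes f :: "'a::euclidean_space \<Rightarrow> 'b::euclidean_space"
  assumes f: "square_integrable lborel f" and "e > 0"
  obtains g R where "continuous_on UNIV g" "\<And>x. norm x > R \<Longrightarrow> g x = 0"
    "(\<integral>\<^sup>+x. ennreal ((norm (f x - g x))\<^sup>2) \<partial>lborel) < ennreal e"
proof -
  have [measurable]: "f \<in> borel_measurable borel"
    using square_integrable_measurable[OF f] by simp
  \<comment> \<open>Each of the two errors is doubled by |a + b|^2 <= 2 |a|^2 + 2 |b|^2, hence e /
    4.\<close>
  obtain M :: nat where M:
    "(LINT x|lborel. (norm (f x - (if norm (f x) \<le> M \<and> norm x \<le> M then f x else 0)))\<^sup>2) < e / 4"
    using L2_approx_bounded_support[OF f, of "e / 4"] \<open>e > 0\<close> by auto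
  define k where "k x = (if norm (f x) \<le> M \<and> norm x \<le> M then f x else 0)" for x
  have [measurable]: "k \<in> borel_measurable borel" unfolding k_def by measurable
  obtain g where g: "continuous_on UNIV g" "\<And>x. norm x > real M + 1 \<Longrightarrow> g x = 0"
    "square_integrable lborel g" "(LINT x|lborel. (norm (k x - g x))\<^sup>2) < e / 4"
    by (rule L2_approx_continuous_of_bounded[of k "real M" "e / 4"]) (use \<open>e > 0\<close> in \<open>auto simp: k_def\<close>)
  have k: "square_integrable lborel k"
    by (rule square_integrable_bound[OF f]) (auto simp: k_def)
  have fk: "square_integrable lborel (\<lambda>x. f x - k x)" and kg: "square_integrable lborel (\<lambda>x. k x - g x)"
    using f k g(3) by (auto intro: square_integrable_diff)
  have sum: "square_integrable lborel (\<lambda>x. f x - g x)"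
    using square_integrable_add[OF fk kg] by simp
  have "(LINT x|lborel. (norm (f x - g x))\<^sup>2)
      \<le> (LINT x|lborel. 2 * (norm (f x - k x))\<^sup>2 + 2 * (norm (k x - g x))\<^sup>2)"
  proof (rule integral_mono)
    show "(norm (f x - g x))\<^sup>2 \<le> 2 * (norm (f x - k x))\<^sup>2 + 2 * (norm (k x - g x))\<^sup>2" for x
      using norm_add_sq_le[of "f x - k x" "k x - g x"] by simp
  qed (use square_integrable_integrable[OF fk] square_integrable_integrable[OF kg]
      square_integrable_integrable[OF sum] in auto)
  also have "\<dots> = 2 * (LINT x|lborel. (norm (f x - k x))\<^sup>2) + 2 * (LINT x|lborel. (norm (k x - g x))\<^sup>2)"
    using square_integrable_integrable[OF fk] square_integrable_integrable[OF kg] by simp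
  also have "\<dots> < e"
    using M g(4) by (simp add: k_def)
  finally show ?thesis
    by (intro that[OF g(1,2)] nn_square_integral_less[OF sum])
qed

text \<open>With a continuous g of bounded support close to f, the difference f(x - z) - f(x)
  consists of f - g, its translate, and g(x - z) - g(x), which is uniformly small on a fixed ball.
  The budget is 4 * e/12 + 2 * e/6 + 4 * e/12 = e.\<close>

lemma L2_translation_continuous:
  fixes f :: "'a::euclidean_space \<Rightarrow> 'b::euclidean_space"
  assumes f: "square_integrable lborel f" and "e > 0"
  obtains d where "d > 0"
    "\<And>z. norm z < d \<Longrightarrow> (\<integral>\<^sup>+x. ennreal ((norm (f (x - z) - f x))\<^sup>2) \<partial>lborel) \<le> ennreal e"
proof -
  have [measurable]: "f \<in> borel_measurable borel"
    using square_integrable_measurable[OF f] by simp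
  obtain g R where g: "continuous_on UNIV g" "\<And>x. norm x > R \<Longrightarrow> g x = 0"
    "(\<integral>\<^sup>+x. ennreal ((norm (f x - g x))\<^sup>2) \<partial>lborel) < ennreal (e / 12)"
    by (rule L2_approx_continuous[OF f, of "e / 12"]) (use \<open>e > 0\<close> in auto)
  have [measurable]: "g \<in> borel_measurable borel"
    using g(1) by (rule borel_measurable_continuous_onI)
  define V where "V = measure lborel (cball (0::'a) (R + 1))"
  have V: "emeasure lborel (cball (0::'a) (R + 1)) = ennreal V"
    unfolding V_def by (rule emeasure_eq_ennreal_measure) (use emeasure_bounded_finite[of "cball (0::'a) (R + 1)"] in simp)
  \<comment> \<open>Chosen so that \<eta>^2 V <= e / 6. Outside the ball of volume V both g and its
    translate by any z with |z| < 1 vanish; V + 1 keeps the denominator positive.\<close>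
  define \<eta> where "\<eta> = sqrt (e / (6 * (V + 1)))"
  have V0: "V \<ge> 0" by (simp add: V_def)
  have \<eta>: "\<eta> > 0" "\<eta>\<^sup>2 * V \<le> e / 6"
  proof -
    show "\<eta> > 0" using \<open>e > 0\<close> V0 by (simp add: \<eta>_def)
    have "\<eta>\<^sup>2 * V \<le> \<eta>\<^sup>2 * (V + 1)" by (intro mult_left_mono) auto
    also have "\<dots> = e / 6"
      using \<open>e > 0\<close> V0 by (simp add: \<eta>_def field_simps)
    finally show "\<eta>\<^sup>2 * V \<le> e / 6" .
  qed
  obtain d where d: "d > 0" "\<And>x y. norm (x - y) < d \<Longrightarrow> norm (g x - g y) < \<eta>"
    by (rule compact_support_uniformly_continuous[OF g(1,2) \<eta>(1)]) blast+
  show ?thesis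
  proof (rule that[of "min d 1"])
    fix z :: 'a assume z: "norm z < min d 1"
    have "(\<integral>\<^sup>+x. ennreal ((norm (g (x - z) - g x))\<^sup>2) \<partial>lborel)
        \<le> (\<integral>\<^sup>+x. ennreal (\<eta>\<^sup>2) * indicator (cball (0::'a) (R + 1)) x \<partial>lborel)"
    proof (rule nn_integral_mono)
      fix x
      show "ennreal ((norm (g (x - z) - g x))\<^sup>2) \<le> ennreal (\<eta>\<^sup>2) * indicator (cball 0 (R + 1)) x"
      proof (cases "norm x \<le> R + 1")
        case True
        have "norm (g (x - z) - g x) < \<eta>" using z by (intro d(2)) simp
        then have "(norm (g (x - z) - g x))\<^sup>2 \<le> \<eta>\<^sup>2" by (intro power_mono) auto
        then show ?thesis using True by (simp add: ennreal_leI)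
      next
        case False
        then have "norm (x - z) > R" "norm x > R"
          using z norm_triangle_ineq2[of x z] by auto
        then show ?thesis using g(2) by simp
      qed
    qed
    also have "\<dots> = ennreal (\<eta>\<^sup>2 * V)"
      using V0 by (simp add: nn_integral_cmult_indicator V ennreal_mult)
    also have "\<dots> \<le> ennreal (e / 6)"
      using \<eta>(2) by (rule ennreal_leI)
    finally have 1: "(\<integral>\<^sup>+x. ennreal ((norm (g (x - z) - g x))\<^sup>2) \<partial>lborel) \<le> ennreal (e / 6)" .
    have 2: "(\<integral>\<^sup>+x. ennreal ((norm (f (x - z) - g (x - z)))\<^sup>2) \<partial>lborel) \<le> ennreal (e / 12)"
      using g(3) by (subst nn_integral_lborel_translate[of "\<lambda>x. ennreal ((norm (f x - g x))\<^sup>2)"]) auto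
    have "(\<integral>\<^sup>+x. ennreal ((norm (f (x - z) - f x))\<^sup>2) \<partial>lborel)
      \<le> (\<integral>\<^sup>+x. 4 * ennreal ((norm (f (x - z) - g (x - z)))\<^sup>2)
          + (2 * ennreal ((norm (g (x - z) - g x))\<^sup>2) + 4 * ennreal ((norm (f x - g x))\<^sup>2)) \<partial>lborel)"
    proof (rule nn_integral_mono)
      fix x
      have "(norm (f (x - z) - f x))\<^sup>2
          \<le> 2 * (norm ((f (x - z) - g (x - z)) - (f x - g x)))\<^sup>2 + 2 * (norm (g (x - z) - g x))\<^sup>2"
        using norm_add_sq_le[of "(f (x - z) - g (x - z)) - (f x - g x)" "g (x - z) - g x"] by simp
      also have "(norm ((f (x - z) - g (x - z)) - (f x - g x)))\<^sup>2
          \<le> 2 * (norm (f (x - z) - g (x - z)))\<^sup>2 + 2 * (norm (f x - g x))\<^sup>2"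
        by (rule norm_diff_sq_le)
      finally have "(norm (f (x - z) - f x))\<^sup>2 \<le> 4 * (norm (f (x - z) - g (x - z)))\<^sup>2
          + (2 * (norm (g (x - z) - g x))\<^sup>2 + 4 * (norm (f x - g x))\<^sup>2)" by simp
      from ennreal_leI[OF this]
      show "ennreal ((norm (f (x - z) - f x))\<^sup>2) \<le> 4 * ennreal ((norm (f (x - z) - g (x - z)))\<^sup>2)
          + (2 * ennreal ((norm (g (x - z) - g x))\<^sup>2) + 4 * ennreal ((norm (f x - g x))\<^sup>2))"
        by (simp add: ennreal_plus ennreal_mult)
    qed
    also have "\<dots> = 4 * (\<integral>\<^sup>+x. ennreal ((norm (f (x - z) - g (x - z)))\<^sup>2) \<partial>lborel)
        + (2 * (\<integral>\<^sup>+x. ennreal ((norm (g (x - z) - g x))\<^sup>2) \<partial>lborel)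
          + 4 * (\<integral>\<^sup>+x. ennreal ((norm (f x - g x))\<^sup>2) \<partial>lborel))"
      by (simp add: nn_integral_add nn_integral_cmult)
    also have "\<dots> \<le> 4 * ennreal (e / 12) + (2 * ennreal (e / 6) + 4 * ennreal (e / 12))"
      using 1 2 less_imp_le[OF g(3)] by (intro add_mono mult_left_mono) auto
    also have "\<dots> = ennreal e"
    proof -
      have "4 * ennreal (e / 12) + (2 * ennreal (e / 6) + 4 * ennreal (e / 12))
          = ennreal (4 * (e / 12) + (2 * (e / 6) + 4 * (e / 12)))"
        using \<open>e > 0\<close> by (simp only: ennreal_plus ennreal_mult ennreal_numeral divide_nonneg_pos
            mult_nonneg_nonneg add_nonneg_nonneg less_imp_le zero_less_numeral zero_le_numeral)
      then show ?thesis by simp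
    qed
    finally show "(\<integral>\<^sup>+x. ennreal ((norm (f (x - z) - f x))\<^sup>2) \<partial>lborel) \<le> ennreal e" .
  qed (use d in auto)
qed

section \<open>Classical gradients, mollifiers and derivatives of convolutions\<close>

lemma has_derivative_grad:
  fixes f :: "'a::euclidean_space \<Rightarrow> real"
  assumes "f differentiable (at x)"
  shows "(f has_derivative (\<lambda>k. grad f x \<bullet> k)) (at x)"
proof -
  have D: "(f has_derivative frechet_derivative f (at x)) (at x)"
    using assms by (simp add: frechet_derivative_works)
  then interpret bounded_linear "frechet_derivative f (at x)"
    by (rule has_derivative_bounded_linear)
  have "frechet_derivative f (at x) k = grad f x \<bullet> k" for k
  proof -
    have "frechet_derivative f (at x) k = frechet_derivative f (at x) (\<Sum>i\<in>Basis. (k \<bullet> i) *\<^sub>R i)"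
      by (simp add: euclidean_representation)
    also have "\<dots> = grad f x \<bullet> k"
      using assms by (simp add: grad_def sum scale inner_sum_right inner_commute[of _ k] mult.commute)
    finally show ?thesis .
  qed
  then have "frechet_derivative f (at x) = (\<bullet>) (grad f x)" by (rule ext)
  with D show ?thesis by simp
qed

lemma grad_eqI:
  fixes f :: "'a::euclidean_space \<Rightarrow> real"
  assumes "(f has_derivative (\<lambda>k. D \<bullet> k)) (at x)"
  shows "grad f x = D"
proof -
  have "f differentiable (at x)" using assms by (auto simp: differentiable_def)
  then show ?thesis
    by (simp add: grad_def frechet_derivative_at[OF assms, symmetric] euclidean_representation)
qed

text \<open>For e > 0 a smooth probability density supported in the closed ball of radius e. Each
  radius has its own normalising constant; it is not the rescaling of one fixed profile.\<close>

definition mollifier :: "real \<Rightarrow> 'a::euclidean_space \<Rightarrow> real" where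
  "mollifier e z = inverse (LINT y|lborel. bump 1 e (y::'a)) * bump 1 e z"

lemma bump_measurable [measurable]: "bump s r \<in> borel_measurable borel"
  using Ck_bump[of 0 s r] by (intro borel_measurable_continuous_onI) simp

lemma bump_eq_0: "s > 0 \<Longrightarrow> r \<ge> 0 \<Longrightarrow> norm x \<ge> r \<Longrightarrow> bump s r x = 0"
  using bump_pos_iff[of s r x] bump_nonneg[of s r x] by simp

lemma integrable_bump:
  assumes "e > 0"
  shows "integrable lborel (bump 1 e :: 'a::euclidean_space \<Rightarrow> real)"
proof (rule Bochner_Integration.integrable_bound)
  show "integrable lborel (\<lambda>x. indicator (cball 0 e) x :: real)"
    by (intro integrable_real_indicator) (auto intro: emeasure_bounded_finite[unfolded infinity_ennreal_def])
  show "AE x::'a in lborel. norm (bump 1 e x) \<le> norm (indicator (cball 0 e) x :: real)"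
  proof (rule AE_I2)
    fix x :: 'a
    show "norm (bump 1 e x) \<le> norm (indicator (cball 0 e) x :: real)"
      using bump_eq_0[of 1 e x] bump_nonneg[of 1 e x] bump_le_1[of 1 e x] assms
      by (cases "norm x \<le> e") auto
  qed
qed measurable

text \<open>A vanishing integral would make the nonnegative bump 0 almost everywhere, but it is
  positive on a ball, which is not negligible.\<close>

lemma integral_bump_pos:
  assumes "e > 0"
  shows "(LINT y|lborel. bump 1 e (y::'a::euclidean_space)) > 0"
proof -
  have "(LINT y|lborel. bump 1 e (y::'a)) \<noteq> 0"
  proof
    assume "(LINT y|lborel. bump 1 e (y::'a)) = 0"
    then have "AE y in lborel. bump 1 e (y::'a) = 0"
      using integral_nonneg_eq_0_iff_AE[OF integrable_bump[OF assms, where 'a='a]] by (simp add: bump_nonneg)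
    then have "AE y in lborel. y \<notin> ball (0::'a) e"
      by eventually_elim (use bump_pos_iff[of 1 e] assms in \<open>auto simp: less_le\<close>)
    moreover have "{y \<in> space lborel. \<not> y \<notin> ball (0::'a) e} = ball 0 e" by auto
    ultimately have "emeasure lborel (ball (0::'a) e) = 0"
      by (subst (asm) AE_iff_measurable[of "ball 0 e"]) auto
    moreover have "\<not> negligible (ball (0::'a) e)"
      using assms by (intro open_not_negligible) auto
    ultimately show False
      by (auto simp: negligible_iff_null_sets null_sets_def)
  qed
  moreover have "(LINT y|lborel. bump 1 e (y::'a)) \<ge> 0"
    by (intro Bochner_Integration.integral_nonneg) (simp add: bump_nonneg)
  ultimately show ?thesis by linarith
qed

lemma mollifier_nonneg: "e > 0 \<Longrightarrow> mollifier e (z::'a::euclidean_space) \<ge> 0"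
  using integral_bump_pos[of e, where 'a='a]
  by (simp add: mollifier_def bump_nonneg)

lemma mollifier_eq_0: "e > 0 \<Longrightarrow> norm z \<ge> e \<Longrightarrow> mollifier e z = 0"
  by (simp add: mollifier_def bump_eq_0)

lemma Ck_mollifier: "Ck n (mollifier e)"
  unfolding mollifier_def[abs_def] by (intro Ck_mult Ck_const Ck_bump)

lemma mollifier_measurable [measurable]: "mollifier e \<in> borel_measurable borel"
  using Ck_mollifier[of 0 e] by (intro borel_measurable_continuous_onI) simp

lemma mollifier_bounded: "e > 0 \<Longrightarrow> \<exists>B. \<forall>z::'a::euclidean_space. \<bar>mollifier e z\<bar> \<le> B"
  using integral_bump_pos[of e, where 'a='a]
  by (intro exI[of _ "inverse (LINT y|lborel. bump 1 e (y::'a))"])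
    (auto simp: mollifier_def abs_mult bump_nonneg intro!: mult_left_le bump_le_1)

lemma nn_integral_mollifier:
  assumes "e > 0"
  shows "(\<integral>\<^sup>+z. ennreal (mollifier e (z::'a::euclidean_space)) \<partial>lborel) = 1"
proof -
  have "integrable lborel (mollifier e :: 'a \<Rightarrow> real)"
    unfolding mollifier_def[abs_def] by (intro integrable_mult_right integrable_bump assms)
  then have "(\<integral>\<^sup>+z. ennreal (mollifier e (z::'a)) \<partial>lborel) = ennreal (LINT z|lborel. mollifier e (z::'a))"
    by (intro nn_integral_eq_integral) (auto simp: mollifier_nonneg assms)
  also have "(LINT z|lborel. mollifier e (z::'a)) = 1"
    using integral_bump_pos[OF assms, where 'a='a] by (simp add: mollifier_def)
  finally show ?thesis by simp
qed

definition mollify :: "real \<Rightarrow> ('a::euclidean_space \<Rightarrow> 'b::euclidean_space) \<Rightarrow> 'a \<Rightarrow> 'b" where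
  "mollify e F x = (LINT y|lborel. mollifier e (x - y) *\<^sub>R F y)"

lemma integrable_mollify:
  fixes F :: "'a::euclidean_space \<Rightarrow> 'b::euclidean_space"
  assumes "integrable lborel F" "e > 0"
  shows "integrable lborel (\<lambda>y. mollifier e (x - y) *\<^sub>R F y)"
proof -
  obtain B where B: "\<And>z::'a. \<bar>mollifier e z\<bar> \<le> B"
    using mollifier_bounded[OF \<open>e > 0\<close>] by blast
  have [measurable]: "F \<in> borel_measurable borel"
    using borel_measurable_integrable[OF assms(1)] by simp
  show ?thesis
  proof (rule Bochner_Integration.integrable_bound[OF integrable_scaleR_right[OF assms(1), of B]])
    show "AE y in lborel. norm (mollifier e (x - y) *\<^sub>R F y) \<le> norm (B *\<^sub>R F y)"
      by (intro AE_I2) (auto intro!: mult_right_mono order_trans[OF B abs_ge_self])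
  qed measurable
qed

text \<open>As the kernel is a probability density, Cauchy-Schwarz bounds |mollify e F x - F x|^2 by
  the kernel average over z of |F(x - z) - F(x)|^2. After exchanging the integrals only |z| < e < d
  contributes, where continuity of translations gives \<delta>.\<close>

lemma mollify_L2_tendsto:
  fixes F :: "'a::euclidean_space \<Rightarrow> 'b::euclidean_space"
  assumes int: "integrable lborel F" and L2: "square_integrable lborel F" and "\<delta> > 0"
  obtains d where "d > 0" "\<And>e. 0 < e \<Longrightarrow> e < d \<Longrightarrow>
    (\<integral>\<^sup>+x. ennreal ((norm (mollify e F x - F x))\<^sup>2) \<partial>lborel) \<le> ennreal \<delta>"
proof -
  have [measurable]: "F \<in> borel_measurable borel"
    using borel_measurable_integrable[OF int] by simp
  obtain d where d: "d > 0"
    "\<And>z. norm z < d \<Longrightarrow> (\<integral>\<^sup>+x. ennreal ((norm (F (x - z) - F x))\<^sup>2) \<partial>lborel) \<le> ennreal \<delta>"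
    by (rule L2_translation_continuous[OF L2 \<open>\<delta> > 0\<close>]) blast
  show ?thesis
  proof (rule that[OF d(1)])
    fix e :: real assume e: "0 < e" "e < d"
    have int_m: "integrable lborel (\<lambda>y. mollifier e (x - y))" for x :: 'a
    proof (rule integrableI_bounded)
      have "(\<integral>\<^sup>+y. ennreal (norm (mollifier e (x - y))) \<partial>lborel) = (\<integral>\<^sup>+y. ennreal (mollifier e (x - y)) \<partial>lborel)"
        by (simp add: mollifier_nonneg[OF e(1)])
      also have "\<dots> = 1"
        by (subst nn_integral_lborel_reflect[of "\<lambda>y. ennreal (mollifier e y)"])
          (simp_all add: nn_integral_mollifier e(1))
      finally show "(\<integral>\<^sup>+y. ennreal (norm (mollifier e (x - y))) \<partial>lborel) < \<infinity>" by simp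
    qed measurable
    have int_1: "(LINT y|lborel. mollifier e (x - y)) = 1" for x :: 'a
    proof -
      have "ennreal (LINT y|lborel. mollifier e (x - y)) = (\<integral>\<^sup>+y. ennreal (mollifier e (x - y)) \<partial>lborel)"
        by (rule nn_integral_eq_integral[OF int_m, symmetric]) (simp add: mollifier_nonneg e(1))
      also have "\<dots> = 1"
        by (subst nn_integral_lborel_reflect[of "\<lambda>y. ennreal (mollifier e y)"])
          (simp_all add: nn_integral_mollifier e(1))
      finally show ?thesis by (simp add: ennreal_eq_1)
    qed
    have pointwise: "ennreal ((norm (mollify e F x - F x))\<^sup>2)
        \<le> (\<integral>\<^sup>+z. ennreal (mollifier e z) * ennreal ((norm (F (x - z) - F x))\<^sup>2) \<partial>lborel)" for x
    proof -
      have i: "integrable lborel (\<lambda>y. mollifier e (x - y) *\<^sub>R (F y - F x))"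
        using integrable_mollify[OF int e(1)] int_m by (auto simp: scaleR_diff_right)
      have "mollify e F x - F x = (LINT y|lborel. mollifier e (x - y) *\<^sub>R (F y - F x))"
        using integrable_mollify[OF int e(1), of x] int_m[of x] int_1[of x]
        by (simp add: mollify_def scaleR_diff_right)
      then have "ennreal (norm (mollify e F x - F x))
          \<le> (\<integral>\<^sup>+y. ennreal (norm (mollifier e (x - y) *\<^sub>R (F y - F x))) \<partial>lborel)"
        using integral_norm_bound_ennreal[OF i] by simp
      also have "\<dots> = (\<integral>\<^sup>+z. ennreal (norm (mollifier e z *\<^sub>R (F (x - z) - F x))) \<partial>lborel)"
        using nn_integral_lborel_reflect[of "\<lambda>z. ennreal (norm (mollifier e z *\<^sub>R (F (x - z) - F x)))" x]
        by simp
      \<comment> \<open>The kernel is split into two square roots so that the first factor in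
        Cauchy-Schwarz integrates to 1.\<close>
      also have "\<dots> = (\<integral>\<^sup>+z. ennreal (sqrt (mollifier e z))
          * (ennreal (sqrt (mollifier e z)) * ennreal (norm (F (x - z) - F x))) \<partial>lborel)"
      proof (rule nn_integral_cong)
        fix z :: 'a
        have "norm (mollifier e z *\<^sub>R (F (x - z) - F x))
            = sqrt (mollifier e z) * (sqrt (mollifier e z) * norm (F (x - z) - F x))"
          using mollifier_nonneg[OF e(1), of z] by (simp add: mult.assoc[symmetric])
        then show "ennreal (norm (mollifier e z *\<^sub>R (F (x - z) - F x)))
          = ennreal (sqrt (mollifier e z)) * (ennreal (sqrt (mollifier e z)) * ennreal (norm (F (x - z) - F x)))"
          by (simp only: ennreal_mult' real_sqrt_ge_zero mollifier_nonneg[OF e(1)])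
      qed
      finally have "(ennreal (norm (mollify e F x - F x)))\<^sup>2 \<le> (\<integral>\<^sup>+z. ennreal (sqrt (mollifier e z))
          * (ennreal (sqrt (mollifier e z)) * ennreal (norm (F (x - z) - F x))) \<partial>lborel)\<^sup>2"
        by (rule power_mono) simp
      also have "\<dots> \<le> (\<integral>\<^sup>+z. (ennreal (sqrt (mollifier e (z::'a))))\<^sup>2 \<partial>lborel)
          * (\<integral>\<^sup>+z. (ennreal (sqrt (mollifier e z)) * ennreal (norm (F (x - z) - F x)))\<^sup>2 \<partial>lborel)"
        by (rule Cauchy_Schwarz_nn_integral) measurable
      also have "(\<integral>\<^sup>+z. (ennreal (sqrt (mollifier e (z::'a))))\<^sup>2 \<partial>lborel) = 1"
        using nn_integral_mollifier[OF e(1), where 'a='a] by (simp add: ennreal_power mollifier_nonneg e(1))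
      also have "(\<integral>\<^sup>+z. (ennreal (sqrt (mollifier e z)) * ennreal (norm (F (x - z) - F x)))\<^sup>2 \<partial>lborel)
          = (\<integral>\<^sup>+z. ennreal (mollifier e z) * ennreal ((norm (F (x - z) - F x))\<^sup>2) \<partial>lborel)"
        by (simp add: power_mult_distrib ennreal_power mollifier_nonneg e(1))
      finally show ?thesis by (simp add: ennreal_power)
    qed
    have "(\<integral>\<^sup>+x. ennreal ((norm (mollify e F x - F x))\<^sup>2) \<partial>lborel)
        \<le> (\<integral>\<^sup>+x. (\<integral>\<^sup>+z. ennreal (mollifier e z) * ennreal ((norm (F (x - z) - F x))\<^sup>2) \<partial>lborel) \<partial>lborel)"
      by (intro nn_integral_mono pointwise)
    also have "\<dots> = (\<integral>\<^sup>+z. (\<integral>\<^sup>+x. ennreal (mollifier e z) * ennreal ((norm (F (x - z) - F x))\<^sup>2) \<partial>lborel) \<partial>lborel)"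
      by (rule lborel_pair.Fubini') measurable
    also have "\<dots> \<le> (\<integral>\<^sup>+z. ennreal (mollifier e (z::'a)) * ennreal \<delta> \<partial>lborel)"
    proof (rule nn_integral_mono)
      fix z :: 'a
      show "(\<integral>\<^sup>+x. ennreal (mollifier e z) * ennreal ((norm (F (x - z) - F x))\<^sup>2) \<partial>lborel)
          \<le> ennreal (mollifier e z) * ennreal \<delta>"
      proof (cases "norm z < d")
        case True
        then show ?thesis
          by (subst nn_integral_cmult) (auto intro!: mult_left_mono d(2))
      qed (use mollifier_eq_0[of e z] e in simp)
    qed
    also have "\<dots> = ennreal \<delta>"
      by (simp add: nn_integral_multc nn_integral_mollifier e(1))
    finally show "(\<integral>\<^sup>+x. ennreal ((norm (mollify e F x - F x))\<^sup>2) \<partial>lborel) \<le> ennreal \<delta>" .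
  qed
qed

lemma continuous_grad_Ck:
  assumes "Ck (Suc 0) f"
  shows "continuous_on UNIV (grad f)"
proof -
  have eq: "grad f = (\<lambda>x. \<Sum>i\<in>Basis. frechet_derivative f (at x) i *\<^sub>R i)"
    using assms by (auto simp: grad_def fun_eq_iff)
  show ?thesis
    unfolding eq using assms by (intro continuous_intros) simp
qed

lemma grad_mollifier_eq_0:
  assumes "e > 0" "norm z > e"
  shows "grad (mollifier e) z = 0"
proof (rule grad_eqI)
  have "open {z::'a. norm z > e}"
    by (intro open_Collect_less continuous_intros)
  then have "(mollifier e has_derivative (\<lambda>x. 0)) (at z)"
    by (rule has_derivative_transform_within_open[OF has_derivative_const[of 0]])
      (use assms in \<open>auto simp: mollifier_eq_0\<close>)
  moreover have "(\<bullet>) (0::'a) = (\<lambda>x. 0)" by auto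
  ultimately show "(mollifier e has_derivative (\<bullet>) 0) (at z)" by simp
qed

text \<open>The gradient of the kernel is continuous with compact support, hence uniformly
  continuous, and the mean value theorem along the segment from z to z + k makes the first order
  remainder small uniformly in z. Uniformity is what allows integration against an arbitrary
  integrable function.\<close>

lemma mollifier_linearization:
  assumes e: "e > 0" and "\<epsilon> > 0"
  obtains d where "d > 0" "\<And>z k :: 'a::euclidean_space. norm k < d \<Longrightarrow>
    \<bar>mollifier e (z + k) - mollifier e z - grad (mollifier e) z \<bullet> k\<bar> \<le> \<epsilon> * norm k"
    "\<And>x y :: 'a. norm (x - y) < d \<Longrightarrow> norm (grad (mollifier e) x - grad (mollifier e) y) < \<epsilon>"
proof -
  obtain d where d: "d > 0"
    "\<And>x y::'a. norm (x - y) < d \<Longrightarrow> norm (grad (mollifier e) x - grad (mollifier e) y) < \<epsilon>"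
    by (rule compact_support_uniformly_continuous[OF continuous_grad_Ck[OF Ck_mollifier]
        grad_mollifier_eq_0[OF e] \<open>\<epsilon> > 0\<close>]) blast+
  have "\<bar>mollifier e (z + k) - mollifier e z - grad (mollifier e) z \<bullet> k\<bar> \<le> \<epsilon> * norm k"
    if k: "norm k < d" for z k :: 'a
  proof -
    \<comment> \<open>The linear part is subtracted, so that g 1 - g 0 is the remainder
      itself.\<close>
    define g where "g t = mollifier e (z + t *\<^sub>R k) - t * (grad (mollifier e) z \<bullet> k)" for t :: real
    have diff: "mollifier e differentiable (at y)" for y :: 'a
      using Ck_mollifier[of "Suc 0" e, where 'a='a] by simp
    have "((\<lambda>t. mollifier e (z + t *\<^sub>R k)) has_derivative (\<lambda>s. grad (mollifier e) (z + t *\<^sub>R k) \<bullet> (s *\<^sub>R k))) (at t)" for t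
      by (rule has_derivative_compose[OF _ has_derivative_grad[OF diff], of "\<lambda>t. z + t *\<^sub>R k"])
        (auto intro!: derivative_eq_intros)
    then have "(g has_derivative (\<lambda>s. grad (mollifier e) (z + t *\<^sub>R k) \<bullet> (s *\<^sub>R k)
        - s * (grad (mollifier e) z \<bullet> k))) (at t)" for t
      unfolding g_def by (intro has_derivative_diff has_derivative_mult_left has_derivative_ident)
    then have g': "(g has_derivative (\<lambda>s. grad (mollifier e) (z + t *\<^sub>R k) \<bullet> (s *\<^sub>R k)
        - s * (grad (mollifier e) z \<bullet> k))) (at t within S)" for t S
      by (rule has_derivative_at_withinI)
    obtain t where t: "0 < t" "t < 1"
      "g 1 - g 0 = (grad (mollifier e) (z + t *\<^sub>R k) - grad (mollifier e) z) \<bullet> k"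
      using mvt_simple[of 0 1 g, OF _ g'] by (auto simp: inner_diff_left)
    have "norm (t *\<^sub>R k) \<le> norm k" using t(1,2) by (simp add: mult_left_le_one_le)
    then have "norm (grad (mollifier e) (z + t *\<^sub>R k) - grad (mollifier e) z) < \<epsilon>"
      using k by (intro d(2)) simp
    then have "norm (grad (mollifier e) (z + t *\<^sub>R k) - grad (mollifier e) z) * norm k \<le> \<epsilon> * norm k"
      by (intro mult_right_mono) auto
    moreover have "\<bar>g 1 - g 0\<bar> \<le> norm (grad (mollifier e) (z + t *\<^sub>R k) - grad (mollifier e) z) * norm k"
      unfolding t(3) by (simp add: Cauchy_Schwarz_ineq2)
    ultimately show ?thesis by (simp add: g_def)
  qed
  then show ?thesis using that d by blast
qed

lemma grad_mollifier_bounded: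
  assumes "e > 0"
  obtains B where "\<And>z::'a::euclidean_space. norm (grad (mollifier e) z) \<le> B"
proof -
  have "compact (grad (mollifier e) ` cball (0::'a) e)"
    by (intro compact_continuous_image continuous_on_subset[OF continuous_grad_Ck[OF Ck_mollifier]]) auto
  then obtain B where B: "\<And>z::'a. norm z \<le> e \<Longrightarrow> norm (grad (mollifier e) z) \<le> B"
    using compact_imp_bounded by (force simp: bounded_iff)
  show ?thesis
  proof
    fix z :: 'a
    show "norm (grad (mollifier e) z) \<le> max B 0"
      using B[of z] grad_mollifier_eq_0[OF assms, of z] by (cases "norm z \<le> e") (auto simp: le_max_iff_disj)
  qed
qed

text \<open>Convolution with the gradient of the kernel: the derivative falls on the kernel, so
  integrability of f is enough for it to make sense.\<close>

definition mollify_grad :: "real \<Rightarrow> ('a::euclidean_space \<Rightarrow> real) \<Rightarrow> 'a \<Rightarrow> 'a" where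
  "mollify_grad e f x = (LINT y|lborel. f y *\<^sub>R grad (mollifier e) (x - y))"

lemma integrable_mollify_grad:
  assumes "integrable lborel f" "e > 0"
  shows "integrable lborel (\<lambda>y. f y *\<^sub>R grad (mollifier e) (x - y))"
proof -
  obtain B where B: "\<And>z::'a. norm (grad (mollifier e) z) \<le> B"
    using grad_mollifier_bounded[OF assms(2)] by blast
  have [measurable]: "f \<in> borel_measurable borel" "grad (mollifier e) \<in> borel_measurable (borel::'a measure)"
    using borel_measurable_integrable[OF assms(1)] continuous_grad_Ck[OF Ck_mollifier]
    by (auto intro: borel_measurable_continuous_onI)
  show ?thesis
  proof (rule Bochner_Integration.integrable_bound[OF integrable_mult_left[OF assms(1), of B]])
    show "AE y in lborel. norm (f y *\<^sub>R grad (mollifier e) (x - y)) \<le> norm (f y * B)"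
      by (intro AE_I2) (auto simp: abs_mult intro!: mult_left_mono order_trans[OF B abs_ge_self])
  qed measurable
qed

text \<open>The kernel remainder is at most \<epsilon>' |k| everywhere, so integrating it against f
  costs \<epsilon>' times the L^1 norm I of f. Dividing \<epsilon> by I + 1 covers I = 0.\<close>

lemma mollify_has_derivative:
  fixes f :: "'a::euclidean_space \<Rightarrow> real"
  assumes f: "integrable lborel f" and e: "e > 0"
  shows "(mollify e f has_derivative (\<lambda>k. mollify_grad e f x \<bullet> k)) (at x)"
  unfolding has_derivative_within_alt
proof (intro conjI allI impI)
  show "bounded_linear (\<lambda>k. mollify_grad e f x \<bullet> k)" by (rule bounded_linear_inner_right)
  fix \<epsilon> :: real assume "\<epsilon> > 0"
  define I where "I = (LINT y|lborel. \<bar>f y\<bar>)"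
  have I: "I \<ge> 0" by (simp add: I_def)
  define \<epsilon>' where "\<epsilon>' = \<epsilon> / (I + 1)"
  have \<epsilon>': "\<epsilon>' > 0" "\<epsilon>' * I \<le> \<epsilon>"
  proof -
    show "\<epsilon>' > 0" using \<open>\<epsilon> > 0\<close> I by (simp add: \<epsilon>'_def)
    then have "\<epsilon>' * I \<le> \<epsilon>' * (I + 1)" by (intro mult_left_mono) auto
    also have "\<dots> = \<epsilon>" using I by (simp add: \<epsilon>'_def)
    finally show "\<epsilon>' * I \<le> \<epsilon>" .
  qed
  obtain d where d: "d > 0" "\<And>z k :: 'a. norm k < d \<Longrightarrow>
    \<bar>mollifier e (z + k) - mollifier e z - grad (mollifier e) z \<bullet> k\<bar> \<le> \<epsilon>' * norm k"
    by (rule mollifier_linearization[OF e \<epsilon>'(1)]) blast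
  show "\<exists>d>0. \<forall>y\<in>UNIV. norm (y - x) < d \<longrightarrow>
      norm (mollify e f y - mollify e f x - mollify_grad e f x \<bullet> (y - x)) \<le> \<epsilon> * norm (y - x)"
  proof (intro exI[of _ d] conjI ballI impI)
    fix x' assume x': "norm (x' - x) < d"
    define k where "k = x' - x"
    define r where "r y = mollifier e (x' - y) - mollifier e (x - y) - grad (mollifier e) (x - y) \<bullet> k" for y
    have i1: "integrable lborel (\<lambda>y. mollifier e (x' - y) * f y)" "integrable lborel (\<lambda>y. mollifier e (x - y) * f y)"
      using integrable_mollify[OF f e] by simp_all
    have i2: "integrable lborel (\<lambda>y. (f y *\<^sub>R grad (mollifier e) (x - y)) \<bullet> k)"
      by (intro integrable_inner_left integrable_mollify_grad[OF f e])
    have split: "f y * r y = mollifier e (x' - y) * f y - mollifier e (x - y) * f y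
        - (f y *\<^sub>R grad (mollifier e) (x - y)) \<bullet> k" for y
      by (simp add: r_def algebra_simps)
    have i: "integrable lborel (\<lambda>y. f y * r y)"
      unfolding split using i1 i2 by (intro Bochner_Integration.integrable_diff)
    have "mollify e f x' - mollify e f x - mollify_grad e f x \<bullet> k = (LINT y|lborel. f y * r y)"
      unfolding split using i1 i2
      by (simp add: mollify_def mollify_grad_def integral_inner_left[symmetric]
          integrable_mollify_grad[OF f e] del: inner_scaleR_left integral_inner_left)
    also have "norm \<dots> \<le> (LINT y|lborel. \<bar>f y\<bar> * (\<epsilon>' * norm k))"
      unfolding real_norm_def
    proof (rule integral_abs_bound[THEN order_trans], rule integral_mono)
      fix y
      have "\<bar>r y\<bar> \<le> \<epsilon>' * norm k"
        using d(2)[of k "x - y"] x' by (simp add: r_def k_def algebra_simps)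
      then show "\<bar>f y * r y\<bar> \<le> \<bar>f y\<bar> * (\<epsilon>' * norm k)"
        by (simp add: abs_mult mult_left_mono)
    qed (use f i in auto)
    also have "\<dots> = (\<epsilon>' * I) * norm k" by (simp add: I_def)
    also have "\<dots> \<le> \<epsilon> * norm k" using \<epsilon>'(2) by (intro mult_right_mono) auto
    finally show "norm (mollify e f x' - mollify e f x - mollify_grad e f x \<bullet> (x' - x)) \<le> \<epsilon> * norm (x' - x)"
      by (simp add: k_def)
  qed (rule d(1))
qed

lemma continuous_mollify_grad:
  fixes f :: "'a::euclidean_space \<Rightarrow> real"
  assumes f: "integrable lborel f" and e: "e > 0"
  shows "continuous_on UNIV (mollify_grad e f)"
  unfolding continuous_on_iff
proof (intro ballI allI impI)
  fix x :: 'a and \<epsilon> :: real assume "\<epsilon> > 0"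
  define I where "I = (LINT y|lborel. \<bar>f y\<bar>)"
  have I: "I \<ge> 0" by (simp add: I_def)
  define \<epsilon>' where "\<epsilon>' = \<epsilon> / (I + 1)"
  have \<epsilon>': "\<epsilon>' > 0" "I * \<epsilon>' < \<epsilon>"
    using \<open>\<epsilon> > 0\<close> I by (simp_all add: \<epsilon>'_def field_simps)
  obtain d where d: "d > 0" "\<And>x y :: 'a. norm (x - y) < d \<Longrightarrow> norm (grad (mollifier e) x - grad (mollifier e) y) < \<epsilon>'"
    by (rule mollifier_linearization[OF e \<epsilon>'(1)]) blast
  have "dist (mollify_grad e f x') (mollify_grad e f x) < \<epsilon>" if x': "dist x' x < d" for x'
  proof -
    have i: "integrable lborel (\<lambda>y. f y *\<^sub>R grad (mollifier e) (x' - y) - f y *\<^sub>R grad (mollifier e) (x - y))"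
      by (intro Bochner_Integration.integrable_diff integrable_mollify_grad[OF f e])
    have "mollify_grad e f x' - mollify_grad e f x
        = (LINT y|lborel. f y *\<^sub>R grad (mollifier e) (x' - y) - f y *\<^sub>R grad (mollifier e) (x - y))"
      by (simp add: mollify_grad_def integrable_mollify_grad[OF f e])
    also have "norm \<dots> \<le> (LINT y|lborel. \<bar>f y\<bar> * \<epsilon>')"
    proof (rule integral_norm_bound[THEN order_trans], rule integral_mono)
      fix y
      have "norm (grad (mollifier e) (x' - y) - grad (mollifier e) (x - y)) \<le> \<epsilon>'"
        using d(2)[of "x' - y" "x - y"] x' by (simp add: dist_norm)
      then show "norm (f y *\<^sub>R grad (mollifier e) (x' - y) - f y *\<^sub>R grad (mollifier e) (x - y)) \<le> \<bar>f y\<bar> * \<epsilon>'"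
        by (simp add: scaleR_diff_right[symmetric] mult_left_mono)
    qed (use f i in auto)
    also have "\<dots> = I * \<epsilon>'" by (simp add: I_def)
    finally show ?thesis using \<epsilon>'(2) by (simp add: dist_norm)
  qed
  with d(1) show "\<exists>d>0. \<forall>x'\<in>UNIV. dist x' x < d \<longrightarrow> dist (mollify_grad e f x') (mollify_grad e f x) < \<epsilon>"
    by blast
qed

section \<open>Approximation by continuously differentiable functions\<close>

text \<open>The quotient is the usual smooth step, 0 for t <= 0 and 1 for t >= 1. For r > 0 the
  chosen t is at least 1 on the closed ball of radius r and at most 0 beyond radius 2 r. Unlike a
  bump, the cutoff is exactly 1 on a ball, which makes the partition of unity locally
  finite.\<close>

definition cutoff :: "'a::euclidean_space \<Rightarrow> real \<Rightarrow> 'a \<Rightarrow> real" where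
  "cutoff c r x = (let t = 2 - ((x - c) \<bullet> (x - c)) / r\<^sup>2
     in flat_exp 1 t * inverse (flat_exp 1 t + flat_exp 1 (1 - t)))"

lemma flat_exp_1_nonneg: "flat_exp 1 t \<ge> 0" and flat_exp_1_pos: "t > 0 \<Longrightarrow> flat_exp 1 t > 0"
  and flat_exp_1_eq_0: "t \<le> 0 \<Longrightarrow> flat_exp 1 t = 0"
  by (auto simp: flat_exp_def)

lemma flat_exp_1_sum_pos: "flat_exp 1 t + flat_exp 1 (1 - t) > 0"
proof (cases "t > 0")
  case True
  then show ?thesis using flat_exp_1_pos[of t] flat_exp_1_nonneg[of "1 - t"] by linarith
next
  case False
  then have "1 - t > 0" by simp
  then show ?thesis using flat_exp_1_pos[of "1 - t"] flat_exp_1_nonneg[of t] by linarith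
qed

lemma Ck_cutoff: "Ck n (cutoff c r)"
proof -
  have "Ck m (\<lambda>x. 2 - ((x - c) \<bullet> (x - c)) * inverse (r\<^sup>2))" for m
    using Ck_diff_const[OF Ck_inner_self, of m c] by (intro Ck_diff Ck_mult Ck_const)
  then have g: "Ck m (\<lambda>x. 2 - ((x - c) \<bullet> (x - c)) / r\<^sup>2)" for m
    by (simp add: divide_inverse)
  have g': "Ck m (\<lambda>x. 1 - (2 - ((x - c) \<bullet> (x - c)) / r\<^sup>2))" for m
    by (intro Ck_diff Ck_const g)
  show ?thesis
    unfolding cutoff_def[abs_def] Let_def
    by (intro Ck_mult Ck_inverse Ck_add Ck_flat_exp g g')
      (rule less_imp_neq[OF flat_exp_1_sum_pos, symmetric])
qed

lemma cutoff_eq: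
  "t = 2 - ((x - c) \<bullet> (x - c)) / r\<^sup>2 \<Longrightarrow>
    cutoff c r x = flat_exp 1 t / (flat_exp 1 t + flat_exp 1 (1 - t))"
  by (simp only: cutoff_def Let_def divide_inverse)

lemma cutoff_bounds: "0 \<le> cutoff c r x" "cutoff c r x \<le> 1"
  unfolding cutoff_eq[OF refl]
  using flat_exp_1_sum_pos[of "2 - ((x - c) \<bullet> (x - c)) / r\<^sup>2"]
    flat_exp_1_nonneg[of "2 - ((x - c) \<bullet> (x - c)) / r\<^sup>2"]
    flat_exp_1_nonneg[of "1 - (2 - ((x - c) \<bullet> (x - c)) / r\<^sup>2)"]
  by (auto intro!: divide_nonneg_pos simp only: divide_le_eq_1_pos le_add_same_cancel1)

lemma cutoff_eq_1:
  assumes "r > 0" "norm (x - c) \<le> r"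
  shows "cutoff c r x = 1"
proof -
  define t where "t = 2 - ((x - c) \<bullet> (x - c)) / r\<^sup>2"
  have "(norm (x - c))\<^sup>2 \<le> r\<^sup>2" using assms by (intro power_mono) auto
  then have "((x - c) \<bullet> (x - c)) / r\<^sup>2 \<le> 1"
    using assms by (simp add: power2_norm_eq_inner divide_le_eq)
  then have "t \<ge> 1" by (simp add: t_def)
  then show ?thesis
    using flat_exp_1_pos[of t] flat_exp_1_eq_0[of "1 - t"] by (simp add: cutoff_eq[OF t_def])
qed

lemma cutoff_eq_0:
  assumes "r > 0" "norm (x - c) \<ge> 2 * r"
  shows "cutoff c r x = 0"
proof -
  define t where "t = 2 - ((x - c) \<bullet> (x - c)) / r\<^sup>2"
  have "(2 * r)\<^sup>2 \<le> (norm (x - c))\<^sup>2" using assms by (intro power_mono) auto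
  then have "4 * r\<^sup>2 \<le> (x - c) \<bullet> (x - c)" by (simp add: power2_norm_eq_inner power_mult_distrib)
  then have "4 \<le> ((x - c) \<bullet> (x - c)) / r\<^sup>2"
    using assms(1) by (simp add: le_divide_eq)
  then have "t \<le> 0" by (simp add: t_def)
  then show ?thesis
    using flat_exp_1_eq_0[of t] by (simp add: cutoff_eq[OF t_def])
qed

text \<open>If \<open>b i = 1\<close> on the \<open>i\<close>-th set of a cover, the terms with index above \<open>i\<close> vanish there,
  so the family is locally finite without any exhaustion by compact sets.\<close>

definition unity_partition :: "(nat \<Rightarrow> 'a \<Rightarrow> real) \<Rightarrow> nat \<Rightarrow> 'a \<Rightarrow> real" where
  "unity_partition b j x = b j x * (\<Prod>i<j. 1 - b i x)"

text \<open>The products telescope. Where b i = 1, the product on the right contains a zero factor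
  as soon as n > i, so the partial sums equal 1 there.\<close>

lemma sum_unity_partition: "(\<Sum>j<n. unity_partition b j x) = 1 - (\<Prod>j<n. 1 - b j x)"
  by (induction n) (simp_all add: unity_partition_def algebra_simps)

lemma unity_partition_eq_0: "b i x = 1 \<Longrightarrow> i < j \<Longrightarrow> unity_partition b j x = 0"
  unfolding unity_partition_def by (auto intro!: prod_zero)

text \<open>The first term is peeled off with |a + b|^2 <= 2 |a|^2 + 2 |b|^2, repeatedly. The weight
  of the j-th term does not depend on n, so it can be absorbed into a tolerance chosen for that term
  in advance.\<close>

lemma norm_sum_sq_le: "(norm (\<Sum>j<n. a j))\<^sup>2 \<le> (\<Sum>j<n. 2 ^ Suc j * (norm (a j :: 'a::real_normed_vector))\<^sup>2)"
proof (induction n arbitrary: a)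
  case (Suc n)
  have "(norm (\<Sum>j<Suc n. a j))\<^sup>2 \<le> 2 * (norm (a 0))\<^sup>2 + 2 * (norm (\<Sum>j<n. a (Suc j)))\<^sup>2"
    unfolding sum.lessThan_Suc_shift by (rule norm_add_sq_le)
  also have "\<dots> \<le> 2 * (norm (a 0))\<^sup>2 + 2 * (\<Sum>j<n. 2 ^ Suc j * (norm (a (Suc j)))\<^sup>2)"
    using Suc.IH[of "\<lambda>j. a (Suc j)"] by simp
  also have "\<dots> = (\<Sum>j<Suc n. 2 ^ Suc j * (norm (a j))\<^sup>2)"
    unfolding sum.lessThan_Suc_shift by (simp add: sum_distrib_left mult.assoc)
  finally show ?case .
qed simp

lemma mollifier_minus: "mollifier e (x - y) = mollifier e (y - x)"
  by (simp add: mollifier_def bump_def dot_square_norm norm_minus_commute)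

lemma mollifier_test_function:
  assumes "e > 0" "cball x e \<subseteq> \<Omega>"
  shows "test_function \<Omega> (\<lambda>y. mollifier e (x - y))"
proof -
  have sub: "closure {y. mollifier e (x - y) \<noteq> 0} \<subseteq> cball x e"
  proof (rule closure_minimal)
    show "{y. mollifier e (x - y) \<noteq> 0} \<subseteq> cball x e"
    proof safe
      fix y assume "mollifier e (x - y) \<noteq> 0"
      then show "y \<in> cball x e"
        using mollifier_eq_0[OF assms(1), of "x - y"] by (force simp: dist_norm)
    qed
  qed simp
  have "compact (closure {y. mollifier e (x - y) \<noteq> 0})"
    using compact_Int_closed[OF compact_cball closed_closure] sub by (metis Int_absorb1)
  moreover have "Ck n (\<lambda>y. mollifier e (x - y))" for n
    unfolding mollifier_minus[of e x] by (intro Ck_diff_const Ck_mollifier)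
  ultimately show ?thesis
    using sub assms(2) by (auto simp: test_function_def)
qed

text \<open>The sign from the inner map y -> x - y later cancels the sign in the weak gradient
  identity.\<close>

lemma frechet_derivative_mollifier:
  "frechet_derivative (\<lambda>y. mollifier e (x - y)) (at y) i = - (grad (mollifier e) (x - y) \<bullet> i)"
proof -
  have "mollifier e differentiable (at z)" for z :: 'a
    using Ck_mollifier[of "Suc 0" e, where 'a='a] by simp
  from has_derivative_grad[OF this]
  have 1: "(mollifier e has_derivative (\<lambda>k. grad (mollifier e) (x - y) \<bullet> k)) (at (x - y))" .
  have 2: "((\<lambda>y. x - y) has_derivative (\<lambda>k. - k)) (at y)"
    by (auto intro!: derivative_eq_intros)
  have "((\<lambda>y. mollifier e (x - y)) has_derivative (\<lambda>k. grad (mollifier e) (x - y) \<bullet> (- k))) (at y)"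
    by (rule has_derivative_compose[OF 2 1])
  from frechet_derivative_at[OF this, symmetric] show ?thesis by simp
qed

text \<open>Convolutions are taken over \<open>lborel\<close>, so Borel representatives are
  required; the real-valued case is applied in each coordinate.\<close>

lemma lebesgue_measurable_ex_borel:
  fixes f :: "'a::euclidean_space \<Rightarrow> 'b::euclidean_space"
  assumes "f \<in> borel_measurable lebesgue"
  obtains g where "g \<in> borel_measurable borel" "AE x in lebesgue. f x = g x"
proof -
  have "\<forall>i. \<exists>g. g \<in> borel_measurable lborel \<and> (AE x in lborel. f x \<bullet> i = g x)"
  proof
    fix i
    have "(\<lambda>x. f x \<bullet> i) \<in> borel_measurable lebesgue"
      using assms by (intro borel_measurable_inner) auto
    from completion_ex_borel_measurable_real[OF this]
    show "\<exists>g. g \<in> borel_measurable lborel \<and> (AE x in lborel. f x \<bullet> i = g x)" by blast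
  qed
  from choice[OF this] obtain g where
    g: "\<And>i. g i \<in> borel_measurable lborel" "\<And>i. AE x in lborel. f x \<bullet> i = g i x"
    by blast
  show ?thesis
  proof (rule that[of "\<lambda>x. \<Sum>i\<in>Basis. g i x *\<^sub>R i"])
    show "(\<lambda>x. \<Sum>i\<in>Basis. g i x *\<^sub>R i) \<in> borel_measurable borel"
      using g(1) by (intro borel_measurable_sum borel_measurable_scaleR) auto
    have "AE x in lborel. \<forall>i\<in>Basis. f x \<bullet> i = g i x"
      by (subst AE_finite_all) (use g(2) in auto)
    then have "AE x in lborel. f x = (\<Sum>i\<in>Basis. g i x *\<^sub>R i)"
    proof eventually_elim
      case (elim x)
      then have "(\<Sum>i\<in>Basis. g i x *\<^sub>R i) = (\<Sum>i\<in>Basis. (f x \<bullet> i) *\<^sub>R i)"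
        by (intro sum.cong) auto
      then show ?case by (simp add: euclidean_representation)
    qed
    then show "AE x in lebesgue. f x = (\<Sum>i\<in>Basis. g i x *\<^sub>R i)"
      by (rule AE_completion)
  qed
qed

lemma (in finite_measure) square_integrable_imp_integrable_vec:
  "square_integrable M f \<Longrightarrow> integrable M f"
proof -
  assume f: "square_integrable M f"
  show ?thesis
  proof (rule Bochner_Integration.integrable_bound)
    show "integrable M (\<lambda>x. 1 + (norm (f x))\<^sup>2)"
      using square_integrable_integrable[OF f] by simp
    have "norm y \<le> 1 + (norm y)\<^sup>2" for y :: 'b
      using sum_squares_bound[of "norm y" 1] by (simp add: power2_eq_square) (smt (verit) norm_ge_zero)
    then show "AE x in M. norm (f x) \<le> norm (1 + (norm (f x))\<^sup>2)"
      by (intro AE_I2) (simp add: abs_of_nonneg)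
  qed (rule square_integrable_measurable[OF f])
qed

lemma integrable_lborel_indicator:
  fixes f :: "'a::euclidean_space \<Rightarrow> 'b::{banach, second_countable_topology}"
  assumes "set_integrable lebesgue K f" "f \<in> borel_measurable borel" "K \<in> sets borel"
  shows "integrable lborel (\<lambda>x. indicator K x *\<^sub>R f x)"
  using assms by (subst integrable_completion[symmetric]) (auto simp: set_integrable_def)

section \<open>Mollifying a Sobolev function on one ball\<close>

context continuous_pdf
begin

text \<open>As the ball of radius e about x lies in K, the kernel centred at x is a test function on
  the support, and testing with it moves the derivative from the kernel to v. The kernel vanishes
  off K, so the indicators have no effect.\<close>

lemma mollify_grad_eq_mollify:
  assumes wg: "has_weak_gradient (pdf_dom p) v G"
    and borel: "v \<in> borel_measurable borel" "G \<in> borel_measurable borel"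
    and int: "integrable lborel (\<lambda>x. indicator K x *\<^sub>R v x)" "integrable lborel (\<lambda>x. indicator K x *\<^sub>R G x)"
    and K: "compact K" "K \<subseteq> pdf_dom p" and e: "e > 0" "cball x e \<subseteq> K"
  shows "mollify_grad e (\<lambda>x. indicator K x *\<^sub>R v x) x = mollify e (\<lambda>x. indicator K x *\<^sub>R G x) x"
proof (rule euclidean_eqI)
  fix i :: 'a assume i: "i \<in> Basis"
  have Ks: "K \<in> sets borel" using K(1) by (simp add: borel_closed compact_imp_closed)
  have gm: "grad (mollifier e) \<in> borel_measurable (borel::'a measure)"
    by (intro borel_measurable_continuous_onI continuous_grad_Ck Ck_mollifier)
  have [measurable]: "(\<lambda>y. grad (mollifier e) (x - y)) \<in> borel_measurable borel"
    by (rule measurable_compose[OF _ gm]) measurable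
  have out: "mollifier e (x - y) = 0" "grad (mollifier e) (x - y) = 0" if "y \<notin> K" for y
  proof -
    have "y \<notin> cball x e" using that e(2) by blast
    then have "norm (x - y) > e" by (simp add: dist_norm)
    then show "mollifier e (x - y) = 0" "grad (mollifier e) (x - y) = 0"
      using mollifier_eq_0[OF e(1), of "x - y"] grad_mollifier_eq_0[OF e(1), of "x - y"] by simp_all
  qed
  have "mollify_grad e (\<lambda>x. indicator K x *\<^sub>R v x) x \<bullet> i
      = (LINT y|lborel. ((indicator K y *\<^sub>R v y) *\<^sub>R grad (mollifier e) (x - y)) \<bullet> i)"
    unfolding mollify_grad_def
    by (rule integral_inner_left[symmetric]) (intro integrable_mollify_grad[OF int(1) e(1)])
  also have "\<dots> = (LINT y|lborel. indicator K y *\<^sub>R (v y * (grad (mollifier e) (x - y) \<bullet> i)))"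
    by (intro Bochner_Integration.integral_cong) (auto simp: indicator_def)
  also have "\<dots> = (LINT y|lebesgue. indicator K y *\<^sub>R (v y * (grad (mollifier e) (x - y) \<bullet> i)))"
    using borel Ks by (intro integral_completion[symmetric]) auto
  also have "\<dots> = - (LINT y:pdf_dom p|lebesgue. v y * frechet_derivative (\<lambda>y. mollifier e (x - y)) (at y) i)"
    unfolding set_lebesgue_integral_def frechet_derivative_mollifier
    by (subst Bochner_Integration.integral_minus[symmetric], intro Bochner_Integration.integral_cong)
      (use out K(2) in \<open>auto simp: indicator_def\<close>)
  also have "\<dots> = (LINT y:pdf_dom p|lebesgue. (G y \<bullet> i) * mollifier e (x - y))"
  proof -
    have "test_function (pdf_dom p) (\<lambda>y. mollifier e (x - y))"
      using e K by (intro mollifier_test_function) auto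
    then show ?thesis using wg i by (simp add: has_weak_gradient_def)
  qed
  also have "\<dots> = (LINT y|lebesgue. (mollifier e (x - y) *\<^sub>R indicator K y *\<^sub>R G y) \<bullet> i)"
    unfolding set_lebesgue_integral_def
    by (intro Bochner_Integration.integral_cong) (use out K(2) in \<open>auto simp: indicator_def\<close>)
  also have "\<dots> = (LINT y|lborel. (mollifier e (x - y) *\<^sub>R indicator K y *\<^sub>R G y) \<bullet> i)"
    using borel Ks by (intro integral_completion) auto
  also have "\<dots> = mollify e (\<lambda>x. indicator K x *\<^sub>R G x) x \<bullet> i"
    unfolding mollify_def by (rule integral_inner_left) (intro integrable_mollify[OF int(2) e(1)])
  finally show "mollify_grad e (\<lambda>x. indicator K x *\<^sub>R v x) x \<bullet> i
      = mollify e (\<lambda>x. indicator K x *\<^sub>R G x) x \<bullet> i" .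
qed

text \<open>The constant sequence v, G converges in L^1(\<mu>) to any representatives that agree
  with v, G almost everywhere, so \<open>has_weak_gradient_limit\<close> transfers the weak gradient
  to Borel ones.\<close>

lemma borel_version:
  assumes wg: "has_weak_gradient (pdf_dom p) v G"
    and L2: "square_integrable \<mu> v" "square_integrable \<mu> G"
  obtains v' G' where "v' \<in> borel_measurable borel" "G' \<in> borel_measurable borel"
    "AE x in \<mu>. v' x = v x \<and> G' x = G x" "has_weak_gradient (pdf_dom p) v' G'"
    "square_integrable \<mu> v'" "square_integrable \<mu> G'"
proof -
  have ex: "\<exists>f'\<in>borel_measurable borel. AE x in \<mu>. f' x = f x" if "square_integrable \<mu> f"
    for f :: "'a \<Rightarrow> 'c::euclidean_space"
  proof -
    have "(\<lambda>x. indicator (pdf_dom p) x *\<^sub>R f x) \<in> borel_measurable lebesgue"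
      using square_integrable_measurable[OF that]
      by (simp add: borel_measurable_\<mu>_iff set_borel_measurable_def)
    then obtain f' where f': "f' \<in> borel_measurable borel"
        "AE x in lebesgue. indicator (pdf_dom p) x *\<^sub>R f x = f' x"
      by (rule lebesgue_measurable_ex_borel)
    have "AE x in \<mu>. f' x = f x"
      unfolding AE_\<mu>_iff using f'(2) by eventually_elim auto
    with f'(1) show ?thesis by blast
  qed
  obtain v' where v': "v' \<in> borel_measurable borel" "AE x in \<mu>. v' x = v x"
    using ex[OF L2(1)] by blast
  obtain G' where G': "G' \<in> borel_measurable borel" "AE x in \<mu>. G' x = G x"
    using ex[OF L2(2)] by blast
  have meas: "f \<in> borel_measurable \<mu>" if "f \<in> borel_measurable borel" for f :: "'a \<Rightarrow> 'c::euclidean_space"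
    unfolding borel_measurable_\<mu>
    by (intro measurable_restrict_space1 measurable_completion) (use that in simp)
  have sv': "square_integrable \<mu> v'"
    by (rule square_integrable_bound[OF L2(1) meas[OF v'(1)]]) (use v'(2) in eventually_elim, simp)
  have sG': "square_integrable \<mu> G'"
    by (rule square_integrable_bound[OF L2(2) meas[OF G'(1)]]) (use G'(2) in eventually_elim, simp)
  have [measurable]: "v \<in> borel_measurable \<mu>" "G \<in> borel_measurable \<mu>" "v' \<in> borel_measurable \<mu>" "G' \<in> borel_measurable \<mu>"
    using L2 sv' sG' by (auto intro: square_integrable_measurable)
  have "AE x in \<mu>. \<bar>v x - v' x\<bar> = 0"
    using v'(2) by eventually_elim simp
  then have zero_v: "(LINT x|\<mu>. \<bar>v x - v' x\<bar>) = 0"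
    by (rule integral_eq_zero_AE)
  have "AE x in \<mu>. norm (G x - G' x) = 0"
    using G'(2) by eventually_elim simp
  then have zero_G: "(LINT x|\<mu>. norm (G x - G' x)) = 0"
    by (rule integral_eq_zero_AE)
  note int = square_integrable_imp_integrable_vec[OF L2(1)] square_integrable_imp_integrable_vec[OF sv']
    square_integrable_imp_integrable_vec[OF L2(2)] square_integrable_imp_integrable_vec[OF sG']
  have "has_weak_gradient (pdf_dom p) v' G'"
    by (rule has_weak_gradient_limit[of "\<lambda>_. v" "\<lambda>_. G", OF wg int])
      (simp_all only: zero_v zero_G tendsto_const)
  moreover have "AE x in \<mu>. v' x = v x \<and> G' x = G x"
    using v'(2) G'(2) by eventually_elim simp
  ultimately show ?thesis
    by (intro that[OF v'(1) G'(1) _ _ sv' sG'])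
qed

lemma nn_integral_\<mu>_le_lborel:
  assumes f: "f \<in> borel_measurable borel" and S: "compact S" "S \<subseteq> pdf_dom p" and M: "\<And>x. x \<in> S \<Longrightarrow> p x \<le> M"
  shows "(\<integral>\<^sup>+x. f x * indicator S x \<partial>\<mu>) \<le> ennreal M * (\<integral>\<^sup>+x. f x \<partial>lborel)"
proof -
  have Ss: "S \<in> sets borel" using S(1) by (simp add: borel_closed compact_imp_closed)
  have fS: "(\<lambda>x. f x * indicator S x) \<in> borel_measurable \<mu>"
    unfolding borel_measurable_\<mu>
    by (intro measurable_restrict_space1 measurable_completion) (use f Ss in simp)
  have "(\<integral>\<^sup>+x. f x * indicator S x \<partial>\<mu>)
      = (\<integral>\<^sup>+x\<in>pdf_dom p. f x * indicator S x * ennreal (p x) \<partial>lebesgue)"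
    by (rule nn_integral_\<mu>[OF fS])
  also have "\<dots> \<le> (\<integral>\<^sup>+x. ennreal M * f x \<partial>lebesgue)"
  proof (rule nn_integral_mono)
    fix x
    show "f x * indicator S x * ennreal (p x) * indicator (pdf_dom p) x \<le> ennreal M * f x"
    proof (cases "x \<in> S")
      case True
      then have "ennreal (p x) \<le> ennreal M" using M by (intro ennreal_leI) auto
      then show ?thesis using True S(2) by (auto simp: indicator_def mult.commute[of "ennreal M"] intro!: mult_left_mono)
    qed simp
  qed
  also have "\<dots> = ennreal M * (\<integral>\<^sup>+x. f x \<partial>lborel)"
    using f by (subst nn_integral_completion) (simp add: nn_integral_cmult)
  finally show ?thesis .
qed

text \<open>The pair of v and G is cut off sharply to the ball of radius 3 r and mollified as one
  vector-valued function with e <= r. From the ball of radius 2 r the kernel does not reach beyond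
  the cut, so there the gradient of the mollified v is the mollified G. The tolerance \<delta> / M
  absorbs the upper bound M of p.\<close>

lemma local_C1_approx:
  assumes wg: "has_weak_gradient (pdf_dom p) v G"
    and L2: "square_integrable \<mu> v" "square_integrable \<mu> G"
    and r: "r > 0" "cball c (3 * r) \<subseteq> pdf_dom p" and \<delta>: "\<delta> > 0"
  obtains w where "Ck (Suc 0) w"
    "(\<integral>\<^sup>+x. ennreal ((norm ((w x, grad w x) - (v x, G x)))\<^sup>2) * indicator (cball c (2 * r)) x \<partial>\<mu>) \<le> ennreal \<delta>"
proof -
  obtain v' G' where b: "v' \<in> borel_measurable borel" "G' \<in> borel_measurable borel"
    "AE x in \<mu>. v' x = v x \<and> G' x = G x" "has_weak_gradient (pdf_dom p) v' G'"
    "square_integrable \<mu> v'" "square_integrable \<mu> G'"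
    by (rule borel_version[OF wg L2]) blast
  define K where "K = cball c (3 * r)"
  have K: "compact K" "K \<subseteq> pdf_dom p" "K \<in> sets borel" using r by (simp_all add: K_def)
  define F where "F x = (v' x, G' x)" for x
  have F: "F \<in> borel_measurable borel" "square_integrable \<mu> F"
    unfolding F_def using b by (auto intro: borel_measurable_Pair square_integrable_Pair)
  define FK where "FK x = indicator K x *\<^sub>R F x" for x
  have FK_int: "integrable lborel FK"
    unfolding FK_def using F K
    by (intro integrable_lborel_indicator set_integrable_compact square_integrable_imp_integrable_vec)
  have FK_L2: "square_integrable lborel FK"
    unfolding square_integrable_def
  proof
    show "FK \<in> borel_measurable lborel" using borel_measurable_integrable[OF FK_int] .
    have "integrable lborel (\<lambda>x. indicator K x *\<^sub>R (norm (F x))\<^sup>2)"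
      using F K by (intro integrable_lborel_indicator set_integrable_compact
          square_integrable_integrable) auto
    moreover have "(norm (FK x))\<^sup>2 = indicator K x *\<^sub>R (norm (F x))\<^sup>2" for x
      by (simp add: FK_def indicator_def)
    ultimately show "integrable lborel (\<lambda>x. (norm (FK x))\<^sup>2)" by simp
  qed
  define vK where "vK x = indicator K x *\<^sub>R v' x" for x
  define GK where "GK x = indicator K x *\<^sub>R G' x" for x
  have FK_eq: "FK x = (vK x, GK x)" for x
    by (simp add: FK_def F_def vK_def GK_def)
  have vK_int: "integrable lborel vK" and GK_int: "integrable lborel GK"
    using integrable_fst[OF FK_int] integrable_snd[OF FK_int] by (simp_all add: FK_eq)
  obtain c0 M where M: "c0 > 0" "M > 0" "\<And>x. x \<in> K \<Longrightarrow> c0 \<le> p x" "\<And>x. x \<in> K \<Longrightarrow> p x \<le> M"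
    by (rule p_bounds_compact[OF K(1,2)]) blast
  obtain d where d: "d > 0" "\<And>e. 0 < e \<Longrightarrow> e < d \<Longrightarrow>
    (\<integral>\<^sup>+x. ennreal ((norm (mollify e FK x - FK x))\<^sup>2) \<partial>lborel) \<le> ennreal (\<delta> / M)"
    by (rule mollify_L2_tendsto[OF FK_int FK_L2, of "\<delta> / M"]) (use \<delta> M(2) in auto)
  define e where "e = min (d / 2) r"
  have e: "e > 0" "e < d" "e \<le> r" using d(1) r(1) by (auto simp: e_def)
  define w where "w = mollify e vK"
  have w': "(w has_derivative (\<lambda>k. mollify_grad e vK x \<bullet> k)) (at x)" for x
    unfolding w_def by (rule mollify_has_derivative[OF vK_int e(1)])
  have grad_w: "grad w x = mollify_grad e vK x" for x
    by (rule grad_eqI[OF w'])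
  have Ck_w: "Ck (Suc 0) w"
    by (rule Ck_SucI[OF w'])
      (use continuous_mollify_grad[OF vK_int e(1)] in \<open>auto intro: continuous_intros\<close>)
  have eq: "(w x, grad w x) - F x = mollify e FK x - FK x" if "x \<in> cball c (2 * r)" for x
  proof -
    have xK: "cball x e \<subseteq> K"
    proof
      fix y assume "y \<in> cball x e"
      then show "y \<in> K"
        using that e(3) dist_triangle[of c y x] by (simp add: K_def)
    qed
    have "grad w x = mollify e GK x"
      unfolding grad_w vK_def[abs_def] GK_def[abs_def]
      by (rule mollify_grad_eq_mollify[OF b(4,1,2) _ _ K(1,2) e(1) xK])
        (use vK_int GK_int in \<open>simp_all add: vK_def[abs_def] GK_def[abs_def]\<close>)
    moreover have "mollify e FK x = (mollify e vK x, mollify e GK x)"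
    proof (rule prod_eqI)
      have i: "integrable lborel (\<lambda>y. mollifier e (x - y) *\<^sub>R FK y)"
        by (rule integrable_mollify[OF FK_int e(1)])
      show "fst (mollify e FK x) = fst (mollify e vK x, mollify e GK x)"
        using integral_fst[OF i] by (simp add: mollify_def FK_eq)
      show "snd (mollify e FK x) = snd (mollify e vK x, mollify e GK x)"
        using integral_snd[OF i] by (simp add: mollify_def FK_eq)
    qed
    moreover have "FK x = F x"
      using that r(1) by (simp add: FK_def K_def)
    ultimately show ?thesis by (simp add: w_def)
  qed
  have mm: "mollify e FK \<in> borel_measurable borel"
  proof -
    have "FK \<in> borel_measurable borel" using borel_measurable_integrable[OF FK_int] by simp
    then have "(\<lambda>(x, y). mollifier e (x - y) *\<^sub>R FK y) \<in> borel_measurable (borel \<Otimes>\<^sub>M lborel)"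
      by measurable
    from lborel.borel_measurable_lebesgue_integral[OF this] show ?thesis
      unfolding mollify_def[abs_def] by simp
  qed
  have "(\<integral>\<^sup>+x. ennreal ((norm ((w x, grad w x) - (v x, G x)))\<^sup>2) * indicator (cball c (2 * r)) x \<partial>\<mu>)
      = (\<integral>\<^sup>+x. ennreal ((norm (mollify e FK x - FK x))\<^sup>2) * indicator (cball c (2 * r)) x \<partial>\<mu>)"
  proof (rule nn_integral_cong_AE, use b(3) in eventually_elim)
    case (elim x)
    then show ?case using eq[of x] by (auto simp: F_def indicator_def)
  qed
  also have "\<dots> \<le> ennreal M * (\<integral>\<^sup>+x. ennreal ((norm (mollify e FK x - FK x))\<^sup>2) \<partial>lborel)"
  proof (rule nn_integral_\<mu>_le_lborel)
    have "cball c (2 * r) \<subseteq> K" using r(1) by (auto simp: K_def)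
    then show "cball c (2 * r) \<subseteq> pdf_dom p" "\<And>x. x \<in> cball c (2 * r) \<Longrightarrow> p x \<le> M"
      using K(2) M(4) by auto
    show "(\<lambda>x. ennreal ((norm (mollify e FK x - FK x))\<^sup>2)) \<in> borel_measurable borel"
      using mm borel_measurable_integrable[OF FK_int] by simp
  qed simp
  also have "\<dots> \<le> ennreal M * ennreal (\<delta> / M)"
    using d(2)[OF e(1,2)] by (rule mult_left_mono) simp
  also have "\<dots> = ennreal \<delta>"
    using M(2) \<delta> by (simp add: ennreal_mult[symmetric])
  finally show ?thesis using that Ck_w by blast
qed

end

text \<open>The gradient is bounded on a closed ball inside \<Omega>, and the mean value inequality
  on the convex open ball turns the bound into a Lipschitz constant. This admits C^1 functions as
  test functions in \<open>poincare_with\<close>.\<close>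

lemma locally_lipschitz_on_C1:
  fixes f :: "'a::euclidean_space \<Rightarrow> real"
  assumes "open \<Omega>" and diff: "\<And>x. x \<in> \<Omega> \<Longrightarrow> f differentiable (at x)"
    and cont: "continuous_on \<Omega> (grad f)"
  shows "locally_lipschitz_on \<Omega> f"
  unfolding locally_lipschitz_on_def
proof
  fix x assume x: "x \<in> \<Omega>"
  obtain e where e: "e > 0" "cball x e \<subseteq> \<Omega>"
    using bspec[OF open_contains_cball[THEN iffD1, OF \<open>open \<Omega>\<close>] x] by auto
  have "compact (grad f ` cball x e)"
    by (intro compact_continuous_image continuous_on_subset[OF cont e(2)] compact_cball)
  then obtain B where B: "\<And>y. y \<in> cball x e \<Longrightarrow> norm (grad f y) \<le> B"
    using compact_imp_bounded by (force simp: bounded_iff)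
  have "B-lipschitz_on (ball x e \<inter> \<Omega>) f"
  proof (rule lipschitz_onI)
    have "norm (grad f x) \<le> B" using e(1) by (intro B) simp
    then show "0 \<le> B" by (rule order_trans[OF norm_ge_zero])
    fix y z assume yz: "y \<in> ball x e \<inter> \<Omega>" "z \<in> ball x e \<inter> \<Omega>"
    have "norm (f y - f z) \<le> B * norm (y - z)"
    proof (rule differentiable_bound)
      show "convex (ball x e)" by (rule convex_ball)
      show "y \<in> ball x e" "z \<in> ball x e" using yz by simp_all
      fix u assume "u \<in> ball x e"
      then have u: "u \<in> cball x e" "u \<in> \<Omega>" using e(2) by auto
      show "(f has_derivative (\<lambda>k. grad f u \<bullet> k)) (at u within ball x e)"
        by (rule has_derivative_at_withinI[OF has_derivative_grad[OF diff[OF u(2)]]])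
      show "onorm (\<lambda>k. grad f u \<bullet> k) \<le> B"
      proof (rule onorm_le)
        fix k
        have "norm (grad f u \<bullet> k) \<le> norm (grad f u) * norm k"
          using Cauchy_Schwarz_ineq2[of "grad f u" k] by simp
        also have "\<dots> \<le> B * norm k" by (rule mult_right_mono[OF B[OF u(1)] norm_ge_zero])
        finally show "norm (grad f u \<bullet> k) \<le> B * norm k" .
      qed
    qed
    then show "dist (f y) (f z) \<le> B * dist y z" by (simp add: dist_norm)
  qed
  with e(1) show "\<exists>e>0. \<exists>L. L-lipschitz_on (ball x e \<inter> \<Omega>) f" by blast
qed

lemma Ck_1_differentiable: "Ck (Suc 0) f \<Longrightarrow> f differentiable (at x)"
  by simp

lemma grad_sum_mult:
  fixes f g :: "nat \<Rightarrow> 'a::euclidean_space \<Rightarrow> real"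
  assumes "\<And>j. f j differentiable (at x)" "\<And>j. g j differentiable (at x)"
  shows "grad (\<lambda>x. \<Sum>j<n. f j x * g j x) x = (\<Sum>j<n. f j x *\<^sub>R grad (g j) x + g j x *\<^sub>R grad (f j) x)"
proof (rule grad_eqI)
  have "((\<lambda>x. \<Sum>j<n. f j x * g j x) has_derivative
      (\<lambda>k. \<Sum>j<n. f j x * (grad (g j) x \<bullet> k) + (grad (f j) x \<bullet> k) * g j x)) (at x)"
    by (intro has_derivative_sum has_derivative_mult has_derivative_grad assms)
  moreover have "(\<Sum>j<n. f j x * (grad (g j) x \<bullet> k) + (grad (f j) x \<bullet> k) * g j x)
      = (\<Sum>j<n. f j x *\<^sub>R grad (g j) x + g j x *\<^sub>R grad (f j) x) \<bullet> k" for k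
    by (simp add: inner_sum_left inner_add_left mult.commute)
  ultimately show "((\<lambda>x. \<Sum>j<n. f j x * g j x) has_derivative
      (\<bullet>) (\<Sum>j<n. f j x *\<^sub>R grad (g j) x + g j x *\<^sub>R grad (f j) x)) (at x)"
    by simp
qed

lemma grad_const: "grad (\<lambda>x. c) x = 0"
  by (rule grad_eqI) simp

lemma grad_cong_open:
  assumes "open S" "x \<in> S" "\<And>y. y \<in> S \<Longrightarrow> f y = g y" "g differentiable (at x)"
  shows "f differentiable (at x)" "grad f x = grad g x"
proof -
  have "(f has_derivative (\<lambda>k. grad g x \<bullet> k)) (at x)"
    by (rule has_derivative_transform_within_open[OF has_derivative_grad[OF assms(4)] assms(1,2)])
      (simp add: assms(3))
  then show "f differentiable (at x)" "grad f x = grad g x"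
    by (auto simp: differentiable_def intro: grad_eqI)
qed

text \<open>The square of g + (f n - g) is expanded, and the cross term tends to 0 by
  Cauchy-Schwarz.\<close>

lemma square_integral_tendsto:
  assumes f: "\<And>n. square_integrable M (f n)" and g: "square_integrable M g"
    and lim: "(\<lambda>n. LINT x|M. (norm (f n x - g x))\<^sup>2) \<longlonglongrightarrow> 0"
  shows "(\<lambda>n. LINT x|M. (norm (f n x))\<^sup>2) \<longlonglongrightarrow> (LINT x|M. (norm (g x))\<^sup>2)"
proof -
  have d: "square_integrable M (\<lambda>x. f n x - g x)" for n
    by (intro square_integrable_diff f g)
  have eq: "(LINT x|M. (norm (f n x))\<^sup>2) = (LINT x|M. (norm (g x))\<^sup>2)
      + 2 * 1 * (LINT x|M. g x \<bullet> (f n x - g x)) + 1\<^sup>2 * (LINT x|M. (norm (f n x - g x))\<^sup>2)" for n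
    unfolding square_integral_add_scaleR[OF g d, symmetric] by simp
  have "(\<lambda>n. LINT x|M. g x \<bullet> (f n x - g x)) \<longlonglongrightarrow> 0"
    by (rule tendsto_zero_of_power2_le[OF integral_Cauchy_Schwarz[OF g d] tendsto_mult_right_zero[OF lim]])
  then have "(\<lambda>n. (LINT x|M. (norm (g x))\<^sup>2) + 2 * 1 * (LINT x|M. g x \<bullet> (f n x - g x))
      + 1\<^sup>2 * (LINT x|M. (norm (f n x - g x))\<^sup>2)) \<longlonglongrightarrow> (LINT x|M. (norm (g x))\<^sup>2) + 2 * 1 * 0 + 1\<^sup>2 * 0"
    by (intro tendsto_intros lim)
  then show ?thesis unfolding eq by simp
qed

section \<open>Gluing the local approximations\<close>

context continuous_pdf
begin

lemma measurable_\<mu>_continuous_on: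
  fixes f :: "'a \<Rightarrow> 'b::euclidean_space"
  assumes "continuous_on (pdf_dom p) f"
  shows "f \<in> borel_measurable \<mu>"
  unfolding borel_measurable_\<mu>
  by (rule continuous_imp_measurable_on_sets_lebesgue[OF assms dom_sets])

lemma global_C1_approx:
  assumes wg: "has_weak_gradient (pdf_dom p) v G"
    and L2: "square_integrable \<mu> v" "square_integrable \<mu> G" and \<delta>: "\<delta> > 0"
  obtains \<phi> where "\<And>x. x \<in> pdf_dom p \<Longrightarrow> \<phi> differentiable (at x)" "continuous_on (pdf_dom p) (grad \<phi>)"
    "(\<integral>\<^sup>+x. ennreal ((norm ((\<phi> x, grad \<phi> x) - (v x, G x)))\<^sup>2) \<partial>\<mu>) \<le> ennreal \<delta>"
proof -
  have "pdf_dom p \<noteq> {}" using not_empty by (simp add: space_\<mu>)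
  \<comment> \<open>Three radii are in play: the balls of radius r cover the support, the partition
    functions vanish outside radius 2 r, and mollification has room up to radius 3 r.\<close>
  obtain c r where cr: "\<And>n::nat. c n \<in> pdf_dom p" "\<And>n. r n > 0" "\<And>n. cball (c n) (3 * r n) \<subseteq> pdf_dom p"
    "pdf_dom p \<subseteq> (\<Union>n. ball (c n) (r n))"
  proof (rule open_countable_ball_cover[OF \<open>pdf_dom p \<noteq> {}\<close>])
    show "\<exists>r>0. cball x (3 * r) \<subseteq> pdf_dom p" if x: "x \<in> pdf_dom p" for x
    proof -
      obtain e where "e > 0" "cball x e \<subseteq> pdf_dom p"
        using bspec[OF open_contains_cball[THEN iffD1, OF open_dom] x] by auto
      then show ?thesis by (intro exI[of _ "e / 3"]) simp
    qed
  qed blast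
  define b where "b j = cutoff (c j) (r j)" for j
  define \<zeta> where "\<zeta> = unity_partition b"
  have Ck_\<zeta>: "Ck (Suc 0) (\<zeta> j)" for j
    unfolding \<zeta>_def unity_partition_def b_def
    by (intro Ck_mult Ck_prod Ck_diff Ck_const Ck_cutoff finite_lessThan)
  have diff_\<zeta>: "\<zeta> j differentiable (at x)" for j x
    using Ck_\<zeta> by (rule Ck_1_differentiable)
  have \<zeta>_1: "\<bar>\<zeta> j x\<bar> \<le> 1" for j x
  proof -
    have "0 \<le> b i x" "b i x \<le> 1" for i by (simp_all add: b_def cutoff_bounds)
    then have "0 \<le> (\<Prod>i<j. 1 - b i x)" "(\<Prod>i<j. 1 - b i x) \<le> 1"
      by (auto intro!: prod_nonneg prod_le_1)
    then show ?thesis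
      unfolding \<zeta>_def unity_partition_def abs_mult using \<open>0 \<le> b j x\<close> \<open>b j x \<le> 1\<close>
      by (intro mult_le_one) auto
  qed
  have \<zeta>_out: "\<zeta> j x = 0" if "x \<notin> cball (c j) (2 * r j)" for j x
  proof -
    have "norm (x - c j) \<ge> 2 * r j" using that by (simp add: dist_norm norm_minus_commute)
    then show ?thesis
      by (simp add: \<zeta>_def unity_partition_def b_def cutoff_eq_0[OF cr(2)])
  qed
  have grad_\<zeta>_out: "grad (\<zeta> j) x = 0" if "x \<notin> cball (c j) (2 * r j)" for j x
  proof -
    have "grad (\<zeta> j) x = grad (\<lambda>x. 0) x"
      by (rule grad_cong_open(2)[of "- cball (c j) (2 * r j)"]) (use that \<zeta>_out in auto)
    then show ?thesis by (simp add: grad_const)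
  qed
  have "\<exists>L. \<forall>x. norm (grad (\<zeta> j) x) \<le> L" for j
  proof -
    have "compact (grad (\<zeta> j) ` cball (c j) (2 * r j))"
      by (intro compact_continuous_image compact_cball continuous_on_subset[OF continuous_grad_Ck[OF Ck_\<zeta>]]) simp
    then obtain L where L: "\<And>x. x \<in> cball (c j) (2 * r j) \<Longrightarrow> norm (grad (\<zeta> j) x) \<le> L"
      using compact_imp_bounded by (force simp: bounded_iff)
    have "norm (grad (\<zeta> j) x) \<le> max L 0" for x
      using L[of x] grad_\<zeta>_out[of x j] by (cases "x \<in> cball (c j) (2 * r j)") (auto simp: le_max_iff_disj)
    then show ?thesis by blast
  qed
  then have "\<forall>j. \<exists>L. \<forall>x. norm (grad (\<zeta> j) x) \<le> L" ..
  from choice[OF this] obtain L where L: "\<And>j x. norm (grad (\<zeta> j) x) \<le> L j" by blast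
  have L0: "L j \<ge> 0" for j using L[of j undefined] norm_ge_zero order_trans by blast
  \<comment> \<open>The factor in front of the squared error of piece j: 2 ^ Suc j from the squared
    norm of a sum, and (1 + L j)^2 because the error is weighted by \<zeta> j and, in the gradient,
    also by grad (\<zeta> j).\<close>
  define K where "K j = 2 ^ Suc j * (1 + L j)\<^sup>2" for j
  have K: "K j > 0" for j
    using L0[of j] by (simp add: K_def)
  \<comment> \<open>With this tolerance piece j contributes K j * \<delta>' j = \<delta> / 2 ^ Suc
    j, and these sum to \<delta>.\<close>
  define \<delta>' where "\<delta>' j = \<delta> * (1/2) ^ Suc j / K j" for j
  have \<delta>': "\<delta>' j > 0" for j using \<delta> K by (simp add: \<delta>'_def)
  have "\<exists>w. Ck (Suc 0) w \<and> (\<integral>\<^sup>+x. ennreal ((norm ((w x, grad w x) - (v x, G x)))\<^sup>2)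
      * indicator (cball (c j) (2 * r j)) x \<partial>\<mu>) \<le> ennreal (\<delta>' j)" for j
    by (rule local_C1_approx[OF wg L2 cr(2) cr(3) \<delta>']) blast
  then have "\<forall>j. \<exists>w. Ck (Suc 0) w \<and> (\<integral>\<^sup>+x. ennreal ((norm ((w x, grad w x) - (v x, G x)))\<^sup>2)
      * indicator (cball (c j) (2 * r j)) x \<partial>\<mu>) \<le> ennreal (\<delta>' j)" ..
  from choice[OF this] obtain w where Ck_w: "\<And>j. Ck (Suc 0) (w j)"
    and w: "\<And>j. (\<integral>\<^sup>+x. ennreal ((norm ((w j x, grad (w j) x) - (v x, G x)))\<^sup>2)
      * indicator (cball (c j) (2 * r j)) x \<partial>\<mu>) \<le> ennreal (\<delta>' j)" by blast
  have diff_w: "w j differentiable (at x)" for j x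
    using Ck_w by (rule Ck_1_differentiable)
  define \<phi>n where "\<phi>n i x = (\<Sum>j<i. \<zeta> j x * w j x)" for i x
  define \<phi> where "\<phi> x = (\<Sum>j. \<zeta> j x * w j x)" for x
  have b1: "b i x = 1" if "x \<in> ball (c i) (r i)" for i x
    unfolding b_def using that cr(2)[of i] by (intro cutoff_eq_1) (auto simp: dist_norm norm_minus_commute)
  \<comment> \<open>The cutoff b i is 1 on the i-th ball, so the terms with index above i vanish
    there, while term i itself remains; hence the bound Suc i.\<close>
  have \<phi>_eq: "\<phi> x = \<phi>n (Suc i) x" if "x \<in> ball (c i) (r i)" for i x
    unfolding \<phi>_def \<phi>n_def
    by (rule suminf_finite) (use unity_partition_eq_0[of b i x, OF b1[OF that]] in \<open>auto simp: \<zeta>_def\<close>)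
  have Ck_\<phi>n: "Ck (Suc 0) (\<phi>n i)" for i
    unfolding \<phi>n_def by (intro Ck_sum Ck_mult Ck_\<zeta> Ck_w)
  have \<phi>_local: "\<phi> differentiable (at x)" "grad \<phi> x = grad (\<phi>n (Suc i)) x" if "x \<in> ball (c i) (r i)" for i x
    using grad_cong_open[OF open_ball that, of \<phi> "\<phi>n (Suc i)"] \<phi>_eq Ck_1_differentiable[OF Ck_\<phi>n] by blast+
  show ?thesis
  proof
    show "\<phi> differentiable (at x)" if "x \<in> pdf_dom p" for x
      using cr(4) that \<phi>_local(1) by blast
    have "continuous (at x) (grad \<phi>)" if x: "x \<in> pdf_dom p" for x
    proof -
      obtain i where i: "x \<in> ball (c i) (r i)" using cr(4) x by blast
      have "continuous_on (ball (c i) (r i)) (grad (\<phi>n (Suc i)))"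
        by (rule continuous_on_subset[OF continuous_grad_Ck[OF Ck_\<phi>n]]) simp
      then have "continuous_on (ball (c i) (r i)) (grad \<phi>)"
        by (rule continuous_on_eq) (simp add: \<phi>_local(2))
      then show ?thesis using i by (simp add: continuous_on_eq_continuous_at)
    qed
    then show "continuous_on (pdf_dom p) (grad \<phi>)"
      by (intro continuous_at_imp_continuous_on) blast
    define W where "W j x = (w j x, grad (w j) x) - (v x, G x)" for j x
    define T where "T j x = ennreal (K j) * (ennreal ((norm (W j x))\<^sup>2) * indicator (cball (c j) (2 * r j)) x)" for j x
    have bound: "ennreal ((norm ((\<phi> x, grad \<phi> x) - (v x, G x)))\<^sup>2) \<le> (\<Sum>j. T j x)" if x: "x \<in> pdf_dom p" for x
    proof -
      obtain i where i: "x \<in> ball (c i) (r i)" using cr(4) x by blast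
      define a where "a j = (\<zeta> j x * (w j x - v x),
        \<zeta> j x *\<^sub>R (grad (w j) x - G x) + (w j x - v x) *\<^sub>R grad (\<zeta> j) x)" for j
      have sum1: "(\<Sum>j<Suc i. \<zeta> j y) = 1" if "y \<in> ball (c i) (r i)" for y
        unfolding \<zeta>_def sum_unity_partition using b1[OF that] by (simp add: prod_zero)
      \<comment> \<open>The partial sum is constantly 1 on a whole ball around x, so the gradients
        of the partition functions add up to 0. This is why w j x may be replaced by w j x - v x in
        front of them.\<close>
      have "grad (\<lambda>x. \<Sum>j<Suc i. \<zeta> j x * 1) x = (\<Sum>j<Suc i. \<zeta> j x *\<^sub>R grad (\<lambda>x. 1) x + 1 *\<^sub>R grad (\<zeta> j) x)"
        by (rule grad_sum_mult) (simp_all add: diff_\<zeta>)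
      moreover have "grad (\<lambda>x. \<Sum>j<Suc i. \<zeta> j x * 1) x = grad (\<lambda>x. 1) x"
        by (rule grad_cong_open(2)[OF open_ball i]) (simp_all only: mult_1_right sum1 differentiable_const)
      ultimately have sum0: "(\<Sum>j<Suc i. grad (\<zeta> j) x) = 0"
        by (simp only: grad_const scaleR_zero_right add_0 scaleR_one)
      have "(\<phi> x, grad \<phi> x) - (v x, G x) = (\<Sum>j<Suc i. a j)"
      proof (rule prod_eqI)
        have "\<phi> x - v x = (\<Sum>j<Suc i. \<zeta> j x * w j x) - (\<Sum>j<Suc i. \<zeta> j x) * v x"
          using sum1[OF i] by (simp only: \<phi>_eq[OF i] \<phi>n_def mult_1_left)
        also have "\<dots> = (\<Sum>j<Suc i. \<zeta> j x * (w j x - v x))"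
          by (simp only: sum_distrib_right sum_subtractf right_diff_distrib)
        finally show "fst ((\<phi> x, grad \<phi> x) - (v x, G x)) = fst (\<Sum>j<Suc i. a j)"
          by (simp only: fst_sum a_def fst_conv fst_diff)
        have "grad \<phi> x = (\<Sum>j<Suc i. \<zeta> j x *\<^sub>R grad (w j) x + w j x *\<^sub>R grad (\<zeta> j) x)"
          unfolding \<phi>_local(2)[OF i] \<phi>n_def by (rule grad_sum_mult) (rule diff_\<zeta> diff_w)+
        then have "grad \<phi> x - G x = (\<Sum>j<Suc i. \<zeta> j x *\<^sub>R grad (w j) x + w j x *\<^sub>R grad (\<zeta> j) x)
            - (\<Sum>j<Suc i. \<zeta> j x) *\<^sub>R G x - v x *\<^sub>R (\<Sum>j<Suc i. grad (\<zeta> j) x)"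
          using sum1[OF i] sum0 by (simp only: scaleR_one scaleR_zero_right diff_zero)
        also have "\<dots> = (\<Sum>j<Suc i. \<zeta> j x *\<^sub>R (grad (w j) x - G x) + (w j x - v x) *\<^sub>R grad (\<zeta> j) x)"
          by (simp only: scaleR_sum_left scaleR_sum_right sum_subtractf[symmetric])
            (simp add: algebra_simps)
        finally show "snd ((\<phi> x, grad \<phi> x) - (v x, G x)) = snd (\<Sum>j<Suc i. a j)"
          by (simp only: snd_sum a_def snd_conv snd_diff)
      qed
      then have "(norm ((\<phi> x, grad \<phi> x) - (v x, G x)))\<^sup>2 \<le> (\<Sum>j<Suc i. 2 ^ Suc j * (norm (a j))\<^sup>2)"
        using norm_sum_sq_le[of a "Suc i"] by simp
      then have "ennreal ((norm ((\<phi> x, grad \<phi> x) - (v x, G x)))\<^sup>2)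
          \<le> ennreal (\<Sum>j<Suc i. 2 ^ Suc j * (norm (a j))\<^sup>2)" by (rule ennreal_leI)
      also have "\<dots> = (\<Sum>j<Suc i. ennreal (2 ^ Suc j * (norm (a j))\<^sup>2))"
        by (rule sum_ennreal[symmetric]) simp
      also have "\<dots> \<le> (\<Sum>j<Suc i. T j x)"
      proof (rule sum_mono)
        fix j
        show "ennreal (2 ^ Suc j * (norm (a j))\<^sup>2) \<le> T j x"
        proof (cases "x \<in> cball (c j) (2 * r j)")
          case True
          have a_eq: "a j = \<zeta> j x *\<^sub>R W j x + (0, (w j x - v x) *\<^sub>R grad (\<zeta> j) x)"
            by (simp add: a_def W_def)
          have "norm (a j) \<le> norm (\<zeta> j x *\<^sub>R W j x) + norm (0::real, (w j x - v x) *\<^sub>R grad (\<zeta> j) x)"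
            unfolding a_eq by (rule norm_triangle_ineq)
          also have "norm (\<zeta> j x *\<^sub>R W j x) \<le> 1 * norm (W j x)"
            unfolding norm_scaleR using \<zeta>_1[of j x] by (intro mult_right_mono) auto
          also have "norm (0::real, (w j x - v x) *\<^sub>R grad (\<zeta> j) x) \<le> norm (W j x) * L j"
          proof -
            have "\<bar>w j x - v x\<bar> \<le> norm (W j x)"
              using norm_fst_le[of "w j x - v x" "grad (w j) x - G x"] by (simp add: W_def)
            then have "\<bar>w j x - v x\<bar> * norm (grad (\<zeta> j) x) \<le> norm (W j x) * L j"
              using L by (intro mult_mono) auto
            then show ?thesis by (simp add: norm_Pair)
          qed
          finally have "norm (a j) \<le> (1 + L j) * norm (W j x)" by (simp add: algebra_simps)
          then have "(norm (a j))\<^sup>2 \<le> ((1 + L j) * norm (W j x))\<^sup>2" by (intro power_mono) auto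
          then have "2 ^ Suc j * (norm (a j))\<^sup>2 \<le> K j * (norm (W j x))\<^sup>2"
            unfolding K_def mult.assoc by (intro mult_left_mono) (auto simp: power_mult_distrib)
          then show ?thesis
            using True K[of j] by (simp only: T_def indicator_simps mult_1_right
                ennreal_mult[symmetric] less_imp_le zero_le_power2 ennreal_leI)
        next
          case False
          then show ?thesis by (simp add: a_def \<zeta>_out grad_\<zeta>_out zero_prod_def[symmetric])
        qed
      qed
      also have "\<dots> \<le> (\<Sum>j. T j x)" by (rule sum_le_suminf[OF summableI]) auto
      finally show ?thesis .
    qed
    have W_meas: "(\<lambda>x. ennreal ((norm (W j x))\<^sup>2) * indicator (cball (c j) (2 * r j)) x) \<in> borel_measurable \<mu>" for j
    proof -
      have "w j \<in> borel_measurable \<mu>"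
        by (intro measurable_\<mu>_continuous_on continuous_at_imp_continuous_on ballI
            differentiable_imp_continuous_within diff_w)
      moreover have "grad (w j) \<in> borel_measurable \<mu>"
        by (intro measurable_\<mu>_continuous_on continuous_on_subset[OF continuous_grad_Ck[OF Ck_w]]) simp
      moreover have "v \<in> borel_measurable \<mu>" "G \<in> borel_measurable \<mu>"
        using L2 by (auto intro: square_integrable_measurable)
      ultimately have "(\<lambda>x. W j x) \<in> borel_measurable \<mu>"
        unfolding W_def by (intro borel_measurable_diff borel_measurable_Pair)
      moreover have "(\<lambda>x. indicator (cball (c j) (2 * r j)) x :: ennreal) \<in> borel_measurable \<mu>"
        unfolding borel_measurable_\<mu>
        by (intro measurable_restrict_space1 measurable_completion borel_measurable_indicator) simp
      ultimately show ?thesis by measurable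
    qed
    have "(\<integral>\<^sup>+x. ennreal ((norm ((\<phi> x, grad \<phi> x) - (v x, G x)))\<^sup>2) \<partial>\<mu>) \<le> (\<integral>\<^sup>+x. (\<Sum>j. T j x) \<partial>\<mu>)"
      using bound by (intro nn_integral_mono) (simp add: space_\<mu>)
    also have "\<dots> = (\<Sum>j. \<integral>\<^sup>+x. T j x \<partial>\<mu>)"
      unfolding T_def using W_meas by (intro nn_integral_suminf borel_measurable_times) auto
    also have "\<dots> \<le> (\<Sum>j. ennreal (\<delta> * (1/2) ^ Suc j))"
    proof (intro suminf_le summableI)
      fix j
      have "(\<integral>\<^sup>+x. T j x \<partial>\<mu>) = ennreal (K j) * (\<integral>\<^sup>+x. ennreal ((norm (W j x))\<^sup>2)
          * indicator (cball (c j) (2 * r j)) x \<partial>\<mu>)"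
        unfolding T_def by (rule nn_integral_cmult[OF W_meas])
      also have "\<dots> \<le> ennreal (K j) * ennreal (\<delta>' j)"
        using w[of j] unfolding W_def by (rule mult_left_mono) simp
      also have "\<dots> = ennreal (\<delta> * (1/2) ^ Suc j)"
        using K[of j] \<delta>'[of j] by (simp add: ennreal_mult[symmetric] \<delta>'_def)
      finally show "(\<integral>\<^sup>+x. T j x \<partial>\<mu>) \<le> ennreal (\<delta> * (1/2) ^ Suc j)" .
    qed
    also have "\<dots> = ennreal \<delta>"
    proof -
      have "(\<lambda>j. \<delta> * (1/2) ^ Suc j) sums (\<delta> * 1)"
        by (intro sums_mult power_half_series)
      then show ?thesis
        using \<delta> by (subst suminf_ennreal2) (auto simp: sums_iff)
    qed
    finally show "(\<integral>\<^sup>+x. ennreal ((norm ((\<phi> x, grad \<phi> x) - (v x, G x)))\<^sup>2) \<partial>\<mu>) \<le> ennreal \<delta>" .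
  qed
qed

subsection \<open>The Poincare inequality for weakly differentiable functions\<close>

text \<open>The assumed inequality concerns mean zero, so it is applied to \<phi> minus its mean,
  which is locally Lipschitz on the support and has the same gradient.\<close>

lemma poincare_C1:
  assumes P: "poincare_with p C"
    and \<phi>: "\<And>x. x \<in> pdf_dom p \<Longrightarrow> \<phi> differentiable (at x)" "continuous_on (pdf_dom p) (grad \<phi>)"
    and L2: "square_integrable \<mu> \<phi>" "square_integrable \<mu> (grad \<phi>)"
  shows "(LINT x|\<mu>. (norm (\<phi> x - (LINT y|\<mu>. \<phi> y)))\<^sup>2) \<le> C * (LINT x|\<mu>. (norm (grad \<phi> x))\<^sup>2)"
proof -
  define m where "m = (LINT y|\<mu>. \<phi> y)"
  define \<psi> where "\<psi> x = \<phi> x - m" for x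
  have int: "integrable \<mu> \<phi>" by (rule square_integrable_imp_integrable_vec[OF L2(1)])
  have const: "square_integrable \<mu> (\<lambda>x. m)" by (simp add: square_integrable_def)
  have \<psi>': "(\<psi> has_derivative (\<lambda>k. grad \<phi> x \<bullet> k)) (at x)" if "x \<in> pdf_dom p" for x
    unfolding \<psi>_def using has_derivative_diff[OF has_derivative_grad[OF \<phi>(1)[OF that]] has_derivative_const[of m]]
    by simp
  have grad_\<psi>: "grad \<psi> x = grad \<phi> x" if "x \<in> pdf_dom p" for x
    by (rule grad_eqI[OF \<psi>'[OF that]])
  have \<psi>_L2: "square_integrable \<mu> \<psi>"
    unfolding \<psi>_def by (intro square_integrable_diff L2 const)
  have lip: "locally_lipschitz_on (pdf_dom p) \<psi>"
  proof (rule locally_lipschitz_on_C1[OF open_dom])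
    show "\<psi> differentiable (at x)" if "x \<in> pdf_dom p" for x
      using \<psi>'[OF that] by (auto simp: differentiable_def)
    show "continuous_on (pdf_dom p) (grad \<psi>)"
      by (rule continuous_on_eq[OF \<phi>(2)]) (simp add: grad_\<psi>)
  qed
  have L2': "in_L2 p \<psi>" using \<psi>_L2 by (simp add: in_L2_iff square_integrable_def)
  have mean: "pexp p \<psi> = 0"
    unfolding pexp_eq \<psi>_def using int by (simp add: m_def prob_space)
  have "ennreal (pexp p (\<lambda>x. (\<psi> x)\<^sup>2))
      \<le> ennreal C * (\<integral>\<^sup>+x\<in>pdf_dom p. ennreal ((norm (grad \<psi> x))\<^sup>2 * p x) \<partial>lebesgue)"
    using P lip L2' mean by (simp add: poincare_with_def)
  also have "(\<integral>\<^sup>+x\<in>pdf_dom p. ennreal ((norm (grad \<psi> x))\<^sup>2 * p x) \<partial>lebesgue)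
      = (\<integral>\<^sup>+x\<in>pdf_dom p. ennreal ((norm (grad \<phi> x))\<^sup>2) * ennreal (p x) \<partial>lebesgue)"
    by (intro nn_integral_cong) (auto simp: indicator_def grad_\<psi> ennreal_mult p_nonneg)
  also have "\<dots> = (\<integral>\<^sup>+x. ennreal ((norm (grad \<phi> x))\<^sup>2) \<partial>\<mu>)"
    using square_integrable_measurable[OF L2(2)] by (intro nn_integral_\<mu>[symmetric]) simp
  also have "\<dots> = ennreal (LINT x|\<mu>. (norm (grad \<phi> x))\<^sup>2)"
    by (rule nn_integral_eq_square_integral[OF L2(2)])
  finally have "ennreal (pexp p (\<lambda>x. (\<psi> x)\<^sup>2)) \<le> ennreal (C * (LINT x|\<mu>. (norm (grad \<phi> x))\<^sup>2))"
    using P by (simp add: poincare_with_def ennreal_mult)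
  then have "pexp p (\<lambda>x. (\<psi> x)\<^sup>2) \<le> C * (LINT x|\<mu>. (norm (grad \<phi> x))\<^sup>2)"
    using P by (subst (asm) ennreal_le_iff) (auto simp: poincare_with_def)
  then show ?thesis by (simp add: pexp_eq \<psi>_def m_def)
qed

text \<open>The C^1 approximants have neither mean zero nor, a priori, finite norm. Finiteness
  follows from that of the approximation error; their means tend to 0 by Cauchy-Schwarz against 1,
  so recentring does not change the limit. Both sides of \<open>poincare_C1\<close> then
  converge.\<close>

lemma poincare_weak:
  assumes P: "poincare_with p C" and wg: "has_weak_gradient (pdf_dom p) v G"
    and L2: "square_integrable \<mu> v" "square_integrable \<mu> G" and mean: "(LINT x|\<mu>. v x) = 0"
  shows "(LINT x|\<mu>. (v x)\<^sup>2) \<le> C * (LINT x|\<mu>. (norm (G x))\<^sup>2)"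
proof -
  have "\<exists>\<phi>. (\<forall>x\<in>pdf_dom p. \<phi> differentiable (at x)) \<and> continuous_on (pdf_dom p) (grad \<phi>) \<and>
    (\<integral>\<^sup>+x. ennreal ((norm ((\<phi> x, grad \<phi> x) - (v x, G x)))\<^sup>2) \<partial>\<mu>) \<le> ennreal (inverse (real (Suc n)))" for n
    by (rule global_C1_approx[OF wg L2, of "inverse (real (Suc n))"]) (simp, blast)
  then have "\<forall>n. \<exists>\<phi>. (\<forall>x\<in>pdf_dom p. \<phi> differentiable (at x)) \<and> continuous_on (pdf_dom p) (grad \<phi>) \<and>
    (\<integral>\<^sup>+x. ennreal ((norm ((\<phi> x, grad \<phi> x) - (v x, G x)))\<^sup>2) \<partial>\<mu>) \<le> ennreal (inverse (real (Suc n)))" ..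
  from choice[OF this] obtain \<phi> where
    \<phi>: "\<And>n x. x \<in> pdf_dom p \<Longrightarrow> \<phi> n differentiable (at x)" "\<And>n. continuous_on (pdf_dom p) (grad (\<phi> n))"
    and approx: "\<And>n. (\<integral>\<^sup>+x. ennreal ((norm ((\<phi> n x, grad (\<phi> n) x) - (v x, G x)))\<^sup>2) \<partial>\<mu>)
      \<le> ennreal (inverse (real (Suc n)))" by blast
  define D where "D n x = (\<phi> n x, grad (\<phi> n) x) - (v x, G x)" for n x
  have D_L2: "square_integrable \<mu> (D n)" for n
  proof -
    have "\<phi> n \<in> borel_measurable \<mu>"
      by (intro measurable_\<mu>_continuous_on continuous_at_imp_continuous_on ballI
          differentiable_imp_continuous_within \<phi>(1))
    moreover have "grad (\<phi> n) \<in> borel_measurable \<mu>"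
      by (rule measurable_\<mu>_continuous_on[OF \<phi>(2)])
    moreover have "v \<in> borel_measurable \<mu>" "G \<in> borel_measurable \<mu>"
      using L2 by (auto intro: square_integrable_measurable)
    ultimately have "D n \<in> borel_measurable \<mu>"
      unfolding D_def by (intro borel_measurable_diff borel_measurable_Pair)
    moreover have "(\<integral>\<^sup>+x. ennreal ((norm (D n x))\<^sup>2) \<partial>\<mu>) < \<infinity>"
      using le_less_trans[OF approx[of n] ennreal_less_top] by (simp add: D_def)
    ultimately show ?thesis by (simp add: square_integrable_iff_nn_integral)
  qed
  have D_le: "(LINT x|\<mu>. (norm (D n x))\<^sup>2) \<le> inverse (real (Suc n))" for n
    using approx[of n] unfolding D_def[symmetric] nn_integral_eq_square_integral[OF D_L2]
    by (subst (asm) ennreal_le_iff) auto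
  have D1: "square_integrable \<mu> (\<lambda>x. \<phi> n x - v x)" and D2: "square_integrable \<mu> (\<lambda>x. grad (\<phi> n) x - G x)" for n
    using square_integrable_fst[OF D_L2[of n]] square_integrable_snd[OF D_L2[of n]] by (simp_all add: D_def)
  have D1_le: "(LINT x|\<mu>. (norm (\<phi> n x - v x))\<^sup>2) \<le> inverse (real (Suc n))"
    and D2_le: "(LINT x|\<mu>. (norm (grad (\<phi> n) x - G x))\<^sup>2) \<le> inverse (real (Suc n))" for n
  proof -
    have "(LINT x|\<mu>. (norm (\<phi> n x - v x))\<^sup>2) \<le> (LINT x|\<mu>. (norm (D n x))\<^sup>2)"
      using square_integrable_integrable[OF D1] square_integrable_integrable[OF D_L2]
      by (rule integral_mono) (auto simp: D_def norm_Pair)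
    then show "(LINT x|\<mu>. (norm (\<phi> n x - v x))\<^sup>2) \<le> inverse (real (Suc n))" using D_le[of n] by simp
    have "(LINT x|\<mu>. (norm (grad (\<phi> n) x - G x))\<^sup>2) \<le> (LINT x|\<mu>. (norm (D n x))\<^sup>2)"
      using square_integrable_integrable[OF D2] square_integrable_integrable[OF D_L2]
      by (rule integral_mono) (auto simp: D_def norm_Pair)
    then show "(LINT x|\<mu>. (norm (grad (\<phi> n) x - G x))\<^sup>2) \<le> inverse (real (Suc n))" using D_le[of n] by simp
  qed
  have \<phi>_L2: "square_integrable \<mu> (\<phi> n)" and grad_L2: "square_integrable \<mu> (grad (\<phi> n))" for n
    using square_integrable_add[OF D1[of n] L2(1)] square_integrable_add[OF D2[of n] L2(2)] by simp_all
  define m where "m n = (LINT x|\<mu>. \<phi> n x)" for n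
  have one: "square_integrable \<mu> (\<lambda>x. c::real)" for c by (simp add: square_integrable_def)
  have m_le: "(m n)\<^sup>2 \<le> inverse (real (Suc n))" for n
  proof -
    have "(LINT x|\<mu>. \<phi> n x - v x) = m n"
      using square_integrable_imp_integrable_vec[OF \<phi>_L2[of n]] square_integrable_imp_integrable_vec[OF L2(1)]
      by (simp add: m_def mean)
    then show ?thesis
      using integral_Cauchy_Schwarz[OF D1[of n] one[of 1]] D1_le[of n] by (simp add: prob_space)
  qed
  have \<psi>_L2: "square_integrable \<mu> (\<lambda>x. \<phi> n x - m n)" for n
    by (intro square_integrable_diff \<phi>_L2 one)
  have inv: "(\<lambda>n. c * inverse (real (Suc n))) \<longlonglongrightarrow> 0" for c
    using tendsto_mult_right_zero[OF LIMSEQ_inverse_real_of_nat] .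
  \<comment> \<open>Here 4 = 2 + 2: the squared approximation error and the squared mean are each at
    most 1/(n+1), and each is doubled.\<close>
  have \<psi>_le: "(LINT x|\<mu>. (norm ((\<phi> n x - m n) - v x))\<^sup>2) \<le> 4 * inverse (real (Suc n))" for n
  proof -
    have "(LINT x|\<mu>. (norm ((\<phi> n x - m n) - v x))\<^sup>2) \<le> (LINT x|\<mu>. 2 * (norm (\<phi> n x - v x))\<^sup>2 + 2 * (m n)\<^sup>2)"
    proof (rule integral_mono)
      show "(norm ((\<phi> n x - m n) - v x))\<^sup>2 \<le> 2 * (norm (\<phi> n x - v x))\<^sup>2 + 2 * (m n)\<^sup>2" for x
        using norm_diff_sq_le[of "\<phi> n x - v x" "m n"] by (simp add: algebra_simps)
      show "integrable \<mu> (\<lambda>x. 2 * (norm (\<phi> n x - v x))\<^sup>2 + 2 * (m n)\<^sup>2)"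
        using square_integrable_integrable[OF D1[of n]] by simp
    qed (rule square_integrable_integrable[OF square_integrable_diff[OF \<psi>_L2 L2(1)]])
    also have "\<dots> = 2 * (LINT x|\<mu>. (norm (\<phi> n x - v x))\<^sup>2) + 2 * (m n)\<^sup>2"
      using square_integrable_integrable[OF D1[of n]] by (simp add: prob_space)
    also have "\<dots> \<le> 4 * inverse (real (Suc n))"
      using D1_le[of n] m_le[of n] by simp
    finally show ?thesis .
  qed
  have "(\<lambda>n. LINT x|\<mu>. (norm (\<phi> n x - m n))\<^sup>2) \<longlonglongrightarrow> (LINT x|\<mu>. (norm (v x))\<^sup>2)"
  proof (rule square_integral_tendsto[OF \<psi>_L2 L2(1)])
    show "(\<lambda>n. LINT x|\<mu>. (norm ((\<phi> n x - m n) - v x))\<^sup>2) \<longlonglongrightarrow> 0"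
      by (rule tendsto_sandwich[OF _ _ tendsto_const inv[of 4]])
        (rule always_eventually, rule allI, simp, rule always_eventually, rule allI, rule \<psi>_le)
  qed
  moreover have "(\<lambda>n. C * (LINT x|\<mu>. (norm (grad (\<phi> n) x))\<^sup>2)) \<longlonglongrightarrow> C * (LINT x|\<mu>. (norm (G x))\<^sup>2)"
  proof (intro tendsto_mult_left square_integral_tendsto[OF grad_L2 L2(2)])
    show "(\<lambda>n. LINT x|\<mu>. (norm (grad (\<phi> n) x - G x))\<^sup>2) \<longlonglongrightarrow> 0"
      by (rule tendsto_sandwich[OF _ _ tendsto_const LIMSEQ_inverse_real_of_nat])
        (rule always_eventually, rule allI, simp, rule always_eventually, rule allI, rule D2_le)
  qed
  moreover have "(LINT x|\<mu>. (norm (\<phi> n x - m n))\<^sup>2) \<le> C * (LINT x|\<mu>. (norm (grad (\<phi> n) x))\<^sup>2)" for n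
    unfolding m_def by (rule poincare_C1[OF P \<phi>(1) \<phi>(2) \<phi>_L2 grad_L2])
  ultimately have "(LINT x|\<mu>. (norm (v x))\<^sup>2) \<le> C * (LINT x|\<mu>. (norm (G x))\<^sup>2)"
    by (intro LIMSEQ_le) auto
  then show ?thesis by simp
qed

text \<open>Along the gradient D itself, f changes by about t |D|^2 but by at most t |D|, so |D| <=
  1 + \<epsilon>. Where f is not differentiable \<open>grad\<close> has the value 0, so the bound
  holds at every point of the support.\<close>

lemma norm_grad_le_lipschitz:
  fixes f :: "'a \<Rightarrow> real"
  assumes lip: "1-lipschitz_on (pdf_dom p) f" and x: "x \<in> pdf_dom p"
  shows "norm (grad f x) \<le> 1"
proof (cases "f differentiable (at x)")
  case True
  define D where "D = grad f x"
  have D: "(f has_derivative (\<lambda>k. D \<bullet> k)) (at x)"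
    unfolding D_def by (rule has_derivative_grad[OF True])
  obtain r where r: "r > 0" "ball x r \<subseteq> pdf_dom p"
    using bspec[OF open_contains_ball[THEN iffD1, OF open_dom] x] by auto
  show ?thesis
  proof (rule field_le_epsilon)
    fix \<epsilon> :: real assume "\<epsilon> > 0"
    have "\<exists>d>0. \<forall>y. norm (y - x) < d \<longrightarrow> norm (f y - f x - D \<bullet> (y - x)) \<le> \<epsilon> * norm (y - x)"
      using D \<open>\<epsilon> > 0\<close> unfolding has_derivative_at_alt by blast
    then obtain d where d: "d > 0"
      "\<And>y. norm (y - x) < d \<Longrightarrow> norm (f y - f x - D \<bullet> (y - x)) \<le> \<epsilon> * norm (y - x)" by blast
    \<comment> \<open>The step length below keeps |t D| at most min d r / 2, within both the
      differentiability radius and the support; adding 1 keeps the denominator positive when D =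
      0.\<close>
    define s where "s = norm D + 1"
    have pos: "s > 0" using norm_ge_zero[of D] unfolding s_def by linarith
    define t where "t = min d r / (2 * s)"
    have t: "t > 0" using d(1) r(1) pos by (simp add: t_def)
    have "norm (t *\<^sub>R D) < min d r"
    proof -
      have "norm (t *\<^sub>R D) = t * norm D" using t by simp
      also have "\<dots> \<le> t * s" using t by (intro mult_left_mono) (auto simp: s_def)
      also have "\<dots> = min d r / 2" using pos by (simp add: t_def)
      also have "\<dots> < min d r" using d(1) r(1) by linarith
      finally show ?thesis .
    qed
    then have small: "norm (t *\<^sub>R D) < d" "x + t *\<^sub>R D \<in> pdf_dom p"
      using r(2) by (auto simp: subset_iff dist_norm)
    have "norm (f (x + t *\<^sub>R D) - f x - D \<bullet> (t *\<^sub>R D)) \<le> \<epsilon> * norm (t *\<^sub>R D)"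
      using d(2)[of "x + t *\<^sub>R D"] small(1) by simp
    moreover have "norm (f (x + t *\<^sub>R D) - f x) \<le> 1 * norm (t *\<^sub>R D)"
      using lipschitz_onD[OF lip small(2) x] by (simp add: dist_norm)
    ultimately have "D \<bullet> (t *\<^sub>R D) \<le> (1 + \<epsilon>) * norm (t *\<^sub>R D)"
      unfolding real_norm_def distrib_right by linarith
    then have "t * (norm D)\<^sup>2 \<le> t * ((1 + \<epsilon>) * norm D)"
      using t by (simp add: power2_norm_eq_inner mult.left_commute)
    then have "(norm D)\<^sup>2 \<le> (1 + \<epsilon>) * norm D" using t by simp
    then show "norm (grad f x) \<le> 1 + \<epsilon>"
      unfolding D_def[symmetric] power2_eq_square using \<open>\<epsilon> > 0\<close>
      by (cases "D = 0") simp_all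
  qed
qed (simp add: grad_def)

text \<open>The gradient has norm at most 1 on the support and p integrates to 1 there. Applied to
  the centred h, this bounds its variance by C.\<close>

lemma poincare_lipschitz:
  fixes f :: "'a \<Rightarrow> real"
  assumes P: "poincare_with p C" and lip: "1-lipschitz_on (pdf_dom p) f"
    and L2: "square_integrable \<mu> f" and mean: "(LINT x|\<mu>. f x) = 0"
  shows "(LINT x|\<mu>. (norm (f x))\<^sup>2) \<le> C"
proof -
  have C: "C \<ge> 0" using P by (simp add: poincare_with_def)
  have "locally_lipschitz_on (pdf_dom p) f"
    unfolding locally_lipschitz_on_def
    by (intro ballI exI[of _ 1] conjI lipschitz_on_subset[OF lip]) auto
  then have "ennreal (pexp p (\<lambda>x. (f x)\<^sup>2))
      \<le> ennreal C * (\<integral>\<^sup>+x\<in>pdf_dom p. ennreal ((norm (grad f x))\<^sup>2 * p x) \<partial>lebesgue)"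
    using P L2 mean by (simp add: poincare_with_def in_L2_iff square_integrable_def pexp_eq)
  also have "\<dots> \<le> ennreal C * (\<integral>\<^sup>+x\<in>pdf_dom p. 1 * ennreal (p x) \<partial>lebesgue)"
  proof (intro mult_left_mono nn_integral_mono)
    fix x
    show "ennreal ((norm (grad f x))\<^sup>2 * p x) * indicator (pdf_dom p) x
        \<le> 1 * ennreal (p x) * indicator (pdf_dom p) x"
    proof (cases "x \<in> pdf_dom p")
      case True
      have "(norm (grad f x))\<^sup>2 \<le> 1"
        using norm_grad_le_lipschitz[OF lip True] by (simp add: power_le_one)
      then have "(norm (grad f x))\<^sup>2 * p x \<le> 1 * p x" by (intro mult_right_mono p_nonneg)
      then show ?thesis using True by (simp add: ennreal_leI)
    qed simp
  qed simp
  also have "(\<integral>\<^sup>+x\<in>pdf_dom p. 1 * ennreal (p x) \<partial>lebesgue) = (\<integral>\<^sup>+x. 1 \<partial>\<mu>)"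
    by (rule nn_integral_\<mu>[symmetric]) simp
  also have "\<dots> = 1" by (simp add: emeasure_space_1)
  finally have "pexp p (\<lambda>x. (f x)\<^sup>2) \<le> C"
    using C by (simp add: ennreal_le_iff)
  then show ?thesis by (simp add: pexp_eq)
qed

lemma integral_norm_sq_le:
  fixes f :: "'a \<Rightarrow> 'b::euclidean_space"
  assumes "square_integrable \<mu> f"
  shows "(LINT x|\<mu>. norm (f x))\<^sup>2 \<le> (LINT x|\<mu>. (norm (f x))\<^sup>2)"
proof -
  have "square_integrable \<mu> (\<lambda>x. norm (f x))"
    using assms by (auto simp: square_integrable_def)
  moreover have "square_integrable \<mu> (\<lambda>x. 1::real)" by (simp add: square_integrable_def)
  ultimately show ?thesis
    using integral_Cauchy_Schwarz[of \<mu> "\<lambda>x. norm (f x)" "\<lambda>x. 1"] by (simp add: prob_space)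
qed

subsection \<open>The Sobolev space as a space of pairs\<close>

text \<open>The graph of the weak gradient on mean-zero functions. With the gradient carried along
  as data instead of chosen by \<open>weak_grad\<close>, sums and limits can be formed pointwise,
  and the set is literally a closed subspace of square-integrable pairs.\<close>

definition W_pairs :: "('a \<Rightarrow> real \<times> 'a) set" where
  "W_pairs = {F. square_integrable \<mu> F \<and> (LINT x|\<mu>. fst (F x)) = 0 \<and>
     has_weak_gradient (pdf_dom p) (\<lambda>x. fst (F x)) (\<lambda>x. snd (F x))}"

lemma W_pairs_add_scaleR:
  assumes F: "F \<in> W_pairs" and G: "G \<in> W_pairs"
  shows "(\<lambda>x. F x + c *\<^sub>R G x) \<in> W_pairs"
proof -
  have L2: "square_integrable \<mu> F" "square_integrable \<mu> G"
    using F G by (simp_all add: W_pairs_def)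
  note int = square_integrable_imp_integrable_vec[OF square_integrable_fst[OF L2(1)]]
    square_integrable_imp_integrable_vec[OF square_integrable_fst[OF L2(2)]]
    square_integrable_imp_integrable_vec[OF square_integrable_snd[OF L2(1)]]
    square_integrable_imp_integrable_vec[OF square_integrable_snd[OF L2(2)]]
  have "square_integrable \<mu> (\<lambda>x. F x + c *\<^sub>R G x)"
    by (intro square_integrable_add square_integrable_scaleR L2)
  moreover have "(LINT x|\<mu>. fst (F x + c *\<^sub>R G x)) = 0"
    using int F G by (simp add: W_pairs_def)
  moreover have "has_weak_gradient (pdf_dom p) (\<lambda>x. fst (F x) + c * fst (G x)) (\<lambda>x. snd (F x) + c *\<^sub>R snd (G x))"
    using F G by (intro has_weak_gradient_add_scaleR int) (simp_all add: W_pairs_def)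
  ultimately show ?thesis by (simp add: W_pairs_def)
qed

lemma W_pairs_zero: "(\<lambda>x. 0) \<in> W_pairs"
  by (simp add: W_pairs_def square_integrable_def has_weak_gradient_def locally_integrable_on_def
      set_integrable_def set_lebesgue_integral_def)

text \<open>For a probability measure L^2 convergence implies L^1 convergence, under which both the
  weak gradient identity and the mean pass to the limit.\<close>

lemma W_pairs_closed:
  assumes Fn: "\<And>n::nat. Fn n \<in> W_pairs" and F: "square_integrable \<mu> F"
    and lim: "(\<lambda>n. LINT x|\<mu>. (norm (Fn n x - F x))\<^sup>2) \<longlonglongrightarrow> 0"
  shows "F \<in> W_pairs"
proof -
  have L2: "square_integrable \<mu> (Fn n)" for n using Fn[of n] by (simp add: W_pairs_def)
  have d: "square_integrable \<mu> (\<lambda>x. Fn n x - F x)" for n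
    by (intro square_integrable_diff L2 F)
  have L1: "(\<lambda>n. LINT x|\<mu>. norm (Fn n x - F x)) \<longlonglongrightarrow> 0"
    by (rule tendsto_zero_of_power2_le[OF integral_norm_sq_le[OF d] lim])
  note int = square_integrable_imp_integrable_vec[OF square_integrable_fst[OF L2]]
    square_integrable_imp_integrable_vec[OF square_integrable_fst[OF F]]
    square_integrable_imp_integrable_vec[OF square_integrable_snd[OF L2]]
    square_integrable_imp_integrable_vec[OF square_integrable_snd[OF F]]
  have int_d: "integrable \<mu> (\<lambda>x. norm (Fn n x - F x))" for n
    by (intro integrable_norm square_integrable_imp_integrable_vec d)
  have lim1: "(\<lambda>n. LINT x|\<mu>. \<bar>fst (Fn n x) - fst (F x)\<bar>) \<longlonglongrightarrow> 0"
  proof (rule Lim_null_comparison[OF always_eventually L1], rule allI)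
    fix n
    have "(LINT x|\<mu>. \<bar>fst (Fn n x) - fst (F x)\<bar>) \<le> (LINT x|\<mu>. norm (Fn n x - F x))"
    proof (rule integral_mono[OF _ int_d])
      show "\<bar>fst (Fn n x) - fst (F x)\<bar> \<le> norm (Fn n x - F x)" for x
        using norm_fst_le[of "fst (Fn n x - F x)" "snd (Fn n x - F x)"] unfolding prod.collapse by simp
    qed (use int in auto)
    then show "norm (LINT x|\<mu>. \<bar>fst (Fn n x) - fst (F x)\<bar>) \<le> (LINT x|\<mu>. norm (Fn n x - F x))" by simp
  qed
  have lim2: "(\<lambda>n. LINT x|\<mu>. norm (snd (Fn n x) - snd (F x))) \<longlonglongrightarrow> 0"
  proof (rule Lim_null_comparison[OF always_eventually L1], rule allI)
    fix n
    have "(LINT x|\<mu>. norm (snd (Fn n x) - snd (F x))) \<le> (LINT x|\<mu>. norm (Fn n x - F x))"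
    proof (rule integral_mono[OF _ int_d])
      show "norm (snd (Fn n x) - snd (F x)) \<le> norm (Fn n x - F x)" for x
        using norm_snd_le[of "snd (Fn n x - F x)" "fst (Fn n x - F x)"] unfolding prod.collapse by simp
    qed (use int in auto)
    then show "norm (LINT x|\<mu>. norm (snd (Fn n x) - snd (F x))) \<le> (LINT x|\<mu>. norm (Fn n x - F x))" by simp
  qed
  have "has_weak_gradient (pdf_dom p) (\<lambda>x. fst (F x)) (\<lambda>x. snd (F x))"
  proof (rule has_weak_gradient_limit[OF _ int(1,2,3,4) lim1 lim2])
    show "has_weak_gradient (pdf_dom p) (\<lambda>x. fst (Fn n x)) (\<lambda>x. snd (Fn n x))" for n
      using Fn[of n] by (simp add: W_pairs_def)
  qed
  moreover have "(LINT x|\<mu>. fst (F x)) = 0"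
  proof -
    have "(\<lambda>n. LINT x|\<mu>. fst (Fn n x) * 1) \<longlonglongrightarrow> (LINT x|\<mu>. fst (F x) * 1)"
      by (rule tendsto_integral_mult_bounded[OF int(1,2) lim1, of "\<lambda>_. 1" 1]) simp_all
    moreover have "(LINT x|\<mu>. fst (Fn n x)) = 0" for n
      using Fn[of n] by (simp add: W_pairs_def)
    ultimately show ?thesis by (simp add: LIMSEQ_const_iff)
  qed
  ultimately show ?thesis using F by (simp add: W_pairs_def)
qed

lemma W12_0_pairs:
  assumes "v \<in> W12_0 p"
  shows "(\<lambda>x. (v x, weak_grad (pdf_dom p) v x)) \<in> W_pairs"
proof -
  have "has_weak_gradient (pdf_dom p) v (weak_grad (pdf_dom p) v)"
    using assms someI_ex[of "has_weak_gradient (pdf_dom p) v"]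
    by (simp add: W12_0_def W12_def weakly_differentiable_def weak_grad_def)
  moreover have "square_integrable \<mu> v" "square_integrable \<mu> (weak_grad (pdf_dom p) v)" "(LINT x|\<mu>. v x) = 0"
    using assms by (auto simp: W12_0_def W12_def in_L2_iff square_integrable_def pexp_eq)
  ultimately show ?thesis
    using square_integrable_Pair by (simp add: W_pairs_def)
qed

text \<open>By uniqueness the chosen \<open>weak_grad\<close> agrees almost everywhere with the
  second component; it inherits measurability because Lebesgue measure is complete.\<close>

lemma W_pairs_W12_0:
  assumes F: "F \<in> W_pairs"
  shows "(\<lambda>x. fst (F x)) \<in> W12_0 p"
    and "AE x in \<mu>. weak_grad (pdf_dom p) (\<lambda>x. fst (F x)) x = snd (F x)"
    and "weak_grad (pdf_dom p) (\<lambda>x. fst (F x)) \<in> borel_measurable \<mu>"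
proof -
  define u where "u = (\<lambda>x. fst (F x))"
  define G where "G = (\<lambda>x. snd (F x))"
  have wg: "has_weak_gradient (pdf_dom p) u G" and L2: "square_integrable \<mu> u" "square_integrable \<mu> G"
    and mean: "(LINT x|\<mu>. u x) = 0"
    using F square_integrable_fst[of \<mu> F] square_integrable_snd[of \<mu> F]
    by (simp_all add: W_pairs_def u_def G_def)
  have wg': "has_weak_gradient (pdf_dom p) u (weak_grad (pdf_dom p) u)"
    unfolding weak_grad_def by (rule someI[of "has_weak_gradient (pdf_dom p) u", OF wg])
  have ae: "AE x in \<mu>. weak_grad (pdf_dom p) u x = G x"
    unfolding AE_\<mu>_iff by (rule has_weak_gradient_AE_unique[OF open_dom wg' wg])
  have meas: "weak_grad (pdf_dom p) u \<in> borel_measurable \<mu>"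
  proof -
    have ae': "AE x in lebesgue. indicator (pdf_dom p) x *\<^sub>R G x
        = indicator (pdf_dom p) x *\<^sub>R weak_grad (pdf_dom p) u x"
      using ae[unfolded AE_\<mu>_iff] by eventually_elim (auto simp: indicator_def)
    have "(\<lambda>x. indicator (pdf_dom p) x *\<^sub>R G x) \<in> borel_measurable lebesgue"
      using square_integrable_measurable[OF L2(2)] by (simp add: borel_measurable_\<mu>_iff set_borel_measurable_def)
    from borel_measurable_AE[OF this ae'] show ?thesis
      unfolding borel_measurable_\<mu>_iff set_borel_measurable_def .
  qed
  show "AE x in \<mu>. weak_grad (pdf_dom p) (\<lambda>x. fst (F x)) x = snd (F x)"
    using ae by (simp add: u_def G_def)
  show "weak_grad (pdf_dom p) (\<lambda>x. fst (F x)) \<in> borel_measurable \<mu>"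
    using meas by (simp add: u_def)
  have "square_integrable \<mu> (weak_grad (pdf_dom p) u)"
    by (rule square_integrable_bound[OF L2(2) meas]) (use ae in eventually_elim, simp)
  then have "u \<in> W12_0 p"
    using wg L2(1) mean
    by (auto simp: W12_0_def W12_def in_L2_iff square_integrable_def pexp_eq weakly_differentiable_def)
  then show "(\<lambda>x. fst (F x)) \<in> W12_0 p" by (simp add: u_def)
qed

text \<open>For a fixed point x0 of the support, |f x| <= |x - m| + |m - x0| + |f x0|. Finite
  variance controls the first term and the others are constant.\<close>

lemma square_integrable_lipschitz:
  fixes f :: "'a \<Rightarrow> real"
  assumes lip: "1-lipschitz_on (pdf_dom p) f" and var: "square_integrable \<mu> (\<lambda>x. x - m)"
  shows "square_integrable \<mu> f"
proof -
  obtain x0 where x0: "x0 \<in> pdf_dom p" using not_empty by (auto simp: space_\<mu>)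
  define k where "k x = norm (x - m) + (norm (m - x0) + \<bar>f x0\<bar>)" for x
  have "square_integrable \<mu> (\<lambda>x. norm (x - m))"
    using var by (auto simp: square_integrable_def)
  moreover have "square_integrable \<mu> (\<lambda>x. norm (m - x0) + \<bar>f x0\<bar>)" by (simp add: square_integrable_def)
  ultimately have k: "square_integrable \<mu> k"
    unfolding k_def by (rule square_integrable_add)
  show ?thesis
  proof (rule square_integrable_bound[OF k])
    show "f \<in> borel_measurable \<mu>"
      by (rule measurable_\<mu>_continuous_on[OF lipschitz_on_continuous_on[OF lip]])
    show "AE x in \<mu>. norm (f x) \<le> norm (k x)"
    proof (rule AE_I2)
      fix x assume "x \<in> space \<mu>"
      then have x: "x \<in> pdf_dom p" by (simp add: space_\<mu>)
      have "\<bar>f x - f x0\<bar> \<le> norm (x - x0)"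
        using lipschitz_onD[OF lip x x0] by (simp add: dist_norm)
      moreover have "norm (x - x0) \<le> norm (x - m) + norm (m - x0)"
        using norm_triangle_ineq[of "x - m" "m - x0"] by simp
      ultimately show "norm (f x) \<le> norm (k x)" by (simp add: k_def)
    qed
  qed
qed

text \<open>\<open>finite_variance\<close> speaks of a Borel measure on the whole space; since p
  vanishes off its support, restricting there and completing keeps the integral.\<close>

lemma integrable_\<mu>_of_density:
  fixes f :: "'a \<Rightarrow> real"
  assumes "integrable (density lborel (\<lambda>x. ennreal (p x))) f" "f \<in> borel_measurable borel"
  shows "integrable \<mu> f"
proof -
  have "integrable lborel (\<lambda>x. p x *\<^sub>R f x)"
    using assms by (subst (asm) integrable_density) (simp_all add: p_nonneg)
  then have "integrable lebesgue (\<lambda>x. f x * p x)"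
    using assms(2) by (subst integrable_completion) (simp_all add: mult.commute)
  moreover have "indicator (pdf_dom p) x *\<^sub>R (f x * p x) = f x * p x" for x
    using p_zero[of x] by (auto simp: indicator_def)
  ultimately show ?thesis
    by (simp only: pintegrable_iff[symmetric] pintegrable_def set_integrable_def)
qed

end

section \<open>The weak solution and its gradient bound\<close>

theorem proposition5p15:
  fixes P1 :: "'a::euclidean_space measure" and p1 :: "'a \<Rightarrow> real" and h :: "'a \<Rightarrow> real"
  assumes "prob_space P1"
    and "p1 \<in> borel_measurable borel"
    and "\<And>x. p1 x \<ge> 0"
    and "P1 = density lborel (\<lambda>x. ennreal (p1 x))"
    and "open (pdf_dom p1)"
    and "continuous_on (pdf_dom p1) p1"
    and "\<And>f. f \<in> Lip1 (pdf_dom p1) \<Longrightarrow> pintegrable p1 (\<lambda>x. \<bar>f x\<bar>)"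
    and "finite_variance P1"
    and "poincare_inequality p1"
    and "h \<in> Lip1 (pdf_dom p1)"
  shows "\<exists>g \<in> W12_0 p1.
      (\<forall>v \<in> W12_0 p1.
         pexp p1 (\<lambda>x. weak_grad (pdf_dom p1) v x \<bullet> weak_grad (pdf_dom p1) g x)
           = pexp p1 (\<lambda>x. (h x - pexp p1 h) * v x)) \<and>
      sqrt (pexp p1 (\<lambda>x. (norm (weak_grad (pdf_dom p1) g x))\<^sup>2)) \<le> poincare_constant p1"
proof -
  interpret continuous_pdf p1
  proof
    have "emeasure P1 (space P1) = 1" using assms(1) by (rule prob_space.emeasure_space_1)
    then show "(\<integral>\<^sup>+x. ennreal (p1 x) \<partial>lborel) = 1"
      using assms(2) by (simp add: assms(4) emeasure_density)
  qed (use assms in auto)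
  define m where "m = (LINT y|P1. y)"
  have "integrable P1 (\<lambda>x. (norm (x - m))\<^sup>2)"
    using assms(8) by (simp add: finite_variance_def m_def)
  then have "integrable \<mu> (\<lambda>x. (norm (x - m))\<^sup>2)"
    unfolding assms(4) by (rule integrable_\<mu>_of_density) simp
  then have var: "square_integrable \<mu> (\<lambda>x. x - m)"
    unfolding square_integrable_def
    by (intro conjI measurable_\<mu>_continuous_on continuous_intros)
  \<comment> \<open>Centring keeps the Lipschitz constant and gives mean zero, so that the Poincare
    inequality applies to the datum itself.\<close>
  define hc where "hc x = h x - pexp p1 h" for x
  have h_lip: "1-lipschitz_on (pdf_dom p1) h" using assms(10) by (simp add: Lip1_def)
  have hc_lip: "1-lipschitz_on (pdf_dom p1) hc"
    using h_lip by (simp add: lipschitz_on_def hc_def dist_norm)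
  have h_L2: "square_integrable \<mu> h" and hc_L2: "square_integrable \<mu> hc"
    by (rule square_integrable_lipschitz[OF h_lip var] square_integrable_lipschitz[OF hc_lip var])+
  have hc_mean: "(LINT x|\<mu>. hc x) = 0"
    using square_integrable_imp_integrable_vec[OF h_L2] by (simp add: hc_def pexp_eq prob_space)
  obtain C0 where C0: "poincare_with p1 C0"
    using assms(9) by (auto simp: poincare_inequality_def)
  have poin: "(LINT x|\<mu>. (fst (F x))\<^sup>2) \<le> C * (LINT x|\<mu>. (norm (snd (F x)))\<^sup>2)"
    if "poincare_with p1 C" "F \<in> W_pairs" for C F
    using that(2) square_integrable_fst[of \<mu> F] square_integrable_snd[of \<mu> F]
    by (intro poincare_weak[OF that(1)]) (simp_all add: W_pairs_def)
  obtain F where F: "F \<in> W_pairs"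
    "\<And>\<Phi>. \<Phi> \<in> W_pairs \<Longrightarrow> (LINT x|\<mu>. snd (F x) \<bullet> snd (\<Phi> x)) = (LINT x|\<mu>. hc x * fst (\<Phi> x))"
  proof (rule weak_solution_exists[of W_pairs \<mu> hc C0])
    show "square_integrable \<mu> F" if "F \<in> W_pairs" for F using that by (simp add: W_pairs_def)
    show "C0 \<ge> 0" using C0 by (simp add: poincare_with_def)
    show "F \<in> W_pairs" if "\<And>n::nat. Fn n \<in> W_pairs" "square_integrable \<mu> F"
      "(\<lambda>n. LINT x|\<mu>. (norm (Fn n x - F x))\<^sup>2) \<longlonglongrightarrow> 0" for Fn F
      using that by (rule W_pairs_closed)
    show "(\<lambda>x. F x + c *\<^sub>R G x) \<in> W_pairs" if "F \<in> W_pairs" "G \<in> W_pairs" for F G c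
      using that by (rule W_pairs_add_scaleR)
    show "(LINT x|\<mu>. (fst (F x))\<^sup>2) \<le> C0 * (LINT x|\<mu>. (norm (snd (F x)))\<^sup>2)" if "F \<in> W_pairs" for F
      by (rule poin[OF C0 that])
    show "(\<lambda>x. 0) \<in> W_pairs" by (rule W_pairs_zero)
    show "square_integrable \<mu> hc" by (rule hc_L2)
  qed blast
  define g where "g = (\<lambda>x. fst (F x))"
  have g: "g \<in> W12_0 p1" and ae: "AE x in \<mu>. weak_grad (pdf_dom p1) g x = snd (F x)"
    and meas: "weak_grad (pdf_dom p1) g \<in> borel_measurable \<mu>"
    unfolding g_def using W_pairs_W12_0[OF F(1)] by simp_all
  have F_L2: "square_integrable \<mu> F" using F(1) by (simp add: W_pairs_def)
  have "pexp p1 (\<lambda>x. weak_grad (pdf_dom p1) v x \<bullet> weak_grad (pdf_dom p1) g x)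
      = pexp p1 (\<lambda>x. (h x - pexp p1 h) * v x)" if v: "v \<in> W12_0 p1" for v
  proof -
    have vm: "weak_grad (pdf_dom p1) v \<in> borel_measurable \<mu>"
      using v by (simp add: W12_0_def W12_def in_L2_iff)
    have "pexp p1 (\<lambda>x. weak_grad (pdf_dom p1) v x \<bullet> weak_grad (pdf_dom p1) g x)
        = (LINT x|\<mu>. snd (F x) \<bullet> weak_grad (pdf_dom p1) v x)"
      unfolding pexp_eq
    proof (rule integral_cong_AE)
      show "AE x in \<mu>. weak_grad (pdf_dom p1) v x \<bullet> weak_grad (pdf_dom p1) g x
          = snd (F x) \<bullet> weak_grad (pdf_dom p1) v x"
        using ae by eventually_elim (simp add: inner_commute)
    qed (use vm meas square_integrable_measurable[OF square_integrable_snd[OF F_L2]] in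
        \<open>auto intro: borel_measurable_inner\<close>)
    also have "\<dots> = (LINT x|\<mu>. hc x * v x)"
      using F(2)[OF W12_0_pairs[OF v]] by simp
    finally show ?thesis by (simp add: pexp_eq hc_def)
  qed
  moreover have "sqrt (pexp p1 (\<lambda>x. (norm (weak_grad (pdf_dom p1) g x))\<^sup>2)) \<le> poincare_constant p1"
  proof -
    define N where "N = (LINT x|\<mu>. (norm (snd (F x)))\<^sup>2)"
    have N0: "N \<ge> 0" by (simp add: N_def)
    have "pexp p1 (\<lambda>x. (norm (weak_grad (pdf_dom p1) g x))\<^sup>2) = N"
      unfolding pexp_eq N_def
    proof (rule integral_cong_AE)
      show "AE x in \<mu>. (norm (weak_grad (pdf_dom p1) g x))\<^sup>2 = (norm (snd (F x)))\<^sup>2"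
        using ae by eventually_elim simp
    qed (use meas square_integrable_measurable[OF square_integrable_snd[OF F_L2]] in auto)
    \<comment> \<open>F was obtained from one admissible constant, but its equation does not involve
      it. The bound by every admissible C makes sqrt N a lower bound of the set whose infimum is
      \<open>poincare_constant p1\<close>.\<close>
    moreover have "sqrt N \<le> C" if C: "poincare_with p1 C" for C
    proof (rule real_le_lsqrt)
      show C0: "C \<ge> 0" using C by (simp add: poincare_with_def)
      \<comment> \<open>The weak equation tested with F itself, which belongs to
        \<open>W_pairs\<close>.\<close>
      have "N = (LINT x|\<mu>. hc x \<bullet> fst (F x))"
        using F(2)[OF F(1)] by (simp add: N_def power2_norm_eq_inner)
      then have "N\<^sup>2 \<le> (LINT x|\<mu>. (norm (hc x))\<^sup>2) * (LINT x|\<mu>. (norm (fst (F x)))\<^sup>2)"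
        using integral_Cauchy_Schwarz[OF hc_L2 square_integrable_fst[OF F_L2]] by simp
      also have "\<dots> \<le> C * (C * N)"
        using poincare_lipschitz[OF C hc_lip hc_L2 hc_mean] poin[OF C F(1)] C0
        by (intro mult_mono) (auto simp: N_def)
      finally have "N * N \<le> C\<^sup>2 * N" by (simp add: power2_eq_square mult.assoc)
      then show "N \<le> C\<^sup>2"
        using N0 by (cases "N = 0") auto
    qed
    ultimately show ?thesis
      unfolding poincare_constant_def using C0 by (intro cInf_greatest) auto
  qed
  ultimately show ?thesis using g by blast
qed

end
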